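(* There exists an Antoine's necklace $\mathcal A\subset\mathbb R^3$ such that for each $2$-plane $\Pi\subset\mathbb R^3$ the set $p_\Pi(\mathcal A)$ is connected and one-dimensional.
   Context: A Cantor set is any topological space homeomorphic to the standard middle-thirds Cantor set. A $2$-plane is a $2$-dimensional affine subspace; $p_\Pi:\mathbb R^3\to\Pi$ is the orthogonal projection onto $\Pi$. A circle in $\mathbb R^3$ is a round circle (obtained by rotating a point around a straight line). $\operatorname{Int}$ denotes the interior of a manifold-with-boundary. Dimension is topological (covering) dimension. Standard solid torus: let $P\subset\mathbb R^3$ be a $2$-plane, $D\subset P$ a disk of radius $r>0$ with center $Q$, and $\ell\subset P$ a straight line at distance $d(Q,\ell)=R>r$ from $Q$. A standard solid torus is the solid torus of revolution generated by revolving such a $D$ in $\mathbb R^3$ about $\ell$. Its central circle is the circle generated by $Q$; its center is the center of its central circle. Two disjoint standard solid tori are linked if their central circles are linked (linking number $\pm1$). Simple chain: a simple chain in a standard solid torus $T\subset\mathbb R^3$ is a finite family $T_1,\dots,T_q$, $q\geqslant 3$, of pairwise disjoint congruent standard solid tori such that (1) $T_1\cup\dots\cup T_q\subset\operatorname{Int}T$; (2) the centers of $T_1,\dots,T_q$ are subsequent vertices of a regular convex $q$-gon inscribed in the central circle of $T$; (3) for $i\ne j$, $T_i$ and $T_j$ are linked if $i-j\equiv\pm1 \pmod q$, and are not linked otherwise; (4) for each $i$, the central circle of $T_i$ is null-homotopic in $T$. Antoine's necklace: a Cantor set in $\mathbb R^3$ which can be obtained as an intersection $\mathcal A=\bigcap_{i=1}^\infty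 M_i$, where each $M_i$ is the union of a finite number of pairwise disjoint standard solid tori such that (1) $M_1$ is a standard solid torus; (2) $M_{i+1}\subset\operatorname{Int}M_i$ for each $i\geqslant1$; (3) for each $i\geqslant1$ and each component $T$ of $M_i$, the intersection $M_{i+1}\cap T$ is the union of solid tori which form a simple chain in $T$. *)

theory Defs
  imports "HOL-Analysis.Analysis" "HOL-Number_Theory.Cong"
begin

section \<open>Planes, lines and projections\<close>

definition is_line :: "(real^3) set \<Rightarrow> bool" where
  "is_line L \<longleftrightarrow> affine L \<and> aff_dim L = 1"

definition is_plane :: "(real^3) set \<Rightarrow> bool" where
  "is_plane P \<longleftrightarrow> affine P \<and> aff_dim P = 2"

definition orthogonal_projection :: "(real^3) set \<Rightarrow> real^3 \<Rightarrow> real^3" where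
  "orthogonal_projection P x = (THE y. y \<in> P \<and> (\<forall>z\<in>P. orthogonal (x - y) (z - y)))"


section \<open>Cantor sets\<close>

fun cantor_stage :: "nat \<Rightarrow> real set" where
  "cantor_stage 0 = {0..1}"
| "cantor_stage (Suc n) =
     (\<lambda>x. x / 3) ` cantor_stage n \<union> (\<lambda>x. 2 / 3 + x / 3) ` cantor_stage n"

definition middle_thirds_cantor_set :: "real set" where
  "middle_thirds_cantor_set = (\<Inter>n. cantor_stage n)"

definition is_cantor_set :: "(real^3) set \<Rightarrow> bool" where
  "is_cantor_set A \<longleftrightarrow> A homeomorphic middle_thirds_cantor_set"


section \<open>Covering dimension\<close>

definition covering_dim_le :: "'a topology \<Rightarrow> nat \<Rightarrow> bool" where
  "covering_dim_le X n \<longleftrightarrow>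
     (\<forall>\<U>. finite \<U> \<and> (\<forall>U\<in>\<U>. openin X U) \<and> \<Union>\<U> = topspace X \<longrightarrow>
        (\<exists>\<V>. finite \<V> \<and> (\<forall>V\<in>\<V>. openin X V) \<and> \<Union>\<V> = topspace X \<and>
             (\<forall>V\<in>\<V>. \<exists>U\<in>\<U>. V \<subseteq> U) \<and>
             (\<forall>x\<in>topspace X. card {V \<in> \<V>. x \<in> V} \<le> n + 1)))"

text \<open>The empty space has dimension $-1$ and is therefore excluded.\<close>

definition has_covering_dim :: "'a topology \<Rightarrow> nat \<Rightarrow> bool" where
  "has_covering_dim X n \<longleftrightarrow>
     topspace X \<noteq> {} \<and> covering_dim_le X n \<and> (\<forall>m<n. \<not> covering_dim_le X m)"


section \<open>Round circles and linking\<close>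

text \<open>\<open>g\<close> runs once around the round circle \<open>C\<close> with center \<open>c\<close>, at constant speed.\<close>

definition circle_parametrization :: "(real^3) set \<Rightarrow> real^3 \<Rightarrow> (real \<Rightarrow> real^3) \<Rightarrow> bool" where
  "circle_parametrization C c g \<longleftrightarrow>
     (\<exists>u v \<rho>. norm u = 1 \<and> norm v = 1 \<and> orthogonal u v \<and> \<rho> > 0 \<and>
        g = (\<lambda>t. c + \<rho> *\<^sub>R (cos (2 * pi * t) *\<^sub>R u + sin (2 * pi * t) *\<^sub>R v)) \<and>
        C = g ` {0..1})"

definition circle_center :: "(real^3) set \<Rightarrow> real^3" where
  "circle_center C = (THE c. \<exists>g. circle_parametrization C c g)"

text \<open>The Gauss integral, which gives the linking number of two disjoint smooth closed curves
  parametrized by \<open>[0,1]\<close>. The sign convention plays no role below.\<close>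

definition linking_number :: "(real \<Rightarrow> real^3) \<Rightarrow> (real \<Rightarrow> real^3) \<Rightarrow> real" where
  "linking_number g h =
     1 / (4 * pi) *
     integral (cbox (0, 0) (1, 1))
       (\<lambda>(s, t). ((g s - h t) \<bullet> cross3 (vector_derivative g (at s)) (vector_derivative h (at t)))
                 / norm (g s - h t) ^ 3)"

text \<open>Changing the parametrizations can only change the sign of the linking number.\<close>

definition linked_circles :: "(real^3) set \<Rightarrow> (real^3) set \<Rightarrow> bool" where
  "linked_circles C C' \<longleftrightarrow>
     (\<exists>c g c' g'. circle_parametrization C c g \<and> circle_parametrization C' c' g' \<and>
        \<bar>linking_number g g'\<bar> = 1)"


section \<open>Standard solid tori\<close>

text \<open>Rotation by the angle \<open>\<theta>\<close> about the line through \<open>a\<close> with unit direction vector \<open>e\<close>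
  (Rodrigues' formula).\<close>

definition rotate_about :: "real^3 \<Rightarrow> real^3 \<Rightarrow> real \<Rightarrow> real^3 \<Rightarrow> real^3" where
  "rotate_about a e \<theta> x =
     a + cos \<theta> *\<^sub>R (x - a) + sin \<theta> *\<^sub>R cross3 e (x - a)
       + ((1 - cos \<theta>) * (e \<bullet> (x - a))) *\<^sub>R e"

definition revolve :: "(real^3) set \<Rightarrow> (real^3) set \<Rightarrow> (real^3) set" where
  "revolve L S = {rotate_about a e \<theta> x | a e \<theta> x. a \<in> L \<and> a + e \<in> L \<and> norm e = 1 \<and> x \<in> S}"

text \<open>\<open>T\<close> is generated by revolving about the line \<open>L\<close> the disk of radius \<open>r\<close>
  with center \<open>Q\<close> in the plane \<open>P\<close>.\<close>

definition torus_generated_by ::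
  "(real^3) set \<Rightarrow> (real^3) set \<Rightarrow> real^3 \<Rightarrow> real \<Rightarrow> (real^3) set \<Rightarrow> bool" where
  "torus_generated_by T P Q r L \<longleftrightarrow>
     is_plane P \<and> Q \<in> P \<and> r > 0 \<and> is_line L \<and> L \<subseteq> P \<and> infdist Q L > r \<and>
     T = revolve L (cball Q r \<inter> P)"

definition standard_solid_torus :: "(real^3) set \<Rightarrow> bool" where
  "standard_solid_torus T \<longleftrightarrow> (\<exists>P Q r L. torus_generated_by T P Q r L)"

text \<open>The central circle depends only on the point set \<open>T\<close>, not on the generating data.\<close>

definition central_circle :: "(real^3) set \<Rightarrow> (real^3) set" where
  "central_circle T = (THE C. \<exists>P Q r L. torus_generated_by T P Q r L \<and> C = revolve L {Q})"

definition torus_center :: "(real^3) set \<Rightarrow> real^3" where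
  "torus_center T = circle_center (central_circle T)"

definition linked_tori :: "(real^3) set \<Rightarrow> (real^3) set \<Rightarrow> bool" where
  "linked_tori T T' \<longleftrightarrow> linked_circles (central_circle T) (central_circle T')"

definition congruent_sets :: "(real^3) set \<Rightarrow> (real^3) set \<Rightarrow> bool" where
  "congruent_sets S T \<longleftrightarrow> (\<exists>f. (\<forall>x y. dist (f x) (f y) = dist x y) \<and> f ` S = T)"


section \<open>Simple chains and Antoine's necklaces\<close>

text \<open>\<open>p 1, \<dots>, p q\<close> are subsequent vertices of a regular convex \<open>q\<close>-gon inscribed in \<open>C\<close>.\<close>

definition regular_polygon_in :: "(real^3) set \<Rightarrow> nat \<Rightarrow> (nat \<Rightarrow> real^3) \<Rightarrow> bool" where
  "regular_polygon_in C q p \<longleftrightarrow>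
     (\<exists>c g. circle_parametrization C c g \<and> (\<forall>i\<in>{1..q}. p i = g (real i / real q)))"

definition simple_chain :: "(real^3) set \<Rightarrow> nat \<Rightarrow> (nat \<Rightarrow> (real^3) set) \<Rightarrow> bool" where
  "simple_chain T q S \<longleftrightarrow>
     standard_solid_torus T \<and> q \<ge> 3 \<and>
     (\<forall>i\<in>{1..q}. standard_solid_torus (S i)) \<and>
     (\<forall>i\<in>{1..q}. \<forall>j\<in>{1..q}. i \<noteq> j \<longrightarrow> S i \<inter> S j = {}) \<and>
     (\<forall>i\<in>{1..q}. \<forall>j\<in>{1..q}. congruent_sets (S i) (S j)) \<and>
     (\<Union>i\<in>{1..q}. S i) \<subseteq> interior T \<and>
     regular_polygon_in (central_circle T) q (\<lambda>i. torus_center (S i)) \<and>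
     (\<forall>i\<in>{1..q}. \<forall>j\<in>{1..q}. i \<noteq> j \<longrightarrow>
        (linked_tori (S i) (S j) \<longleftrightarrow>
           [int i - int j = 1] (mod int q) \<or> [int i - int j = - 1] (mod int q))) \<and>
     (\<forall>i\<in>{1..q}. \<exists>a. homotopic_with_canon (\<lambda>_. True) (central_circle (S i)) T (\<lambda>x. x) (\<lambda>_. a))"

text \<open>Only the values \<open>M i\<close> with \<open>i \<ge> 1\<close> matter.\<close>

definition antoine_necklace :: "(real^3) set \<Rightarrow> bool" where
  "antoine_necklace A \<longleftrightarrow>
     is_cantor_set A \<and>
     (\<exists>M :: nat \<Rightarrow> (real^3) set.
        A = (\<Inter>i\<in>{1..}. M i) \<and>
        (\<forall>i\<ge>1. \<exists>\<T>. finite \<T> \<and> (\<forall>T\<in>\<T>. standard_solid_torus T) \<and> disjoint \<T> \<and> M i = \<Union>\<T>) \<and>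
        standard_solid_torus (M 1) \<and>
        (\<forall>i\<ge>1. M (i + 1) \<subseteq> interior (M i)) \<and>
        (\<forall>i\<ge>1. \<forall>T\<in>components (M i).
           \<exists>q S. simple_chain T q S \<and> M (i + 1) \<inter> T = (\<Union>k\<in>{1..q}. S k)))"

end

theory Submission
  imports Defs "HOL-Complex_Analysis.Complex_Analysis"
begin

text \<open>The necklace is the attractor of \<open>q = 16000\<close> similarities of ratio \<open>\<rho> < 1/3000\<close> which place congruent thin
  tori, alternately horizontal and vertical, on the unit circle.

  The shadow of the necklace has area zero because \<open>q \<rho>\<^sup>2 < 1\<close>, and a compact planar null set is at most
  one-dimensional: cover it along a grid whose vertices avoid it.  It is connected because, in every direction and at
  every stage, the shadows of neighbouring links meet.  That property passes to the next stage: each of two neighbouring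
  links contains a closed chain of smaller links whose shadow is connected, and the two chains contain arcs whose
  shadows traverse a rectangle in perpendicular directions.

  The linking numbers are computed from a vector potential of the monopole field \<open>x / |x|\<^sup>3\<close> with singular ray opposite
  to \<open>d\<close>: the Gauss integrand becomes an exact form wherever the differences of the curves avoid that ray.\<close>

section \<open>The Gauss integral through a monopole potential\<close>

text \<open>Two demands compete. Links must be big enough for neighbours to be linked and to have
  meeting shadows along every line of sight, yet the shadow must have area zero. Linked neighbours
  on the unit circle keep q \<rho> bounded below; here the chord 2 sin (pi / q) equals 3/2 \<rho>,
  so q \<rho> is about 4 pi / 3 and q \<rho>^2 about (4 pi / 3)^2 / q. Many links thus destroy the
  area without loosening the chain. The number 16000 is even, so the alternation closes up;
  divisible by 8, so the arcs used for crossings end at vertices; and so large that neighbours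
  differ from two perpendicular circles with centres 3/2 radii apart by at most 1/300 of a radius.
  The necklace contains no arcs, so the crossing argument runs on thick stages that start from a
  ball, and connectedness passes to the limit. Each link sees the line of sight rotated, hence the
  invariant speaks of all unit directions at once. The Gauss integral is cut where one circle
  pierces the plane of the other, which leaves planar winding numbers.\<close>

definition monopole_potential :: "real^3 \<Rightarrow> real^3 \<Rightarrow> real^3" where
  "monopole_potential d x = (1 / (norm x * (norm x + d \<bullet> x))) *\<^sub>R cross3 d x"

text \<open>The directional derivative of the potential at x along w, written out so that continuity
  and the fundamental theorem of calculus can be applied to it. For a unit vector d the denominator
  vanishes exactly on the closed ray opposite to d.\<close>

definition monopole_potential_deriv :: "real^3 \<Rightarrow> real^3 \<Rightarrow> real^3 \<Rightarrow> real^3" where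
  "monopole_potential_deriv d x w =
     (1 / (norm x * (norm x + d \<bullet> x))) *\<^sub>R cross3 d w
     - ((2 * (x \<bullet> w) + (x \<bullet> w) * (d \<bullet> x) / norm x + norm x * (d \<bullet> w)) / (norm x * (norm x + d \<bullet> x))\<^sup>2) *\<^sub>R cross3 d x"

lemma has_vector_derivative_cross3_right:
  assumes "(f has_vector_derivative f') F"
  shows "((\<lambda>t. cross3 d (f t)) has_vector_derivative cross3 d f') F"
proof -
  have "bounded_linear (cross3 d)"
    by (rule bilinear_conv_bounded_bilinear[THEN iffD1, OF bilinear_cross, THEN bounded_bilinear.bounded_linear_right])
  from bounded_linear.has_vector_derivative[OF this assms] show ?thesis .
qed

lemma continuous_on_cross3:
  assumes "continuous_on S f" "continuous_on S g"
  shows "continuous_on S (\<lambda>t. cross3 (f t) (g t))"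
  using bounded_bilinear.continuous_on[OF bilinear_conv_bounded_bilinear[THEN iffD1, OF bilinear_cross] assms] .

lemma monopole_potential_has_vector_derivative:
  fixes f :: "real \<Rightarrow> real^3"
  assumes f: "(f has_vector_derivative w) (at t within S)"
    and x: "f t \<noteq> 0" "norm (f t) + d \<bullet> f t > 0"
  shows "((\<lambda>t. monopole_potential d (f t)) has_vector_derivative monopole_potential_deriv d (f t) w) (at t within S)"
proof -
  let ?x = "f t"
  have n: "((\<lambda>t. norm (f t)) has_real_derivative (?x \<bullet> w) / norm ?x) (at t within S)"
  proof -
    have "((\<lambda>t. f t \<bullet> f t) has_real_derivative (2 * (?x \<bullet> w))) (at t within S)"
      using has_vector_derivative_def f
      by (auto intro!: derivative_eq_intros simp: has_vector_derivative_def has_field_derivative_def inner_commute algebra_simps fun_eq_iff)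
    moreover have "?x \<bullet> ?x > 0" using x by simp
    ultimately show ?thesis unfolding norm_eq_sqrt_inner using x
      by (auto intro!: derivative_eq_intros simp: field_simps) (meson inner_ge_zero leD)
  qed
  have dx: "((\<lambda>t. d \<bullet> f t) has_real_derivative (d \<bullet> w)) (at t within S)"
    using f by (auto intro!: derivative_eq_intros simp: has_vector_derivative_def has_field_derivative_def algebra_simps fun_eq_iff)
  have nz: "norm ?x * (norm ?x + d \<bullet> ?x) \<noteq> 0" using x by simp
  have D: "((\<lambda>t. 1 / (norm (f t) * (norm (f t) + d \<bullet> f t))) has_real_derivative
      - ((2 * (?x \<bullet> w) + (?x \<bullet> w) * (d \<bullet> ?x) / norm ?x + norm ?x * (d \<bullet> w)) / (norm ?x * (norm ?x + d \<bullet> ?x))\<^sup>2)) (at t within S)"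
  proof -
    have E: "((\<lambda>t. norm (f t) * (norm (f t) + d \<bullet> f t)) has_real_derivative
        2 * (?x \<bullet> w) + (?x \<bullet> w) * (d \<bullet> ?x) / norm ?x + norm ?x * (d \<bullet> w)) (at t within S)"
      by (rule DERIV_cong[OF DERIV_mult[OF n DERIV_add[OF n dx]]]) (use x in \<open>simp add: field_simps\<close>)
    show ?thesis
      by (rule DERIV_cong[OF DERIV_divide[OF DERIV_const E nz]])
         (simp only: power2_eq_square mult_zero_left mult_1_left diff_0 minus_divide_left)
  qed
  have c: "((\<lambda>t. cross3 d (f t)) has_vector_derivative cross3 d w) (at t within S)"
    by (rule has_vector_derivative_cross3_right[OF f])
  show ?thesis
    unfolding monopole_potential_def monopole_potential_deriv_def
    using has_vector_derivative_scaleR[OF D c] by (simp add: algebra_simps)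
qed

text \<open>The left side is the exterior derivative of the potential, read as a 1-form, on the pair
  v, w; so the curl is the monopole field. With G the gradient of the denominator D, only two
  products matter: G . x = 2 D, which is Euler's relation in degree 2, and G . d = D^2 /
  n^3.\<close>

lemma curl_monopole_potential:
  fixes d x v w :: "real^3"
  assumes d: "norm d = 1" and x: "x \<noteq> 0" "norm x + d \<bullet> x > 0"
  shows "monopole_potential_deriv d x v \<bullet> w - monopole_potential_deriv d x w \<bullet> v = x \<bullet> cross3 v w / norm x ^ 3"
proof -
  define n where "n = norm x"
  define D where "D = n * (n + d \<bullet> x)"
  have n: "n > 0" "n * n = x \<bullet> x" using x by (auto simp: n_def power2_norm_eq_inner[symmetric] power2_eq_square)
  have D: "D > 0" using x n by (simp add: D_def n_def)
  have dd: "d \<bullet> d = 1" using d by (simp add: norm_eq_1)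
  define G where "G = 2 *\<^sub>R x + ((d \<bullet> x) / n) *\<^sub>R x + n *\<^sub>R d"
  have e1: "monopole_potential_deriv d x v \<bullet> w - monopole_potential_deriv d x w \<bullet> v =
     2 * (d \<bullet> cross3 v w) / D - (cross3 d x \<bullet> ((G \<bullet> v) *\<^sub>R w - (G \<bullet> w) *\<^sub>R v)) / D\<^sup>2"
  proof -
    have "cross3 d v \<bullet> w = d \<bullet> cross3 v w" "cross3 d w \<bullet> v = - (d \<bullet> cross3 v w)"
      by (simp_all add: cross3_simps)
    then show ?thesis
      unfolding monopole_potential_deriv_def G_def n_def[symmetric] D_def[symmetric]
      by (simp add: inner_diff_left inner_diff_right inner_add_left algebra_simps add_divide_distrib diff_divide_distrib)
  qed
  \<comment> \<open>The bracket is - G x (v x w) by the triple product expansion; the Binet-Cauchy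
    identity does the rest.\<close>
  have e2: "cross3 d x \<bullet> ((G \<bullet> v) *\<^sub>R w - (G \<bullet> w) *\<^sub>R v) = - ((x \<bullet> cross3 v w) * (G \<bullet> d) - (d \<bullet> cross3 v w) * (G \<bullet> x))"
    by (simp add: cross3_simps)
  have Gx: "G \<bullet> x = 2 * D" using n unfolding G_def D_def
    by (simp add: inner_add_left field_simps flip: n(2))
  have Gd: "G \<bullet> d = D\<^sup>2 / n ^ 3" using n dd unfolding G_def D_def
    by (simp add: inner_add_left inner_add_right inner_commute[of x d] field_simps power2_eq_square power3_eq_cube flip: n(2))
  show ?thesis unfolding e1 e2 Gx Gd n_def[symmetric] using D n(1)
    by (simp add: field_simps power2_eq_square)
qed

lemma monopole_potential_deriv_minus:
  "monopole_potential_deriv d x (- w) = - monopole_potential_deriv d x w"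
  unfolding monopole_potential_deriv_def
  by (simp add: cross_minus_right vec_eq_iff diff_divide_distrib add_divide_distrib algebra_simps)

lemma continuous_on_monopole_potential_deriv:
  fixes f w :: "'a::topological_space \<Rightarrow> real^3"
  assumes "continuous_on S f" "continuous_on S w"
    and "\<And>p. p \<in> S \<Longrightarrow> norm (f p) + d \<bullet> f p > 0"
  shows "continuous_on S (\<lambda>p. monopole_potential_deriv d (f p) (w p))"
proof -
  have "f p \<noteq> 0" if "p \<in> S" for p using assms(3)[OF that] by auto
  with assms(3) show ?thesis
    unfolding monopole_potential_deriv_def
    by (intro continuous_intros continuous_on_cross3 assms(1,2)) (auto simp: less_imp_neq[symmetric])
qed

section \<open>The Gauss integral over strips on which the potential is regular\<close>

definition gauss_kernel :: "(real \<Rightarrow> real^3) \<Rightarrow> (real \<Rightarrow> real^3) \<Rightarrow> (real \<Rightarrow> real^3) \<Rightarrow> (real \<Rightarrow> real^3) \<Rightarrow> real \<Rightarrow> real \<Rightarrow> real" where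
  "gauss_kernel g g' h h' s t = ((g s - h t) \<bullet> cross3 (g' s) (h' t)) / norm (g s - h t) ^ 3"

lemma continuous_on_gauss_kernel:
  assumes "continuous_on UNIV g" "continuous_on UNIV g'" "continuous_on UNIV h" "continuous_on UNIV h'"
    and "\<And>s t. s \<in> A \<Longrightarrow> t \<in> B \<Longrightarrow> g s \<noteq> h t"
  shows "continuous_on (A \<times> B) (\<lambda>(s, t). gauss_kernel g g' h h' s t)"
proof -
  have c: "continuous_on S (\<lambda>p. f (fst p))" "continuous_on S (\<lambda>p. f (snd p))"
    if "continuous_on UNIV f" for S :: "(real \<times> real) set" and f :: "real \<Rightarrow> real^3"
    by (rule continuous_on_compose2[OF that]; auto intro!: continuous_intros)+
  show ?thesis
    unfolding gauss_kernel_def case_prod_unfold using assms(5)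
    by (intro continuous_intros continuous_on_cross3 c assms) auto
qed

text \<open>Stokes' theorem on the strip [0,1] x [a,b]. Away from the singular ray the kernel is an
  exterior derivative; the sides s = 0 and s = 1 cancel because g is closed, and only the two edges
  t = a and t = b contribute.\<close>

lemma gauss_kernel_strip:
  assumes g: "\<And>s. (g has_vector_derivative g' s) (at s)" and h: "\<And>t. (h has_vector_derivative h' t) (at t)"
    and cg': "continuous_on UNIV g'" and ch': "continuous_on UNIV h'"
    and per: "g 0 = g 1" and d: "norm d = 1" and ab: "a \<le> b"
    and pos: "\<And>s t. s \<in> {0..1} \<Longrightarrow> t \<in> {a..b} \<Longrightarrow> norm (g s - h t) + d \<bullet> (g s - h t) > 0"
  shows "integral {a..b} (\<lambda>t. integral {0..1} (\<lambda>s. gauss_kernel g g' h h' s t)) =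
    integral {0..1} (\<lambda>s. monopole_potential d (g s - h b) \<bullet> g' s)
    - integral {0..1} (\<lambda>s. monopole_potential d (g s - h a) \<bullet> g' s)"
proof -
  define F1 where "F1 = (\<lambda>s t. monopole_potential_deriv d (g s - h t) (g' s) \<bullet> h' t)"
  define F2 where "F2 = (\<lambda>s t. monopole_potential_deriv d (g s - h t) (h' t) \<bullet> g' s)"
  have nz: "g s - h t \<noteq> 0" if "s \<in> {0..1}" "t \<in> {a..b}" for s t using pos[OF that] by auto
  have cg: "continuous_on UNIV g" and ch: "continuous_on UNIV h"
    using g h by (auto intro!: continuous_at_imp_continuous_on has_vector_derivative_continuous)
  have c: "continuous_on S (\<lambda>p. f (fst p))" "continuous_on S (\<lambda>p. f (snd p))"
    if "continuous_on UNIV f" for S :: "(real \<times> real) set" and f :: "real \<Rightarrow> real^3"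
    by (rule continuous_on_compose2[OF that]; auto intro!: continuous_intros)+
  have c1: "continuous_on (cbox (0,a) (1,b)) (\<lambda>(s,t). F1 s t)"
    unfolding F1_def case_prod_unfold
    by (intro continuous_intros continuous_on_monopole_potential_deriv c cg ch cg' ch')
       (auto intro!: pos simp: cbox_Pair_eq)
  have c2: "continuous_on (cbox (0,a) (1,b)) (\<lambda>(s,t). F2 s t)"
    unfolding F2_def case_prod_unfold
    by (intro continuous_intros continuous_on_monopole_potential_deriv c cg ch cg' ch')
       (auto intro!: pos simp: cbox_Pair_eq)
  have sec: "continuous_on {0..1} (\<lambda>s. F s t)" "continuous_on {a..b} (\<lambda>t. F s t)"
    if "continuous_on (cbox (0,a) (1,b)) (\<lambda>(s,t). F s t)" "s \<in> {0..1}" "t \<in> {a..b}" for F :: "real \<Rightarrow> real \<Rightarrow> real" and s t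
  proof -
    show "continuous_on {0..1} (\<lambda>s. F s t)"
      by (rule continuous_on_compose2[OF that(1), of "{0..1}" "\<lambda>s. (s,t)", unfolded prod.case])
         (use that in \<open>auto intro!: continuous_intros simp: cbox_Pair_eq\<close>)
    show "continuous_on {a..b} (\<lambda>t. F s t)"
      by (rule continuous_on_compose2[OF that(1), of "{a..b}" "\<lambda>t. (s,t)", unfolded prod.case])
         (use that in \<open>auto intro!: continuous_intros simp: cbox_Pair_eq\<close>)
  qed
  \<comment> \<open>\<open>F1\<close> is the s-derivative of A (g s - h t) . h' t, with A the
    potential.\<close>
  have i1: "integral {0..1} (\<lambda>s. F1 s t) = 0" if t: "t \<in> {a..b}" for t
  proof -
    have "((\<lambda>s. F1 s t) has_integral (monopole_potential d (g 1 - h t) \<bullet> h' t - monopole_potential d (g 0 - h t) \<bullet> h' t)) {0..1}"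
    proof (rule fundamental_theorem_of_calculus)
      fix s :: real assume s: "s \<in> {0..1}"
      have "((\<lambda>s. g s - h t) has_vector_derivative g' s) (at s within {0..1})"
        using has_vector_derivative_diff[OF has_vector_derivative_at_within[OF g] has_vector_derivative_const] by simp
      from monopole_potential_has_vector_derivative[OF this nz[OF s t] pos[OF s t]]
      have "((\<lambda>s. monopole_potential d (g s - h t)) has_vector_derivative
        monopole_potential_deriv d (g s - h t) (g' s)) (at s within {0..1})" .
      from bounded_linear.has_vector_derivative[OF bounded_linear_inner_left this, of "h' t"]
      show "((\<lambda>s. monopole_potential d (g s - h t) \<bullet> h' t) has_vector_derivative F1 s t) (at s within {0..1})"
        unfolding F1_def .
    qed simp
    then show ?thesis using per by (simp add: integral_unique)
  qed
  \<comment> \<open>As t grows the argument g s - h t moves with velocity - h' t, so it is -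
    \<open>F2\<close> that is the t-derivative of A (g s - h t) . g' s.\<close>
  have i2: "integral {a..b} (\<lambda>t. F2 s t) = monopole_potential d (g s - h a) \<bullet> g' s - monopole_potential d (g s - h b) \<bullet> g' s" if s: "s \<in> {0..1}" for s
  proof -
    have "((\<lambda>t. - F2 s t) has_integral (monopole_potential d (g s - h b) \<bullet> g' s - monopole_potential d (g s - h a) \<bullet> g' s)) {a..b}"
    proof (rule fundamental_theorem_of_calculus[OF ab])
      fix t :: real assume t: "t \<in> {a..b}"
      have "((\<lambda>t. g s - h t) has_vector_derivative - h' t) (at t within {a..b})"
        using has_vector_derivative_diff[OF has_vector_derivative_const has_vector_derivative_at_within[OF h]] by simp
      from monopole_potential_has_vector_derivative[OF this nz[OF s t] pos[OF s t]]
      have "((\<lambda>t. monopole_potential d (g s - h t)) has_vector_derivative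
        monopole_potential_deriv d (g s - h t) (- h' t)) (at t within {a..b})" .
      from bounded_linear.has_vector_derivative[OF bounded_linear_inner_left this, of "g' s"]
      show "((\<lambda>t. monopole_potential d (g s - h t) \<bullet> g' s) has_vector_derivative - F2 s t) (at t within {a..b})"
        unfolding F2_def by (simp add: monopole_potential_deriv_minus)
    qed
    from has_integral_neg[OF this] show ?thesis by (simp add: integral_unique)
  qed
  have k: "gauss_kernel g g' h h' s t = F1 s t - F2 s t" if "s \<in> {0..1}" "t \<in> {a..b}" for s t
    unfolding gauss_kernel_def F1_def F2_def
    using curl_monopole_potential[OF d nz[OF that] pos[OF that]] by simp
  have "integral {a..b} (\<lambda>t. integral {0..1} (\<lambda>s. gauss_kernel g g' h h' s t))
      = integral {a..b} (\<lambda>t. - integral {0..1} (\<lambda>s. F2 s t))"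
  proof (rule integral_cong)
    fix t assume t: "t \<in> {a..b}"
    have "integral {0..1} (\<lambda>s. gauss_kernel g g' h h' s t) = integral {0..1} (\<lambda>s. F1 s t - F2 s t)"
      by (rule integral_cong) (rule k[OF _ t])
    also have "\<dots> = integral {0..1} (\<lambda>s. F1 s t) - integral {0..1} (\<lambda>s. F2 s t)"
      by (intro integral_diff integrable_continuous_interval sec(1)[OF c1 _ t, of 0] sec(1)[OF c2 _ t, of 0]) auto
    finally show "integral {0..1} (\<lambda>s. gauss_kernel g g' h h' s t) = - integral {0..1} (\<lambda>s. F2 s t)"
      by (simp add: i1[OF t])
  qed
  also have "\<dots> = - integral {0..1} (\<lambda>s. integral {a..b} (\<lambda>t. F2 s t))"
    using integral_swap_continuous[OF c2] by simp
  also have "integral {0..1} (\<lambda>s. integral {a..b} (\<lambda>t. F2 s t)) =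
     integral {0..1} (\<lambda>s. monopole_potential d (g s - h a) \<bullet> g' s - monopole_potential d (g s - h b) \<bullet> g' s)"
    by (rule integral_cong) (simp add: i2)
  also have "\<dots> = integral {0..1} (\<lambda>s. monopole_potential d (g s - h a) \<bullet> g' s)
     - integral {0..1} (\<lambda>s. monopole_potential d (g s - h b) \<bullet> g' s)"
  proof (rule integral_diff)
    have "(\<lambda>s. monopole_potential d (g s - h t) \<bullet> g' s) integrable_on {0..1}" if t: "t \<in> {a..b}" for t
      unfolding monopole_potential_def
      using nz[OF _ t] pos[OF _ t]
      by (intro integrable_continuous_interval continuous_intros continuous_on_cross3 continuous_on_subset[OF cg] continuous_on_subset[OF cg'])
         (auto simp: less_imp_neq[symmetric])
    with ab show "(\<lambda>s. monopole_potential d (g s - h a) \<bullet> g' s) integrable_on {0..1}"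
      "(\<lambda>s. monopole_potential d (g s - h b) \<bullet> g' s) integrable_on {0..1}" by auto
  qed
  finally show ?thesis by simp
qed

text \<open>Fubini for a kernel that is continuous because the curves are disjoint. The variable s
  is put inside to match the strip formula, and integrability in t allows the range of t to be cut
  into two strips.\<close>

lemma linking_number_iterated:
  assumes g: "\<And>s. (g has_vector_derivative g' s) (at s)" and h: "\<And>t. (h has_vector_derivative h' t) (at t)"
    and cg': "continuous_on UNIV g'" and ch': "continuous_on UNIV h'"
    and disj: "\<And>s t. s \<in> {0..1} \<Longrightarrow> t \<in> {0..1} \<Longrightarrow> g s \<noteq> h t"
  shows "linking_number g h = 1 / (4 * pi) * integral {0..1} (\<lambda>t. integral {0..1} (\<lambda>s. gauss_kernel g g' h h' s t))"
    and "(\<lambda>t. integral {0..1} (\<lambda>s. gauss_kernel g g' h h' s t)) integrable_on {0..1}"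
proof -
  have cg: "continuous_on UNIV g" and ch: "continuous_on UNIV h"
    using g h by (auto intro!: continuous_at_imp_continuous_on has_vector_derivative_continuous)
  have v: "vector_derivative g (at s) = g' s" "vector_derivative h (at t) = h' t" for s t
    using g h by (auto intro: vector_derivative_at)
  have c: "continuous_on (cbox (0,0) (1,1)) (\<lambda>(s,t). gauss_kernel g g' h h' s t)"
    using continuous_on_gauss_kernel[OF cg cg' ch ch', of "{0..1}" "{0..1}"] disj by (simp add: cbox_Pair_eq)
  have "linking_number g h = 1 / (4 * pi) * integral (cbox (0,0) (1,1)) (\<lambda>(s,t). gauss_kernel g g' h h' s t)"
    unfolding linking_number_def gauss_kernel_def v ..
  also have "\<dots> = 1 / (4 * pi) * integral {0..1} (\<lambda>s. integral {0..1} (\<lambda>t. gauss_kernel g g' h h' s t))"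
    using integral_prod_continuous[OF c] by simp
  finally show "linking_number g h = 1 / (4 * pi) * integral {0..1} (\<lambda>t. integral {0..1} (\<lambda>s. gauss_kernel g g' h h' s t))"
    using integral_swap_continuous[OF c] by simp
  have c': "continuous_on (cbox 0 1 \<times> cbox 0 1) (\<lambda>(t,s). gauss_kernel g g' h h' s t)"
    using continuous_on_swap_args[OF c[unfolded cbox_Pair_eq]] by simp
  show "(\<lambda>t. integral {0..1} (\<lambda>s. gauss_kernel g g' h h' s t)) integrable_on {0..1}"
    using integral_continuous_on_param[OF c'] by (intro integrable_continuous_interval) simp
qed

text \<open>A single strip suffices: differences with positive d-component never meet the singular
  ray, and the two edge terms agree because h is closed.\<close>

lemma linking_number_separated:
  assumes g: "\<And>s. (g has_vector_derivative g' s) (at s)" and h: "\<And>t. (h has_vector_derivative h' t) (at t)"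
    and cg': "continuous_on UNIV g'" and ch': "continuous_on UNIV h'"
    and per: "g 0 = g 1" "h 0 = h 1" and pos: "\<And>s t. d \<bullet> (g s - h t) > 0"
  shows "linking_number g h = 0"
proof -
  define e where "e = d /\<^sub>R norm d"
  have "d \<noteq> 0" using pos by force
  then have e: "norm e = 1" "e \<bullet> (g s - h t) > 0" for s t
    using pos[of s t] by (auto simp: e_def)
  have ne: "g s \<noteq> h t" for s t using pos[of s t] by auto
  have pos': "norm (g s - h t) + e \<bullet> (g s - h t) > 0" for s t using e(2)[of s t] norm_ge_zero[of "g s - h t"] by linarith
  show ?thesis
    unfolding linking_number_iterated(1)[OF g h cg' ch' ne]
      gauss_kernel_strip[OF g h cg' ch' per(1) e(1) zero_le_one pos'] using per by simp
qed

text \<open>On each half of the parameter interval h stays on one side of the plane of g, so the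
  potential whose ray points the other way is regular there. At times 0 and 1/2 the differences are
  orthogonal to d, where the potentials for d and - d are opposite and equal, up to sign, to the
  angular form d x X / |X|^2. The change of potential doubles that form, and what survives is the
  difference of the winding integrals of g around \<open>h 0\<close> and
  \<open>h (1/2)\<close>.\<close>

lemma linking_number_halves:
  assumes g: "\<And>s. (g has_vector_derivative g' s) (at s)" and h: "\<And>t. (h has_vector_derivative h' t) (at t)"
    and cg': "continuous_on UNIV g'" and ch': "continuous_on UNIV h'"
    and per: "g 0 = g 1" "h 0 = h 1" and d: "norm d = 1"
    and disj: "\<And>s t. g s \<noteq> h t"
    and lo: "\<And>s t. t \<in> {0..1/2} \<Longrightarrow> d \<bullet> (g s - h t) \<le> 0" and hi: "\<And>s t. t \<in> {1/2..1} \<Longrightarrow> d \<bullet> (g s - h t) \<ge> 0"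
  shows "linking_number g h = 1 / (2 * pi) *
    (integral {0..1} (\<lambda>s. cross3 d (g s - h 0) \<bullet> g' s / norm (g s - h 0) ^ 2)
     - integral {0..1} (\<lambda>s. cross3 d (g s - h (1/2)) \<bullet> g' s / norm (g s - h (1/2)) ^ 2))"
proof -
  let ?G = "\<lambda>t. integral {0..1} (\<lambda>s. gauss_kernel g g' h h' s t)"
  have nd: "norm (- d) = 1" using d by simp
  have pos1: "norm (g s - h t) + (-d) \<bullet> (g s - h t) > 0" if "t \<in> {0..1/2}" for s t
  proof -
    have "norm (g s - h t) > 0" using disj[of s t] by simp
    then show ?thesis using lo[OF that, of s] unfolding inner_minus_left by linarith
  qed
  have pos2: "norm (g s - h t) + d \<bullet> (g s - h t) > 0" if "t \<in> {1/2..1}" for s t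
  proof -
    have "norm (g s - h t) > 0" using disj[of s t] by simp
    then show ?thesis using hi[OF that, of s] by linarith
  qed
  have s1: "integral {0..1/2} ?G =
    integral {0..1} (\<lambda>s. monopole_potential (-d) (g s - h (1/2)) \<bullet> g' s)
    - integral {0..1} (\<lambda>s. monopole_potential (-d) (g s - h 0) \<bullet> g' s)"
    by (rule gauss_kernel_strip[OF g h cg' ch' per(1) nd _ pos1]) auto
  have s2: "integral {1/2..1} ?G =
    integral {0..1} (\<lambda>s. monopole_potential d (g s - h 1) \<bullet> g' s)
    - integral {0..1} (\<lambda>s. monopole_potential d (g s - h (1/2)) \<bullet> g' s)"
    by (rule gauss_kernel_strip[OF g h cg' ch' per(1) d _ pos2]) auto
  have hor: "d \<bullet> (g s - h (1/2)) = 0" for s using lo[of "1/2" s] hi[of "1/2" s] by auto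
  have hor0: "d \<bullet> (g s - h 0) = 0" for s using lo[of 0 s] hi[of 1 s] per by auto
  have m: "monopole_potential (-d) (g s - h 0) \<bullet> g' s = - (cross3 d (g s - h 0) \<bullet> g' s / norm (g s - h 0) ^ 2)"
    "monopole_potential d (g s - h 0) \<bullet> g' s = (cross3 d (g s - h 0) \<bullet> g' s / norm (g s - h 0) ^ 2)"
    "monopole_potential (-d) (g s - h (1/2)) \<bullet> g' s = - (cross3 d (g s - h (1/2)) \<bullet> g' s / norm (g s - h (1/2)) ^ 2)"
    "monopole_potential d (g s - h (1/2)) \<bullet> g' s = (cross3 d (g s - h (1/2)) \<bullet> g' s / norm (g s - h (1/2)) ^ 2)" for s
    unfolding monopole_potential_def using hor[of s] hor0[of s] by (simp_all add: power2_eq_square cross_minus_left)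
  have "integral {0..1} ?G = integral {0..1/2} ?G + integral {1/2..1} ?G"
    by (rule Henstock_Kurzweil_Integration.integral_combine[symmetric]) (auto intro: linking_number_iterated(2)[OF g h cg' ch' disj])
  also have "\<dots> = 2 * (integral {0..1} (\<lambda>s. cross3 d (g s - h 0) \<bullet> g' s / norm (g s - h 0) ^ 2)
     - integral {0..1} (\<lambda>s. cross3 d (g s - h (1/2)) \<bullet> g' s / norm (g s - h (1/2)) ^ 2))"
    unfolding s1 s2 per(2)[symmetric] m by simp
  finally show ?thesis
    unfolding linking_number_iterated(1)[OF g h cg' ch' disj] by (simp add: field_simps)
qed

text \<open>In the coordinates u, v of its plane the integrand is the imaginary part of dz / (z -
  w), the differential of the angle seen from y. The integral is therefore 2 pi times the winding
  number of a round circle.\<close>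

lemma integral_angular_form_circle:
  fixes u v c y :: "real^3"
  assumes u: "norm u = 1" and v: "norm v = 1" and uv: "u \<bullet> v = 0" and \<rho>: "\<rho> > 0"
    and y: "(y - c) \<bullet> cross3 u v = 0" "norm (y - c) \<noteq> \<rho>"
    and gdef: "\<And>s. g s = c + \<rho> *\<^sub>R (cos (2 * pi * s) *\<^sub>R u + sin (2 * pi * s) *\<^sub>R v)"
    and g'def: "\<And>s. g' s = (2 * pi * \<rho>) *\<^sub>R (- sin (2 * pi * s) *\<^sub>R u + cos (2 * pi * s) *\<^sub>R v)"
  shows "integral {0..1} (\<lambda>s. cross3 (cross3 u v) (g s - y) \<bullet> g' s / norm (g s - y) ^ 2)
    = (if norm (y - c) < \<rho> then 2 * pi else 0)"
proof -
  have uu: "u \<bullet> u = 1" "v \<bullet> v = 1" using u v by (simp_all add: norm_eq_1)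
  define p q where "p = (y - c) \<bullet> u" and "q = (y - c) \<bullet> v"
  define w where "w = Complex p q"
  have yc: "y - c = p *\<^sub>R u + q *\<^sub>R v"
  proof -
    let ?z = "y - c - (p *\<^sub>R u + q *\<^sub>R v)"
    have "cross3 u v \<bullet> cross3 u v = 1"
      using norm_cross_dot[of u v] u v uv by (simp add: power2_norm_eq_inner)
    moreover have "?z \<bullet> u = 0" "?z \<bullet> v = 0" using uu uv
      by (simp_all add: p_def q_def inner_diff_left inner_add_left inner_commute[of v u])
    moreover have "?z \<bullet> cross3 u v = 0" using y(1)
      by (simp add: inner_diff_left inner_add_left dot_cross_self)
    ultimately have "cross3 (cross3 u v) ?z = 0" "cross3 u v \<bullet> ?z = 0"
      using Lagrange[of ?z u v] by (simp_all add: cross_skew[of "cross3 u v" ?z] inner_commute)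
    moreover have "cross3 u v \<noteq> 0" using \<open>cross3 u v \<bullet> cross3 u v = 1\<close> by auto
    ultimately have "?z = 0" using norm_and_cross_eq_0 by blast
    then show ?thesis by simp
  qed
  have nw: "norm w = norm (y - c)"
    unfolding yc w_def complex_norm norm_eq_sqrt_inner[of "p *\<^sub>R u + q *\<^sub>R v"]
    using uu uv by (simp add: inner_add_left inner_add_right inner_commute[of v u] power2_eq_square)
  have zw: "norm w \<noteq> \<rho>" using y(2) nw by simp
  define e where "e s = exp (2 * complex_of_real pi * \<i> * complex_of_real s)" for s
  have e: "e s = Complex (cos (2 * pi * s)) (sin (2 * pi * s))" for s
    unfolding e_def using cis_conv_exp[of "2 * pi * s"] by (simp add: cis.ctr mult_ac)
  have ne: "\<rho> * e s \<noteq> w" for s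
  proof
    assume "\<rho> * e s = w"
    then have "norm w = \<rho>" using \<rho> by (auto simp: norm_mult e complex_norm)
    with zw show False by simp
  qed
  have "w \<notin> path_image (circlepath 0 \<rho>)" using \<rho> zw by (auto simp: sphere_def)
  then have "((\<lambda>z. 1 / (z - w)) has_contour_integral (complex_of_real (2 * pi) * \<i> * winding_number (circlepath 0 \<rho>) w)) (circlepath 0 \<rho>)"
    by (intro has_contour_integral_winding_number valid_path_circlepath)
  moreover have "winding_number (circlepath 0 \<rho>) w = (if norm w < \<rho> then 1 else 0)"
  proof (cases "norm w < \<rho>")
    case True then show ?thesis using winding_number_circlepath[of w 0 \<rho>] by simp
  next
    case False
    then have "w \<notin> cball 0 \<rho>" using zw by auto
    then show ?thesis using \<rho> False
      by (simp add: winding_number_zero_outside[of _ "cball 0 \<rho>"] sphere_cball)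
  qed
  ultimately have I: "((\<lambda>s. 1 / (\<rho> * e s - w) * (2 * pi * \<i> * \<rho> * e s)) has_integral
     (2 * of_real pi * \<i> * (if norm w < \<rho> then 1 else 0))) {0..1}"
    unfolding has_contour_integral vector_derivative_circlepath
    by (simp add: circlepath e_def has_integral_eq)
  have "((\<lambda>s. Im (1 / (\<rho> * e s - w) * (2 * pi * \<i> * \<rho> * e s))) has_integral
     Im (2 * of_real pi * \<i> * (if norm w < \<rho> then 1 else 0))) {0..1}"
    using has_integral_linear[OF I bounded_linear_Im] by (simp add: o_def)
  moreover have "Im (1 / (\<rho> * e s - w) * (2 * pi * \<i> * \<rho> * e s)) =
     cross3 (cross3 u v) (g s - y) \<bullet> g' s / norm (g s - y) ^ 2" for s
  proof -
    define C S where "C = cos (2 * pi * s)" and "S = sin (2 * pi * s)"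
    define a b where "a = \<rho> * C - p" and "b = \<rho> * S - q"
    have gy: "g s - y = a *\<^sub>R u + b *\<^sub>R v"
    proof -
      have "g s - y = \<rho> *\<^sub>R (C *\<^sub>R u + S *\<^sub>R v) - (y - c)" unfolding gdef C_def S_def by simp
      then show ?thesis unfolding yc a_def b_def by (simp add: algebra_simps)
    qed
    have n: "norm (g s - y) ^ 2 = a\<^sup>2 + b\<^sup>2"
      unfolding gy power2_norm_eq_inner
      using uu uv by (simp add: inner_add_left inner_add_right inner_commute[of v u] power2_eq_square)
    have dx: "cross3 (cross3 u v) (g s - y) = a *\<^sub>R v - b *\<^sub>R u"
    proof -
      have "cross3 (cross3 u v) (g s - y) = - cross3 (g s - y) (cross3 u v)" by (rule cross_skew)
      also have "\<dots> = - (((g s - y) \<bullet> v) *\<^sub>R u - ((g s - y) \<bullet> u) *\<^sub>R v)" by (simp add: Lagrange)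
      finally show ?thesis unfolding gy using uu uv
        by (simp add: inner_add_left inner_commute[of v u])
    qed
    have num: "cross3 (cross3 u v) (g s - y) \<bullet> g' s = 2 * pi * \<rho> * (a * C + b * S)"
      unfolding dx g'def C_def[symmetric] S_def[symmetric] using uu uv
      by (simp add: inner_add_left inner_add_right inner_diff_left inner_diff_right inner_commute[of v u] algebra_simps)
    have z: "\<rho> * e s - w = Complex a b" unfolding e w_def a_def b_def C_def S_def by (simp add: complex_eq_iff)
    have ab: "a\<^sup>2 + b\<^sup>2 \<noteq> 0" using ne[of s] z by (auto simp: complex_eq_iff sum_power2_eq_zero_iff)
    show ?thesis unfolding n num z using ab
      by (simp add: e Im_divide Re_divide field_simps power2_eq_square) (simp add: C_def S_def algebra_simps)
  qed
  ultimately show ?thesis by (simp add: integral_unique nw)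
qed

section \<open>Linking of perpendicular circles\<close>

definition circle_path :: "real^3 \<Rightarrow> real \<Rightarrow> real^3 \<Rightarrow> real^3 \<Rightarrow> real \<Rightarrow> real^3" where
  "circle_path c \<rho> u v t = c + \<rho> *\<^sub>R (cos (2 * pi * t) *\<^sub>R u + sin (2 * pi * t) *\<^sub>R v)"

definition circle_velocity :: "real \<Rightarrow> real^3 \<Rightarrow> real^3 \<Rightarrow> real \<Rightarrow> real^3" where
  "circle_velocity \<rho> u v t = (2 * pi * \<rho>) *\<^sub>R (- sin (2 * pi * t) *\<^sub>R u + cos (2 * pi * t) *\<^sub>R v)"

lemma circle_path_has_vector_derivative:
  "(circle_path c \<rho> u v has_vector_derivative circle_velocity \<rho> u v t) (at t)"
proof -
  have "((\<lambda>t. cos (2 * pi * t)) has_real_derivative - sin (2 * pi * t) * (2 * pi)) (at t)"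
       "((\<lambda>t. sin (2 * pi * t)) has_real_derivative cos (2 * pi * t) * (2 * pi)) (at t)"
    by (auto intro!: derivative_eq_intros)
  note D = this[THEN has_vector_derivative_scaleR, OF has_vector_derivative_const]
  have "((\<lambda>t. c + \<rho> *\<^sub>R (cos (2 * pi * t) *\<^sub>R u + sin (2 * pi * t) *\<^sub>R v)) has_vector_derivative
     0 + \<rho> *\<^sub>R ((cos (2 * pi * t) *\<^sub>R 0 + (- sin (2 * pi * t) * (2 * pi)) *\<^sub>R u) + (sin (2 * pi * t) *\<^sub>R 0 + (cos (2 * pi * t) * (2 * pi)) *\<^sub>R v))) (at t)"
    by (intro has_vector_derivative_add has_vector_derivative_const
       bounded_linear.has_vector_derivative[OF bounded_linear_scaleR_right] D)
  then show ?thesis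
    unfolding circle_path_def[abs_def] circle_velocity_def by (simp add: algebra_simps)
qed

lemma continuous_on_circle_velocity: "continuous_on S (circle_velocity \<rho> u v)"
  unfolding circle_velocity_def[abs_def] by (intro continuous_intros)

lemma circle_path_periodic: "circle_path c \<rho> u v 0 = circle_path c \<rho> u v 1"
  by (simp add: circle_path_def)

lemma linking_number_circles_separated:
  assumes "\<And>s t. d \<bullet> (circle_path c \<rho> u v s - circle_path c' \<rho>' u' v' t) > 0"
  shows "linking_number (circle_path c \<rho> u v) (circle_path c' \<rho>' u' v') = 0"
  by (rule linking_number_separated[OF circle_path_has_vector_derivative circle_path_has_vector_derivative
      continuous_on_circle_velocity continuous_on_circle_velocity circle_path_periodic circle_path_periodic assms])

text \<open>The second circle pierces the plane of the first in c' + \<rho>' u' and c' - \<rho>' u'.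
  The first of these points is outside the first circle and the second is inside, so the two winding
  numbers differ by one in absolute value.\<close>

lemma linking_number_perpendicular_circles:
  assumes u: "norm u = 1" and v: "norm v = 1" and uv: "u \<bullet> v = 0"
    and u': "norm u' = 1" and v': "norm v' = 1" and u'v': "u' \<bullet> v' = 0"
    and perp: "u \<bullet> v' = 0" "v \<bullet> v' = 0" "(c' - c) \<bullet> v' = 0"
    and \<rho>: "\<rho> > 0" "\<rho>' > 0"
    and far: "norm (c' + \<rho>' *\<^sub>R u' - c) > \<rho>" and near: "norm (c' - \<rho>' *\<^sub>R u' - c) < \<rho>"
  shows "\<bar>linking_number (circle_path c \<rho> u v) (circle_path c' \<rho>' u' v')\<bar> = 1"
proof -
  let ?g = "circle_path c \<rho> u v" and ?h = "circle_path c' \<rho>' u' v'"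
  let ?g' = "circle_velocity \<rho> u v"
  have ort: "u \<bullet> u = 1" "v \<bullet> v = 1" "v' \<bullet> v' = 1" using u v v' by (simp_all add: norm_eq_1)
  have ccv: "c' \<bullet> v' = c \<bullet> v'" using perp(3) by (simp add: inner_diff_left)
  have height: "v' \<bullet> (?g s - ?h t) = - \<rho>' * sin (2 * pi * t)" for s t
    using perp u'v' ort ccv unfolding inner_commute[of v' "_ - _"]
    by (simp add: circle_path_def inner_diff_left inner_add_left)
  have h0: "?h 0 = c' + \<rho>' *\<^sub>R u'" by (simp add: circle_path_def)
  have h1: "?h (1/2) = c' - \<rho>' *\<^sub>R u'" by (simp add: circle_path_def)
  have gn: "norm (?g s - c) = \<rho>" for s
  proof -
    have "norm (cos (2 * pi * s) *\<^sub>R u + sin (2 * pi * s) *\<^sub>R v) ^ 2 = 1"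
      unfolding power2_norm_eq_inner using ort uv sin_cos_squared_add[of "2 * pi * s"]
      by (simp add: inner_add_left inner_add_right inner_commute[of v u] power2_eq_square)
    then have "norm (cos (2 * pi * s) *\<^sub>R u + sin (2 * pi * s) *\<^sub>R v) = 1"
      by (simp add: power2_eq_1_iff) (metis norm_ge_zero not_one_le_zero neg_0_le_iff_le)
    then show ?thesis using \<rho> by (simp add: circle_path_def)
  qed
  \<comment> \<open>A common point would have height zero over the first plane, hence be one of the
    two piercing points, and neither of these has distance \<rho> from c.\<close>
  have disj: "?g s \<noteq> ?h t" for s t
  proof
    assume eq: "?g s = ?h t"
    have s0: "sin (2 * pi * t) = 0" using height[of s t] \<rho> unfolding eq by simp
    then have "cos (2 * pi * t) = 1 \<or> cos (2 * pi * t) = -1"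
      using sin_cos_squared_add[of "2 * pi * t"] by (simp add: power2_eq_1_iff)
    then have "?h t = c' + \<rho>' *\<^sub>R u' \<or> ?h t = c' - \<rho>' *\<^sub>R u'"
      using s0 by (auto simp: circle_path_def)
    then have "norm (?h t - c) \<noteq> \<rho>" using far near by auto
    with gn[of s] eq show False by simp
  qed
  have lo: "v' \<bullet> (?g s - ?h t) \<le> 0" if "t \<in> {0..1/2}" for s t
    unfolding height using that \<rho> by (auto intro!: mult_nonneg_nonneg sin_ge_zero)
  have hi: "v' \<bullet> (?g s - ?h t) \<ge> 0" if "t \<in> {1/2..1}" for s t
  proof -
    have "sin (2 * pi * t - pi) \<ge> 0" using that by (intro sin_ge_zero) (auto simp: field_simps)
    then have "sin (2 * pi * t) \<le> 0" by simp
    then show ?thesis unfolding height using \<rho> by (auto simp: mult_nonneg_nonpos)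
  qed
  note L = linking_number_halves[OF circle_path_has_vector_derivative circle_path_has_vector_derivative
      continuous_on_circle_velocity continuous_on_circle_velocity circle_path_periodic circle_path_periodic v' disj lo hi, unfolded h0 h1]
  define d where "d = cross3 u v"
  have dd: "norm d = 1"
  proof -
    have "(norm d)\<^sup>2 = 1" using norm_cross_dot[of u v] u v uv by (simp add: d_def)
    then show ?thesis by (simp add: power2_eq_1_iff) (metis norm_ge_zero not_one_le_zero neg_0_le_iff_le)
  qed
  \<comment> \<open>Both v' and d = u x v are unit normals of the first plane. The number k below is
    the sign between them; it is also, up to sign, the linking number.\<close>
  have "cross3 d v' = 0"
    using Lagrange[of v' u v] perp unfolding d_def by (simp add: cross_skew[of "cross3 u v" v'] inner_commute)
  then have "\<exists>k. v' = k *\<^sub>R d"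
  proof -
    have "\<bar>d \<bullet> v'\<bar> = norm d * norm v'"
      using norm_cross_dot[of d v'] \<open>cross3 d v' = 0\<close> dd v' by (auto simp: power2_eq_1_iff)
    then show ?thesis unfolding norm_cauchy_schwarz_abs_eq using dd v' by (metis scaleR_one scaleR_minus1_left scaleR_minus_left add.inverse_inverse)
  qed
  then obtain k where k: "v' = k *\<^sub>R d" by blast
  have k1: "\<bar>k\<bar> = 1" using v' dd unfolding k by simp
  have W: "integral {0..1} (\<lambda>s. cross3 v' (?g s - y) \<bullet> ?g' s / norm (?g s - y) ^ 2)
    = k * (if norm (y - c) < \<rho> then 2 * pi else 0)" if y: "(y - c) \<bullet> v' = 0" "norm (y - c) \<noteq> \<rho>" for y
  proof -
    have yd: "(y - c) \<bullet> cross3 u v = 0" using y k1 unfolding k d_def by auto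
    have "integral {0..1} (\<lambda>s. cross3 v' (?g s - y) \<bullet> ?g' s / norm (?g s - y) ^ 2) =
      integral {0..1} (\<lambda>s. k * (cross3 (cross3 u v) (?g s - y) \<bullet> ?g' s / norm (?g s - y) ^ 2))"
      unfolding k d_def[symmetric] by (simp add: cross_mult_left)
    also have "\<dots> = k * integral {0..1} (\<lambda>s. (cross3 (cross3 u v) (?g s - y) \<bullet> ?g' s / norm (?g s - y) ^ 2))"
      by (rule integral_mult_right)
    finally show ?thesis
      using integral_angular_form_circle[OF u v uv \<rho>(1) yd y(2) circle_path_def circle_velocity_def] by simp
  qed
  have p0: "(c' + \<rho>' *\<^sub>R u' - c) \<bullet> v' = 0" "(c' - \<rho>' *\<^sub>R u' - c) \<bullet> v' = 0"
    using ccv u'v' by (simp_all add: inner_add_left inner_diff_left)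
  have "linking_number ?g ?h = 1 / (2 * pi) * (k * (if norm (c' + \<rho>' *\<^sub>R u' - c) < \<rho> then 2 * pi else 0) - k * (if norm (c' - \<rho>' *\<^sub>R u' - c) < \<rho> then 2 * pi else 0))"
    using L unfolding W[OF p0(1) less_imp_neq[OF far, symmetric]] W[OF p0(2) less_imp_neq[OF near]]
    .
  then have "linking_number ?g ?h = - k" using far near by simp
  then show ?thesis using k1 by simp
qed

section \<open>Round circles and solid tori\<close>

text \<open>The residual ?z is orthogonal to u and v, which by the Lagrange formula makes it
  parallel to u x v; being orthogonal to u x v as well, it vanishes.\<close>

lemma orthonormal_expansion:
  fixes u v x :: "real^3"
  assumes u: "norm u = 1" and v: "norm v = 1" and uv: "u \<bullet> v = 0"
  shows "x = (x \<bullet> u) *\<^sub>R u + (x \<bullet> v) *\<^sub>R v + (x \<bullet> cross3 u v) *\<^sub>R cross3 u v"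
    and "norm (cross3 u v) = 1"
proof -
  define w where "w = cross3 u v"
  have uu: "u \<bullet> u = 1" "v \<bullet> v = 1" using u v by (simp_all add: norm_eq_1)
  have ww: "w \<bullet> w = 1"
    using norm_cross_dot[of u v] u v uv by (simp add: power2_norm_eq_inner w_def)
  then show nw: "norm (cross3 u v) = 1" by (simp add: norm_eq_1 w_def)
  have wuv: "w \<bullet> u = 0" "w \<bullet> v = 0" by (simp_all add: w_def dot_cross_self)
  let ?z = "x - ((x \<bullet> u) *\<^sub>R u + (x \<bullet> v) *\<^sub>R v + (x \<bullet> w) *\<^sub>R w)"
  have z: "?z \<bullet> u = 0" "?z \<bullet> v = 0" "w \<bullet> ?z = 0" using uu uv ww wuv
    by (simp_all add: inner_diff_left inner_diff_right inner_add_left inner_add_right inner_commute[of v u] inner_commute[of w x])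
  then have "cross3 w ?z = 0"
    using Lagrange[of ?z u v] by (simp add: w_def cross_skew[of "cross3 u v"])
  then have "?z = 0" using z(3) norm_and_cross_eq_0[of w ?z] ww by auto
  then show "x = (x \<bullet> u) *\<^sub>R u + (x \<bullet> v) *\<^sub>R v + (x \<bullet> cross3 u v) *\<^sub>R cross3 u v" by (simp add: w_def)
qed

lemma norm_orthonormal_comb:
  fixes u v :: "'a::real_inner"
  assumes "norm u = 1" "norm v = 1" "u \<bullet> v = 0"
  shows "norm (a *\<^sub>R u + b *\<^sub>R v) ^ 2 = a\<^sup>2 + b\<^sup>2"
  unfolding power2_norm_eq_inner using assms
  by (simp add: inner_add_left inner_add_right inner_commute[of v u] norm_eq_1 power2_eq_square)

lemma norm_cos_sin_comb:
  fixes u v :: "'a::real_inner"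
  assumes "norm u = 1" "norm v = 1" "u \<bullet> v = 0"
  shows "norm (cos t *\<^sub>R u + sin t *\<^sub>R v) = 1"
proof -
  have "norm (cos t *\<^sub>R u + sin t *\<^sub>R v) ^ 2 = 1 ^ 2" unfolding norm_orthonormal_comb[OF assms] by simp
  then show ?thesis by (subst (asm) power2_eq_iff_nonneg) auto
qed

lemma ex_orthonormal_pair:
  fixes n :: "real^3" assumes n: "norm n = 1"
  obtains u v where "norm u = 1" "norm v = 1" "u \<bullet> v = 0" "n \<bullet> u = 0" "n \<bullet> v = 0" "v = cross3 n u"
proof -
  have "DIM(real^3) \<ge> 2" by simp
  then obtain y where y: "y \<noteq> 0" "orthogonal n y"
    using orthogonal_to_vector_exists[of n] by (auto simp: orthogonal_commute)
  define u where "u = y /\<^sub>R norm y"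
  have u: "norm u = 1" "n \<bullet> u = 0" using y by (auto simp: u_def orthogonal_def)
  show thesis
    by (rule that[of u "cross3 n u"]) (use u n orthonormal_expansion(2)[OF n u(1) u(2)] in \<open>simp_all add: dot_cross_self\<close>)
qed

section \<open>Round circles and their tubes\<close>

definition round_circle :: "real^3 \<Rightarrow> real^3 \<Rightarrow> real \<Rightarrow> (real^3) set" where
  "round_circle c n R = {x. (x - c) \<bullet> n = 0 \<and> norm (x - c) = R}"

text \<open>A tube rather than a set of revolution: in this form compactness, connectedness and
  behaviour under similarities are immediate. The agreement with \<open>revolve\<close> is
  established once, through cylindrical coordinates.\<close>

definition solid_torus :: "real^3 \<Rightarrow> real^3 \<Rightarrow> real \<Rightarrow> real \<Rightarrow> (real^3) set" where
  "solid_torus c n R r = (\<Union>y\<in>round_circle c n R. cball y r)"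

lemma mem_round_circle_iff:
  assumes u: "norm u = 1" "norm v = 1" "u \<bullet> v = 0" and n: "norm n = 1" "n \<bullet> u = 0" "n \<bullet> v = 0" and R: "R > 0"
  shows "x \<in> round_circle c n R \<longleftrightarrow> (\<exists>t. x = c + R *\<^sub>R (cos t *\<^sub>R u + sin t *\<^sub>R v))"
    and "x \<in> round_circle c n R \<longleftrightarrow> (\<exists>t\<in>{0..1}. x = circle_path c R u v t)"
proof -
  have a: "c + R *\<^sub>R (cos t *\<^sub>R u + sin t *\<^sub>R v) \<in> round_circle c n R" for t
    using norm_cos_sin_comb[OF u, of t] R n
    by (simp add: round_circle_def inner_add_right inner_commute[of _ n])
  have b: "\<exists>t. 0 \<le> t \<and> t < 2 * pi \<and> x = c + R *\<^sub>R (cos t *\<^sub>R u + sin t *\<^sub>R v)" if x: "x \<in> round_circle c n R"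
  proof -
    have xn: "(x - c) \<bullet> n = 0" "norm (x - c) = R" using x by (auto simp: round_circle_def)
    have "n = (n \<bullet> cross3 u v) *\<^sub>R cross3 u v" using orthonormal_expansion(1)[OF u, of n] n by simp
    then have "n \<bullet> cross3 u v \<noteq> 0" "(x - c) \<bullet> n = (n \<bullet> cross3 u v) * ((x - c) \<bullet> cross3 u v)"
      using n(1) by (force, metis inner_scaleR_right)
    then have "(x - c) \<bullet> cross3 u v = 0" using xn by simp
    then have e: "x - c = ((x - c) \<bullet> u) *\<^sub>R u + ((x - c) \<bullet> v) *\<^sub>R v" (is "_ = ?a *\<^sub>R u + ?b *\<^sub>R v")
      using orthonormal_expansion(1)[OF u, of "x - c"] by simp
    have "?a\<^sup>2 + ?b\<^sup>2 = R\<^sup>2" using norm_orthonormal_comb[OF u, of ?a ?b] e xn(2) by metis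
    then have "(?a / R)\<^sup>2 + (?b / R)\<^sup>2 = 1" using R by (simp add: power_divide flip: add_divide_distrib)
    then obtain t where t: "0 \<le> t" "t < 2 * pi" "?a / R = cos t" "?b / R = sin t"
      using sincos_total_2pi by metis
    then have "?a = R * cos t" "?b = R * sin t" using R by (auto simp: field_simps)
    then have "x = c + R *\<^sub>R (cos t *\<^sub>R u + sin t *\<^sub>R v)" using e
      by (metis (no_types, lifting) add.commute diff_add_cancel scaleR_add_right scaleR_scaleR)
    then show ?thesis using t by blast
  qed
  show "x \<in> round_circle c n R \<longleftrightarrow> (\<exists>t. x = c + R *\<^sub>R (cos t *\<^sub>R u + sin t *\<^sub>R v))"
    using a b by blast
  show "x \<in> round_circle c n R \<longleftrightarrow> (\<exists>t\<in>{0..1}. x = circle_path c R u v t)"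
  proof
    assume "x \<in> round_circle c n R"
    then obtain t where t: "0 \<le> t" "t < 2 * pi" "x = c + R *\<^sub>R (cos t *\<^sub>R u + sin t *\<^sub>R v)" using b by blast
    then show "\<exists>t\<in>{0..1}. x = circle_path c R u v t"
      by (intro bexI[of _ "t / (2 * pi)"]) (auto simp: circle_path_def)
  next
    assume "\<exists>t\<in>{0..1}. x = circle_path c R u v t"
    then show "x \<in> round_circle c n R" using a by (auto simp: circle_path_def)
  qed
qed

lemma circle_parametrization_imp:
  assumes "circle_parametrization C c g"
  obtains u v n \<rho> where "norm u = 1" "norm v = 1" "u \<bullet> v = 0" "norm n = 1" "n \<bullet> u = 0" "n \<bullet> v = 0" "\<rho> > 0"
    "g = circle_path c \<rho> u v" "C = round_circle c n \<rho>"
proof -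
  from assms obtain u v \<rho> where uv: "norm u = 1" "norm v = 1" "u \<bullet> v = 0" and \<rho>: "\<rho> > 0"
    and g: "g = circle_path c \<rho> u v" and C: "C = g ` {0..1}"
    unfolding circle_parametrization_def circle_path_def[abs_def] orthogonal_def by blast
  have n: "norm (cross3 u v) = 1" "cross3 u v \<bullet> u = 0" "cross3 u v \<bullet> v = 0"
    using orthonormal_expansion(2)[OF uv] by (simp_all add: dot_cross_self)
  have "C = round_circle c (cross3 u v) \<rho>"
    using mem_round_circle_iff(2)[OF uv n \<rho>] unfolding C g by blast
  then show thesis using that[OF uv n \<rho> g] by simp
qed

lemma circle_parametrization_round_circle:
  assumes u: "norm u = 1" "norm v = 1" "u \<bullet> v = 0" and n: "norm n = 1" "n \<bullet> u = 0" "n \<bullet> v = 0" and R: "R > 0"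
  shows "circle_parametrization (round_circle c n R) c (circle_path c R u v)"
  unfolding circle_parametrization_def circle_path_def[abs_def, symmetric]
  using u R mem_round_circle_iff(2)[OF u n R, of _ c]
  by (intro exI[of _ u] exI[of _ v] exI[of _ R]) (auto simp: orthogonal_def circle_path_def[abs_def])

text \<open>Two point reflections compose to the translation by 2 (c' - c), whose iterates leave
  every bounded set unless c = c'. This is what makes the centre of a circle, and later that of a
  solid torus, a function of the point set.\<close>

lemma bounded_symmetric_center_unique:
  fixes S :: "'a::real_normed_vector set"
  assumes S: "bounded S" "S \<noteq> {}" and c: "\<And>x. x \<in> S \<Longrightarrow> 2 *\<^sub>R c - x \<in> S" and c': "\<And>x. x \<in> S \<Longrightarrow> 2 *\<^sub>R c' - x \<in> S"
  shows "c = c'"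
proof (rule ccontr)
  assume ne: "c \<noteq> c'"
  obtain x where x: "x \<in> S" using S by auto
  have it: "x + (2 * real k) *\<^sub>R (c' - c) \<in> S" for k
  proof (induction k)
    case (Suc k)
    have "2 *\<^sub>R c' - (2 *\<^sub>R c - (x + (2 * real k) *\<^sub>R (c' - c))) \<in> S" using Suc c c' by blast
    then show ?case by (simp add: algebra_simps scaleR_2)
  qed (use x in simp)
  obtain B where B: "\<And>y. y \<in> S \<Longrightarrow> norm y \<le> B" using S by (auto simp: bounded_iff)
  obtain k :: nat where k: "real k * norm (c' - c) > B + norm x"
    using reals_Archimedean3[of "norm (c' - c)"] ne by auto
  have "norm ((2 * real k) *\<^sub>R (c' - c)) \<le> norm (x + (2 * real k) *\<^sub>R (c' - c)) + norm x"
    using norm_triangle_ineq4[of "x + (2 * real k) *\<^sub>R (c' - c)" x] by simp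
  also have "\<dots> \<le> B + norm x" using B[OF it[of k]] by simp
  finally have "2 * (real k * norm (c' - c)) \<le> B + norm x" by simp
  moreover have "real k * norm (c' - c) \<ge> 0" by simp
  ultimately show False using k by linarith
qed

lemma round_circle_reflect: "x \<in> round_circle c n R \<Longrightarrow> 2 *\<^sub>R c - x \<in> round_circle c n R"
proof -
  have "2 *\<^sub>R c - x - c = - (x - c)" by (simp add: scaleR_2)
  then show "x \<in> round_circle c n R \<Longrightarrow> 2 *\<^sub>R c - x \<in> round_circle c n R"
    unfolding round_circle_def mem_Collect_eq by (simp only: inner_minus_left norm_minus_cancel) simp
qed

lemma bounded_round_circle: "bounded (round_circle c n R)"
  by (rule bounded_subset[OF bounded_cball[of c R]]) (auto simp: round_circle_def dist_norm norm_minus_commute)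

lemma round_circle_nonempty:
  assumes n: "norm n = 1" and R: "R > 0" shows "round_circle c n R \<noteq> {}"
proof -
  obtain u v where "norm u = 1" "norm v = 1" "u \<bullet> v = 0" "n \<bullet> u = 0" "n \<bullet> v = 0" "v = cross3 n u"
    using ex_orthonormal_pair[OF n] .
  then have "c + R *\<^sub>R u \<in> round_circle c n R" using R by (simp add: round_circle_def inner_commute)
  then show ?thesis by blast
qed

lemma round_circle_center_unique:
  assumes "round_circle c n R = round_circle c' n' R'" "norm n = 1" "R > 0"
  shows "c = c'"
  using bounded_symmetric_center_unique[OF bounded_round_circle round_circle_nonempty, of n R c c c'] assms
    round_circle_reflect by metis

lemma circle_center_round_circle:
  assumes n: "norm n = 1" and R: "R > 0" shows "circle_center (round_circle c n R) = c"
  unfolding circle_center_def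
proof (rule the_equality)
  obtain u v where "norm u = 1" "norm v = 1" "u \<bullet> v = 0" "n \<bullet> u = 0" "n \<bullet> v = 0" "v = cross3 n u"
    using ex_orthonormal_pair[OF n] .
  then show "\<exists>g. circle_parametrization (round_circle c n R) c g"
    using circle_parametrization_round_circle n R by blast
next
  fix c' assume "\<exists>g. circle_parametrization (round_circle c n R) c' g"
  then show "c' = c" using round_circle_center_unique n R by (metis circle_parametrization_imp)
qed

lemma linked_circles_perpendicular:
  assumes n: "norm n = 1" and u': "norm u' = 1" and v': "norm v' = 1" and n': "norm n' = 1"
    and o: "u' \<bullet> v' = 0" "n' \<bullet> u' = 0" "n' \<bullet> v' = 0" and nv: "n = v' \<or> n = - v'"
    and \<rho>: "\<rho> > 0" "\<rho>' > 0" and plane: "(c' - c) \<bullet> v' = 0"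
    and far: "norm (c' + \<rho>' *\<^sub>R u' - c) > \<rho>" and near: "norm (c' - \<rho>' *\<^sub>R u' - c) < \<rho>"
  shows "linked_circles (round_circle c n \<rho>) (round_circle c' n' \<rho>')"
proof -
  obtain u v where u: "norm u = 1" "norm v = 1" "u \<bullet> v = 0" "n \<bullet> u = 0" "n \<bullet> v = 0" "v = cross3 n u"
    using ex_orthonormal_pair[OF n] .
  have "\<bar>linking_number (circle_path c \<rho> u v) (circle_path c' \<rho>' u' v')\<bar> = 1"
    using nv u by (intro linking_number_perpendicular_circles u' v' o plane \<rho> far near) (auto simp: inner_commute)
  then show ?thesis unfolding linked_circles_def
    using circle_parametrization_round_circle[OF u(1,2,3) n u(4,5) \<rho>(1), of c]
      circle_parametrization_round_circle[OF u' v' o(1) n' o(2,3) \<rho>(2), of c'] by blast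
qed

text \<open>Exchanging the curves changes the sign of the difference vector and of the cross
  product, so the kernel is symmetric. Needed because the perpendicular case is settled with the
  roles of the two circles fixed.\<close>

lemma linking_number_commute:
  assumes g: "\<And>s. (g has_vector_derivative g' s) (at s)" and h: "\<And>t. (h has_vector_derivative h' t) (at t)"
    and cg': "continuous_on UNIV g'" and ch': "continuous_on UNIV h'"
    and disj: "\<And>s t. s \<in> {0..1} \<Longrightarrow> t \<in> {0..1} \<Longrightarrow> g s \<noteq> h t"
  shows "linking_number h g = linking_number g h"
proof -
  have cg: "continuous_on UNIV g" and ch: "continuous_on UNIV h"
    using g h by (auto intro!: continuous_at_imp_continuous_on has_vector_derivative_continuous)
  have k: "gauss_kernel h h' g g' s t = gauss_kernel g g' h h' t s" for s t
  proof -
    have "(h s - g t) \<bullet> cross3 (h' s) (g' t) = (g t - h s) \<bullet> cross3 (g' t) (h' s)"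
      by (simp add: cross_skew[of "h' s"] inner_diff_left)
    then show ?thesis by (simp add: gauss_kernel_def norm_minus_commute)
  qed
  have "continuous_on (cbox (0,0) (1,1)) (\<lambda>(s,t). gauss_kernel g g' h h' s t)"
    using continuous_on_gauss_kernel[OF cg cg' ch ch', of "{0..1}" "{0..1}"] disj by (simp add: cbox_Pair_eq)
  from integral_swap_continuous[OF this] show ?thesis
    using disj by (subst linking_number_iterated[OF h g ch' cg'], metis)
      (subst linking_number_iterated[OF g h cg' ch'], auto simp: k)
qed

lemma linked_circles_commute:
  assumes l: "linked_circles C C'" and disj: "C \<inter> C' = {}"
  shows "linked_circles C' C"
proof -
  from l obtain c g c' g' where g: "circle_parametrization C c g" and g': "circle_parametrization C' c' g'"
    and l: "\<bar>linking_number g g'\<bar> = 1" unfolding linked_circles_def by blast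
  obtain u v n \<rho> where 1: "norm u = 1" "norm v = 1" "u \<bullet> v = 0" "norm n = 1" "n \<bullet> u = 0" "n \<bullet> v = 0" "\<rho> > 0"
    "g = circle_path c \<rho> u v" "C = round_circle c n \<rho>" using circle_parametrization_imp[OF g] .
  obtain u' v' n' \<rho>' where 2: "norm u' = 1" "norm v' = 1" "u' \<bullet> v' = 0" "norm n' = 1" "n' \<bullet> u' = 0" "n' \<bullet> v' = 0" "\<rho>' > 0"
    "g' = circle_path c' \<rho>' u' v'" "C' = round_circle c' n' \<rho>'" using circle_parametrization_imp[OF g'] .
  have "g s \<in> C" "g' s \<in> C'" for s
    unfolding 1(9) mem_round_circle_iff(1)[OF 1(1-7)] 2(9) mem_round_circle_iff(1)[OF 2(1-7)] 1(8) 2(8) circle_path_def by blast+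
  then have "g s \<noteq> g' t" for s t using disj by (metis IntI empty_iff)
  then have "linking_number g' g = linking_number g g'"
    unfolding 1(8) 2(8)
    by (intro linking_number_commute[OF circle_path_has_vector_derivative circle_path_has_vector_derivative
      continuous_on_circle_velocity continuous_on_circle_velocity]) auto
  then show ?thesis using l g g' unfolding linked_circles_def by metis
qed

text \<open>Linking is an existential statement over parametrizations, so all of them have to be
  excluded. Each one is a \<open>circle_path\<close>, which stays on its circle for every real
  parameter, and separated circles have linking number 0.\<close>

lemma not_linked_separated:
  assumes sep: "\<And>x y. x \<in> C \<Longrightarrow> y \<in> C' \<Longrightarrow> d \<bullet> (x - y) > 0"
  shows "\<not> linked_circles C C'"
proof
  assume "linked_circles C C'"
  then obtain c g c' g' where g: "circle_parametrization C c g" and g': "circle_parametrization C' c' g'"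
    and l: "\<bar>linking_number g g'\<bar> = 1" unfolding linked_circles_def by blast
  obtain u v n \<rho> where 1: "norm u = 1" "norm v = 1" "u \<bullet> v = 0" "norm n = 1" "n \<bullet> u = 0" "n \<bullet> v = 0" "\<rho> > 0"
    "g = circle_path c \<rho> u v" "C = round_circle c n \<rho>" using circle_parametrization_imp[OF g] .
  obtain u' v' n' \<rho>' where 2: "norm u' = 1" "norm v' = 1" "u' \<bullet> v' = 0" "norm n' = 1" "n' \<bullet> u' = 0" "n' \<bullet> v' = 0" "\<rho>' > 0"
    "g' = circle_path c' \<rho>' u' v'" "C' = round_circle c' n' \<rho>'" using circle_parametrization_imp[OF g'] .
  have "g s \<in> C" "g' s \<in> C'" for s
    unfolding 1(9) mem_round_circle_iff(1)[OF 1(1-7)] 2(9) mem_round_circle_iff(1)[OF 2(1-7)] 1(8) 2(8) circle_path_def by blast+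
  then have "linking_number g g' = 0" unfolding 1(8) 2(8)
    by (intro linking_number_circles_separated[of d] sep) (simp_all add: 1(8) 2(8))
  with l show False by simp
qed

section \<open>Topology of the tubes and recovery of the central circle\<close>

lemma compact_round_circle: "compact (round_circle c n R)"
proof -
  have "closed (round_circle c n R)"
    unfolding round_circle_def by (intro closed_Collect_conj closed_Collect_eq continuous_intros)
  then show ?thesis using bounded_round_circle compact_eq_bounded_closed by blast
qed

lemma connected_round_circle:
  assumes n: "norm n = 1" and R: "R > 0" shows "connected (round_circle c n R)"
proof -
  obtain u v where u: "norm u = 1" "norm v = 1" "u \<bullet> v = 0" "n \<bullet> u = 0" "n \<bullet> v = 0" "v = cross3 n u"
    using ex_orthonormal_pair[OF n] .
  have "round_circle c n R = circle_path c R u v ` {0..1}"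
    using mem_round_circle_iff(2)[OF u(1-3) n u(4,5) R] by blast
  then show ?thesis
    by (auto intro!: connected_continuous_image continuous_intros simp: circle_path_def[abs_def])
qed

lemma solid_torus_eq_sums: "solid_torus c n R r = (\<lambda>(y, z). y + z) ` (round_circle c n R \<times> cball 0 r)"
proof -
  have "\<exists>a\<in>round_circle c n R. \<exists>b\<in>cball 0 r. x = a + b" if "y \<in> round_circle c n R" "dist y x \<le> r" for x y
    using that by (intro bexI[of _ y] bexI[of _ "x - y"]) (auto simp: dist_norm norm_minus_commute)
  then show ?thesis
    by (auto simp: solid_torus_def dist_norm image_iff)
qed

lemma compact_solid_torus: "compact (solid_torus c n R r)"
  unfolding solid_torus_eq_sums case_prod_unfold
  by (intro compact_continuous_image compact_Times compact_round_circle continuous_intros) auto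

lemma connected_solid_torus: "norm n = 1 \<Longrightarrow> R > 0 \<Longrightarrow> connected (solid_torus c n R r)"
  unfolding solid_torus_eq_sums case_prod_unfold
  by (intro connected_continuous_image connected_Times connected_round_circle continuous_intros) auto

lemma round_circle_subset_solid_torus: "r \<ge> 0 \<Longrightarrow> round_circle c n R \<subseteq> solid_torus c n R r"
  by (auto simp: solid_torus_def)

lemma solid_torus_reflect:
  assumes "x \<in> solid_torus c n R r" shows "2 *\<^sub>R c - x \<in> solid_torus c n R r"
proof -
  obtain y where y: "y \<in> round_circle c n R" "dist y x \<le> r" using assms by (auto simp: solid_torus_def)
  have "dist (2 *\<^sub>R c - y) (2 *\<^sub>R c - x) = dist y x" by (simp add: dist_norm norm_minus_commute)
  then show ?thesis using round_circle_reflect[OF y(1)] y(2) unfolding solid_torus_def by (intro UN_I[of "2 *\<^sub>R c - y"]) auto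
qed

text \<open>A solid torus determines its generating data: the centre is its centre of symmetry, the extreme distances
  from the centre are \<open>R \<plusminus> r\<close>, and the points at distance \<open>R + r\<close> form a circle homothetic
  to the central circle.\<close>

lemma solid_torus_farthest:
  assumes R: "0 < r" "r < R"
  shows "x \<in> solid_torus c n R r \<Longrightarrow> norm (x - c) \<le> R + r"
    and "x \<in> solid_torus c n R r \<Longrightarrow> norm (x - c) \<ge> R - r"
    and "y \<in> round_circle c n R \<longleftrightarrow>
      (let x = c + ((R + r) / R) *\<^sub>R (y - c) in x \<in> solid_torus c n R r \<and> norm (x - c) = R + r)"
proof -
  show "norm (x - c) \<le> R + r" if x: "x \<in> solid_torus c n R r"
  proof -
    obtain y where "norm (y - c) = R" "dist y x \<le> r" using x by (auto simp: solid_torus_def round_circle_def)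
    then show ?thesis using norm_triangle_ineq[of "x - y" "y - c"] by (simp add: dist_norm norm_minus_commute)
  qed
  show "norm (x - c) \<ge> R - r" if x: "x \<in> solid_torus c n R r"
  proof -
    obtain y where "norm (y - c) = R" "dist y x \<le> r" using x by (auto simp: solid_torus_def round_circle_def)
    then show ?thesis using norm_triangle_ineq2[of "y - c" "y - x"] by (simp add: dist_norm)
  qed
  show "y \<in> round_circle c n R \<longleftrightarrow>
      (let x = c + ((R + r) / R) *\<^sub>R (y - c) in x \<in> solid_torus c n R r \<and> norm (x - c) = R + r)"
  proof
    assume y: "y \<in> round_circle c n R"
    then have ny: "norm (y - c) = R" by (simp add: round_circle_def)
    let ?x = "c + ((R + r) / R) *\<^sub>R (y - c)"
    have xy: "?x - y = (r / R) *\<^sub>R (y - c)" using R by (simp add: add_divide_distrib algebra_simps)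
    have "dist ?x y \<le> r" unfolding dist_norm xy using ny R by simp
    then have "dist y ?x \<le> r" by (simp only: dist_commute)
    moreover have "norm (?x - c) = R + r" using ny R by simp
    ultimately show "let x = ?x in x \<in> solid_torus c n R r \<and> norm (x - c) = R + r"
      using y by (auto simp: Let_def solid_torus_def)
  next
    assume a: "let x = c + ((R + r) / R) *\<^sub>R (y - c) in x \<in> solid_torus c n R r \<and> norm (x - c) = R + r"
    define x where "x = c + ((R + r) / R) *\<^sub>R (y - c)"
    have x: "x \<in> solid_torus c n R r" "norm (x - c) = R + r" using a by (auto simp: Let_def x_def)
    obtain z where z: "z \<in> round_circle c n R" "dist z x \<le> r" using x(1) by (auto simp: solid_torus_def)
    have nz: "norm (z - c) = R" using z(1) by (simp add: round_circle_def)
    \<comment> \<open>Distance R + r from c forces equality in this triangle inequality. Hence x - z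
      and z - c point the same way, and z is the point y.\<close>
    have t: "norm ((x - z) + (z - c)) \<le> norm (x - z) + norm (z - c)" by (rule norm_triangle_ineq)
    have xz: "norm (x - z) = r" using t x(2) z(2) nz by (simp add: dist_norm norm_minus_commute)
    then have "norm ((x - z) + (z - c)) = norm (x - z) + norm (z - c)" using x(2) nz by simp
    then have "norm (x - z) *\<^sub>R (z - c) = norm (z - c) *\<^sub>R (x - z)" by (rule norm_triangle_eq[THEN iffD1])
    then have "R *\<^sub>R (x - z) = r *\<^sub>R (z - c)" unfolding xz nz by simp
    then have "R *\<^sub>R (x - c) = (R + r) *\<^sub>R (z - c)" by (simp add: algebra_simps)
    moreover have "R *\<^sub>R (x - c) = (R + r) *\<^sub>R (y - c)" using R by (simp add: x_def)
    ultimately have "y = z" using R by simp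
    then show "y \<in> round_circle c n R" using z by simp
  qed
qed

lemma solid_torus_determines_circle:
  assumes eq: "solid_torus c n R r = solid_torus c' n' R' r'" and n: "norm n = 1" "norm n' = 1"
    and R: "0 < r" "r < R" "0 < r'" "r' < R'"
  shows "round_circle c n R = round_circle c' n' R'"
proof -
  let ?T = "solid_torus c n R r"
  have ne: "round_circle c n R \<noteq> {}" "round_circle c' n' R' \<noteq> {}"
    using round_circle_nonempty n R by auto
  then have "?T \<noteq> {}" using round_circle_subset_solid_torus[of r c n R] R by auto
  then have cc: "c = c'"
    using bounded_symmetric_center_unique[of ?T c c'] solid_torus_reflect compact_solid_torus compact_imp_bounded eq by metis
  \<comment> \<open>Both extreme distances are attained, so R + r and R - r can be read off the
    point set.\<close>
  have attain: "\<exists>x\<in>solid_torus c n R r. norm (x - c) = R + r" "\<exists>x\<in>solid_torus c n R r. norm (x - c) = R - r"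
    if n: "norm n = 1" and R: "0 < r" "r < R" for n R r
  proof -
    obtain y where y: "y \<in> round_circle c n R" using round_circle_nonempty[OF n, of R] R by auto
    then show "\<exists>x\<in>solid_torus c n R r. norm (x - c) = R + r"
      using solid_torus_farthest(3)[OF R, of y c n] unfolding Let_def by blast
    let ?x = "c + ((R - r) / R) *\<^sub>R (y - c)"
    have ny: "norm (y - c) = R" using y by (simp add: round_circle_def)
    have yx: "y - ?x = (r / R) *\<^sub>R (y - c)" using R by (simp add: diff_divide_distrib algebra_simps)
    have "dist y ?x \<le> r" unfolding dist_norm yx using ny R by simp
    moreover have "norm (?x - c) = R - r" using ny R by simp
    ultimately show "\<exists>x\<in>solid_torus c n R r. norm (x - c) = R - r" using y unfolding solid_torus_def by fastforce
  qed
  note f = solid_torus_farthest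
  have "R + r = R' + r'"
    using attain(1)[OF n(1) R(1,2)] attain(1)[OF n(2) R(3,4)] f(1)[OF R(1,2)] f(1)[OF R(3,4)] eq cc
    by (metis order_antisym)
  moreover have "R - r = R' - r'"
    using attain(2)[OF n(1) R(1,2)] attain(2)[OF n(2) R(3,4)] f(2)[OF R(1,2)] f(2)[OF R(3,4)] eq cc
    by (metis order_antisym)
  ultimately have "R = R'" "r = r'" by auto
  then show ?thesis using f(3)[OF R(1,2)] f(3)[OF R(3,4)] eq cc by auto
qed

section \<open>Lines, planes and solids of revolution\<close>

lemma is_lineE:
  assumes "is_line L"
  obtains a n where "norm n = 1" "L = range (\<lambda>t. a + t *\<^sub>R n)"
proof -
  have L: "affine L" "aff_dim L = 1" using assms by (auto simp: is_line_def)
  obtain B where B: "\<not> affine_dependent B" "B \<subseteq> L" "affine hull B = affine hull L"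
    using affine_basis_exists by blast
  have "aff_dim L = aff_dim B" using aff_dim_affine_hull[of B] aff_dim_affine_hull[of L] B(3) by simp
  then have "aff_dim L = int (card B) - 1" using aff_dim_affine_independent[OF B(1)] by simp
  then have "card B = 2" using L by simp
  then obtain a b where ab: "B = {a, b}" "a \<noteq> b" by (auto simp: card_2_iff)
  have Lr: "L = range (\<lambda>t. a + t *\<^sub>R (b - a))"
  proof -
    have "L = affine hull L" using L(1) affine_hull_eq by metis
    then show ?thesis using B(3) unfolding ab affine_hull_2_alt by simp
  qed
  define n where "n = (b - a) /\<^sub>R norm (b - a)"
  have ba: "b - a = norm (b - a) *\<^sub>R n" "norm n = 1" using ab by (auto simp: n_def)
  have "range (\<lambda>t. a + t *\<^sub>R (b - a)) = range (\<lambda>t. a + t *\<^sub>R n)"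
  proof (intro equalityI image_subsetI)
    fix t :: real
    have "a + t *\<^sub>R (b - a) = a + (t * norm (b - a)) *\<^sub>R n" using ba(1) by (metis scaleR_scaleR)
    then show "a + t *\<^sub>R (b - a) \<in> range (\<lambda>t. a + t *\<^sub>R n)" by blast
    have "a + t *\<^sub>R n = a + (t / norm (b - a)) *\<^sub>R (b - a)" unfolding n_def by (simp add: divide_inverse)
    then show "a + t *\<^sub>R n \<in> range (\<lambda>t. a + t *\<^sub>R (b - a))" by blast
  qed
  with Lr ba that show thesis by blast
qed

lemma is_line_range:
  assumes "norm n = 1" shows "is_line (range (\<lambda>t. a + t *\<^sub>R n))"
proof -
  have "range (\<lambda>t. a + t *\<^sub>R n) = affine hull {a, a + n}" using affine_hull_2_alt[of a "a + n"] by simp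
  moreover have "a \<noteq> a + n" using assms by auto
  ultimately show ?thesis by (simp add: is_line_def aff_dim_2)
qed

lemma is_planeE:
  assumes "is_plane P"
  obtains a b where "norm a = 1" "P = {x. a \<bullet> x = b}"
proof -
  have P: "affine P" "aff_dim P = DIM(real^3) - 1" using assms by (auto simp: is_plane_def)
  obtain a b where ab: "a \<noteq> 0" "P = {x. a \<bullet> x = b}"
    using aff_dim_eq_hyperplane[of P] P affine_hull_eq[of P] by metis
  have "P = {x. (a /\<^sub>R norm a) \<bullet> x = b / norm a}" using ab by (auto simp: field_simps)
  then show thesis using ab that[of "a /\<^sub>R norm a" "b / norm a"] by simp
qed

lemma is_plane_hyperplane: "a \<noteq> 0 \<Longrightarrow> is_plane {x. a \<bullet> x = b}"
  using aff_dim_hyperplane[of a b] by (simp add: is_plane_def affine_hyperplane)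

text \<open>In coordinates \<alpha> along the axis and \<beta> across it, Rodrigues' formula keeps
  \<alpha> and turns m. The base point on the axis drops out, and the two admissible unit directions
  differ only by the sign of \<theta>.\<close>

lemma revolve_eq:
  assumes n: "norm n = 1" and m: "norm m = 1" and nm: "n \<bullet> m = 0"
    and L: "L = range (\<lambda>t. c + t *\<^sub>R n)"
    and S: "S = (\<lambda>(\<alpha>, \<beta>). c + \<alpha> *\<^sub>R n + \<beta> *\<^sub>R m) ` U"
  shows "revolve L S = {c + \<alpha> *\<^sub>R n + \<beta> *\<^sub>R (cos \<theta> *\<^sub>R m + sin \<theta> *\<^sub>R cross3 n m) | \<alpha> \<beta> \<theta>. (\<alpha>, \<beta>) \<in> U}"
proof -
  have nn: "n \<bullet> n = 1" using n by (simp add: norm_eq_1)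
  have rot: "rotate_about (c + t *\<^sub>R n) (\<sigma> *\<^sub>R n) \<theta> (c + \<alpha> *\<^sub>R n + \<beta> *\<^sub>R m) =
      c + \<alpha> *\<^sub>R n + \<beta> *\<^sub>R (cos \<theta> *\<^sub>R m + (\<sigma> * sin \<theta>) *\<^sub>R cross3 n m)" if \<sigma>: "\<sigma> = 1 \<or> \<sigma> = -1" for t \<sigma> \<theta> \<alpha> \<beta>
  proof -
    define s where "s = \<alpha> - t"
    have x: "c + \<alpha> *\<^sub>R n + \<beta> *\<^sub>R m - (c + t *\<^sub>R n) = s *\<^sub>R n + \<beta> *\<^sub>R m" by (simp add: s_def algebra_simps)
    have "cross3 (\<sigma> *\<^sub>R n) (s *\<^sub>R n + \<beta> *\<^sub>R m) = (\<sigma> * \<beta>) *\<^sub>R cross3 n m"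
      by (simp add: cross_add_right cross_mult_left cross_mult_right)
    moreover have "(\<sigma> *\<^sub>R n) \<bullet> (s *\<^sub>R n + \<beta> *\<^sub>R m) = \<sigma> * s" using nn nm by (simp add: inner_add_right)
    ultimately have "rotate_about (c + t *\<^sub>R n) (\<sigma> *\<^sub>R n) \<theta> (c + \<alpha> *\<^sub>R n + \<beta> *\<^sub>R m) =
      c + t *\<^sub>R n + cos \<theta> *\<^sub>R (s *\<^sub>R n + \<beta> *\<^sub>R m) + sin \<theta> *\<^sub>R ((\<sigma> * \<beta>) *\<^sub>R cross3 n m) + ((1 - cos \<theta>) * (\<sigma> * s)) *\<^sub>R (\<sigma> *\<^sub>R n)"
      unfolding rotate_about_def x by simp
    also have "((1 - cos \<theta>) * (\<sigma> * s)) *\<^sub>R (\<sigma> *\<^sub>R n) = ((1 - cos \<theta>) * s) *\<^sub>R n" using \<sigma> by auto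
    finally have e: "rotate_about (c + t *\<^sub>R n) (\<sigma> *\<^sub>R n) \<theta> (c + \<alpha> *\<^sub>R n + \<beta> *\<^sub>R m) =
      c + t *\<^sub>R n + cos \<theta> *\<^sub>R (s *\<^sub>R n + \<beta> *\<^sub>R m) + sin \<theta> *\<^sub>R ((\<sigma> * \<beta>) *\<^sub>R cross3 n m) + ((1 - cos \<theta>) * s) *\<^sub>R n" .
    have "\<alpha> = s + t" by (simp add: s_def)
    then show ?thesis unfolding e by (simp add: algebra_simps)
  qed
  show ?thesis
  proof (intro equalityI subsetI)
    fix y assume "y \<in> revolve L S"
    then obtain a e \<theta> x where y: "y = rotate_about a e \<theta> x" "a \<in> L" "a + e \<in> L" "norm e = 1" "x \<in> S"
      by (auto simp: revolve_def)
    obtain t where t1: "a = c + t *\<^sub>R n" using y(2) unfolding L by blast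
    obtain t' where t2: "a + e = c + t' *\<^sub>R n" using y(3) unfolding L by blast
    note t = t1 t2
    have e: "e = (t' - t) *\<^sub>R n"
      using t1 t2 by (metis add_diff_cancel_left add_diff_cancel_left' scaleR_left_diff_distrib)
    then have \<sigma>: "t' - t = 1 \<or> t' - t = -1" using y(4) n by auto
    obtain \<alpha> \<beta> where x: "(\<alpha>, \<beta>) \<in> U" "x = c + \<alpha> *\<^sub>R n + \<beta> *\<^sub>R m" using y(5) S by auto
    have y': "y = c + \<alpha> *\<^sub>R n + \<beta> *\<^sub>R (cos \<theta> *\<^sub>R m + ((t' - t) * sin \<theta>) *\<^sub>R cross3 n m)"
      unfolding y(1) t(1) e x(2) rot[OF \<sigma>] ..
    have "\<exists>\<theta>'. cos \<theta> = cos \<theta>' \<and> (t' - t) * sin \<theta> = sin \<theta>'"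
      using \<sigma> by (auto intro: exI[of _ \<theta>] exI[of _ "- \<theta>"])
    then show "y \<in> {c + \<alpha> *\<^sub>R n + \<beta> *\<^sub>R (cos \<theta> *\<^sub>R m + sin \<theta> *\<^sub>R cross3 n m) | \<alpha> \<beta> \<theta>. (\<alpha>, \<beta>) \<in> U}"
      using y' x by (auto intro!: exI)
  next
    fix y assume "y \<in> {c + \<alpha> *\<^sub>R n + \<beta> *\<^sub>R (cos \<theta> *\<^sub>R m + sin \<theta> *\<^sub>R cross3 n m) | \<alpha> \<beta> \<theta>. (\<alpha>, \<beta>) \<in> U}"
    then obtain \<alpha> \<beta> \<theta> where y: "y = c + \<alpha> *\<^sub>R n + \<beta> *\<^sub>R (cos \<theta> *\<^sub>R m + sin \<theta> *\<^sub>R cross3 n m)" "(\<alpha>, \<beta>) \<in> U" by blast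
    have "y = rotate_about c n \<theta> (c + \<alpha> *\<^sub>R n + \<beta> *\<^sub>R m)" using rot[of 1 0 \<theta> \<alpha> \<beta>] y by simp
    moreover have "c \<in> L" "c + n \<in> L" unfolding L by (auto intro: range_eqI[of _ _ 0] range_eqI[of _ _ 1])
    moreover have "c + \<alpha> *\<^sub>R n + \<beta> *\<^sub>R m \<in> S" using y(2) S by force
    ultimately show "y \<in> revolve L S" using n unfolding revolve_def by blast
  qed
qed

text \<open>For a point at distance \<open>norm q\<close> from the axis, the nearest point of the
  circle is the one at the same angle: the reverse triangle inequality gives | |q| - R | \<le> |q -
  R w| for every unit vector w. The tube condition thus becomes a disk condition in \<alpha> and
  \<beta>.\<close>

lemma solid_torus_cylindrical:
  assumes n: "norm n = 1" and m: "norm m = 1" and nm: "n \<bullet> m = 0" and R: "R > 0" and r: "r > 0"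
  shows "solid_torus c n R r = {c + \<alpha> *\<^sub>R n + \<beta> *\<^sub>R (cos \<theta> *\<^sub>R m + sin \<theta> *\<^sub>R cross3 n m) | \<alpha> \<beta> \<theta>. \<alpha>\<^sup>2 + (\<beta> - R)\<^sup>2 \<le> r\<^sup>2}"
    (is "_ = ?S")
proof -
  let ?k = "cross3 n m"
  have k: "norm ?k = 1" "m \<bullet> ?k = 0" "n \<bullet> ?k = 0"
    using orthonormal_expansion(2)[OF n m nm] by (simp_all add: dot_cross_self)
  note circ = mem_round_circle_iff(1)[OF m k(1,2) n nm k(3) R]
  define w where "w \<theta> = cos \<theta> *\<^sub>R m + sin \<theta> *\<^sub>R ?k" for \<theta>
  have w: "norm (w \<theta>) = 1" "n \<bullet> w \<theta> = 0" for \<theta>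
    unfolding w_def using norm_cos_sin_comb[OF m k(1,2)] nm k(3) by (simp_all add: inner_add_right)
  have nn: "n \<bullet> n = 1" using n by (simp add: norm_eq_1)
  have split: "norm (\<alpha> *\<^sub>R n + q) ^ 2 = \<alpha>\<^sup>2 + norm q ^ 2" if "n \<bullet> q = 0" for \<alpha> q
    unfolding power2_norm_eq_inner using nn that
    by (simp add: inner_add_left inner_add_right inner_commute[of q n] power2_eq_square)
  show ?thesis
  proof (intro equalityI subsetI)
    fix x assume "x \<in> solid_torus c n R r"
    then obtain \<phi> where "dist (c + R *\<^sub>R w \<phi>) x \<le> r" unfolding solid_torus_def w_def using circ by auto
    then have d: "norm (x - (c + R *\<^sub>R w \<phi>)) \<le> r" by (simp add: dist_norm norm_minus_commute)
    define \<alpha> where "\<alpha> = (x - c) \<bullet> n"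
    define q where "q = x - c - \<alpha> *\<^sub>R n"
    have nq: "n \<bullet> q = 0" using nn by (simp add: q_def \<alpha>_def inner_diff_right inner_commute)
    have "\<exists>\<theta>. q = norm q *\<^sub>R w \<theta>"
    proof (cases "q = 0")
      case False
      then have "q \<in> round_circle 0 n (norm q)" using nq by (simp add: round_circle_def inner_commute)
      then show ?thesis using mem_round_circle_iff(1)[OF m k(1,2) n nm k(3), of "norm q" q 0] False unfolding w_def by auto
    qed simp
    then obtain \<theta> where q: "q = norm q *\<^sub>R w \<theta>" by blast
    have xq: "x - (c + R *\<^sub>R w \<phi>) = \<alpha> *\<^sub>R n + (q - R *\<^sub>R w \<phi>)" by (simp add: q_def)
    have "\<alpha>\<^sup>2 + norm (q - R *\<^sub>R w \<phi>) ^ 2 = norm (x - (c + R *\<^sub>R w \<phi>)) ^ 2"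
      unfolding xq by (rule split[symmetric]) (use nq w(2) in \<open>simp add: inner_diff_right\<close>)
    also have "\<dots> \<le> r\<^sup>2" using d by (intro power_mono) auto
    finally have A: "\<alpha>\<^sup>2 + norm (q - R *\<^sub>R w \<phi>) ^ 2 \<le> r\<^sup>2" .
    have "\<bar>norm q - R\<bar> \<le> norm (q - R *\<^sub>R w \<phi>)" using norm_triangle_ineq3[of q "R *\<^sub>R w \<phi>"] w R by simp
    then have "(norm q - R)\<^sup>2 \<le> norm (q - R *\<^sub>R w \<phi>) ^ 2" by (metis abs_ge_zero power2_abs power_mono)
    then have "\<alpha>\<^sup>2 + (norm q - R)\<^sup>2 \<le> r\<^sup>2" using A by simp
    moreover have "x = c + \<alpha> *\<^sub>R n + norm q *\<^sub>R w \<theta>" using q by (simp add: q_def)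
    ultimately show "x \<in> ?S" unfolding w_def by blast
  next
    fix x assume "x \<in> ?S"
    then obtain \<alpha> \<beta> \<theta> where x: "x = c + \<alpha> *\<^sub>R n + \<beta> *\<^sub>R w \<theta>" "\<alpha>\<^sup>2 + (\<beta> - R)\<^sup>2 \<le> r\<^sup>2" unfolding w_def by blast
    have "x - (c + R *\<^sub>R w \<theta>) = \<alpha> *\<^sub>R n + (\<beta> - R) *\<^sub>R w \<theta>" by (simp add: x algebra_simps)
    then have "norm (x - (c + R *\<^sub>R w \<theta>)) ^ 2 \<le> r\<^sup>2"
      using norm_orthonormal_comb[OF n w(1,2)] x by simp
    then have "norm (x - (c + R *\<^sub>R w \<theta>)) \<le> r" using r by (simp add: power2_le_iff_abs_le)
    then have "x \<in> cball (c + R *\<^sub>R w \<theta>) r" by (simp add: dist_norm norm_minus_commute)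
    moreover have "c + R *\<^sub>R w \<theta> \<in> round_circle c n R" using circ unfolding w_def by blast
    ultimately show "x \<in> solid_torus c n R r" unfolding solid_torus_def by blast
  qed
qed

lemma revolve_disk:
  assumes n: "norm n = 1" and m: "norm m = 1" and nm: "n \<bullet> m = 0" and R: "R > 0" and r: "r > 0"
    and L: "L = range (\<lambda>t. c + t *\<^sub>R n)" and P: "P = {x. cross3 n m \<bullet> x = cross3 n m \<bullet> c}"
  shows "revolve L (cball (c + R *\<^sub>R m) r \<inter> P) = solid_torus c n R r"
    and "revolve L {c + R *\<^sub>R m} = round_circle c n R"
proof -
  let ?k = "cross3 n m"
  have k: "norm ?k = 1" "m \<bullet> ?k = 0" "n \<bullet> ?k = 0"
    using orthonormal_expansion(2)[OF n m nm] by (simp_all add: dot_cross_self)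
  have nn: "n \<bullet> n = 1" "m \<bullet> m = 1" using n m by (simp_all add: norm_eq_1)
  have "cball (c + R *\<^sub>R m) r \<inter> P = (\<lambda>(\<alpha>, \<beta>). c + \<alpha> *\<^sub>R n + \<beta> *\<^sub>R m) ` {(\<alpha>, \<beta>). \<alpha>\<^sup>2 + (\<beta> - R)\<^sup>2 \<le> r\<^sup>2}"
  proof (intro equalityI subsetI)
    fix x assume x: "x \<in> cball (c + R *\<^sub>R m) r \<inter> P"
    define \<alpha> \<beta> where "\<alpha> = (x - c) \<bullet> n" and "\<beta> = (x - c) \<bullet> m"
    have "(x - c) \<bullet> ?k = 0" using x P by (simp add: inner_commute inner_diff_right)
    then have e: "x - c = \<alpha> *\<^sub>R n + \<beta> *\<^sub>R m"
      using orthonormal_expansion(1)[OF n m nm, of "x - c"] by (simp add: \<alpha>_def \<beta>_def)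
    then have xe: "x = c + \<alpha> *\<^sub>R n + \<beta> *\<^sub>R m" by (metis add.assoc add.commute diff_add_cancel)
    have "x - (c + R *\<^sub>R m) = \<alpha> *\<^sub>R n + (\<beta> - R) *\<^sub>R m" by (simp add: xe algebra_simps)
    then have "norm (x - (c + R *\<^sub>R m)) ^ 2 = \<alpha>\<^sup>2 + (\<beta> - R)\<^sup>2" using norm_orthonormal_comb[OF n m nm] by simp
    moreover have "norm (x - (c + R *\<^sub>R m)) ^ 2 \<le> r\<^sup>2" using x by (intro power_mono) (auto simp: dist_norm norm_minus_commute)
    ultimately show "x \<in> (\<lambda>(\<alpha>, \<beta>). c + \<alpha> *\<^sub>R n + \<beta> *\<^sub>R m) ` {(\<alpha>, \<beta>). \<alpha>\<^sup>2 + (\<beta> - R)\<^sup>2 \<le> r\<^sup>2}" using xe by force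
  next
    fix x assume "x \<in> (\<lambda>(\<alpha>, \<beta>). c + \<alpha> *\<^sub>R n + \<beta> *\<^sub>R m) ` {(\<alpha>, \<beta>). \<alpha>\<^sup>2 + (\<beta> - R)\<^sup>2 \<le> r\<^sup>2}"
    then obtain \<alpha> \<beta> where x: "x = c + \<alpha> *\<^sub>R n + \<beta> *\<^sub>R m" "\<alpha>\<^sup>2 + (\<beta> - R)\<^sup>2 \<le> r\<^sup>2" by auto
    have "x - (c + R *\<^sub>R m) = \<alpha> *\<^sub>R n + (\<beta> - R) *\<^sub>R m" by (simp add: x algebra_simps)
    then have "norm (x - (c + R *\<^sub>R m)) ^ 2 \<le> r\<^sup>2" using norm_orthonormal_comb[OF n m nm] x by simp
    then have "norm (x - (c + R *\<^sub>R m)) \<le> r" using r by (simp add: power2_le_iff_abs_le)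
    moreover have "x \<in> P" using k by (simp add: x P inner_add_right dot_cross_self)
    ultimately show "x \<in> cball (c + R *\<^sub>R m) r \<inter> P" by (simp add: dist_norm norm_minus_commute)
  qed
  from revolve_eq[OF n m nm L this] show "revolve L (cball (c + R *\<^sub>R m) r \<inter> P) = solid_torus c n R r"
    unfolding solid_torus_cylindrical[OF n m nm R r] by simp
  have "{c + R *\<^sub>R m} = (\<lambda>(\<alpha>, \<beta>). c + \<alpha> *\<^sub>R n + \<beta> *\<^sub>R m) ` {(0, R)}" by simp
  from revolve_eq[OF n m nm L this] show "revolve L {c + R *\<^sub>R m} = round_circle c n R"
    using mem_round_circle_iff(1)[OF m k(1,2) n nm k(3) R] by auto
qed

text \<open>The centre c is the foot of the perpendicular from Q to the axis, R its length and m its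
  direction. The generating plane contains the axis and Q, so it must be the plane through c normal
  to n x m, as \<open>revolve_disk\<close> requires.\<close>

lemma torus_generated_byE:
  assumes "torus_generated_by T P Q r L"
  obtains c n R where "norm n = 1" "0 < r" "r < R" "T = solid_torus c n R r" "revolve L {Q} = round_circle c n R"
proof -
  have P: "is_plane P" "Q \<in> P" "r > 0" "is_line L" "L \<subseteq> P" "infdist Q L > r"
    and T: "T = revolve L (cball Q r \<inter> P)" using assms by (auto simp: torus_generated_by_def)
  obtain a n where n: "norm n = 1" and La: "L = range (\<lambda>t. a + t *\<^sub>R n)" using is_lineE[OF P(4)] .
  obtain k b where k: "norm k = 1" and Pk: "P = {x. k \<bullet> x = b}" using is_planeE[OF P(1)] .
  define c where "c = a + ((Q - a) \<bullet> n) *\<^sub>R n"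
  have nn: "n \<bullet> n = 1" using n by (simp add: norm_eq_1)
  have cL: "c \<in> L" unfolding c_def La by blast
  have L: "L = range (\<lambda>t. c + t *\<^sub>R n)"
  proof (intro equalityI subsetI)
    fix x assume "x \<in> L"
    then obtain t where "x = a + t *\<^sub>R n" using La by auto
    then have "x = c + (t - (Q - a) \<bullet> n) *\<^sub>R n" by (simp add: c_def algebra_simps)
    then show "x \<in> range (\<lambda>t. c + t *\<^sub>R n)" by blast
  next
    fix x assume "x \<in> range (\<lambda>t. c + t *\<^sub>R n)"
    then obtain t where "x = c + t *\<^sub>R n" by auto
    then have "x = a + ((Q - a) \<bullet> n + t) *\<^sub>R n" by (simp add: c_def algebra_simps)
    then show "x \<in> L" using La by blast
  qed
  define R where "R = norm (Q - c)"
  have R: "r < R" using P(6) infdist_le[OF cL, of Q] by (simp add: R_def dist_norm)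
  define m where "m = (Q - c) /\<^sub>R R"
  have "R > 0" using R P(3) by simp
  then have m: "norm m = 1" using left_inverse[of R] by (simp add: m_def flip: R_def)
  have Q: "Q = c + R *\<^sub>R m" using R P(3) by (simp add: m_def)
  have "(Q - c) \<bullet> n = 0" using nn by (simp add: c_def inner_diff_left inner_add_left)
  then have nm: "n \<bullet> m = 0" by (simp add: m_def inner_commute[of n])
  have "c \<in> P" "c + n \<in> P" using cL L by (auto intro!: subsetD[OF P(5)] range_eqI[of _ _ 1])
  then have kn: "k \<bullet> n = 0" and kc: "k \<bullet> c = b" using Pk by (auto simp: inner_add_right)
  have "R * (k \<bullet> m) = 0" using P(2) Pk kc by (simp add: Q inner_add_right)
  then have km: "k \<bullet> m = 0" using R P(3) by simp
  obtain \<kappa> where kk: "k = \<kappa> *\<^sub>R cross3 n m" using orthonormal_expansion(1)[OF n m nm, of k] kn km by auto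
  then have "\<kappa> \<noteq> 0" using k by auto
  then have Pn: "P = {x. cross3 n m \<bullet> x = cross3 n m \<bullet> c}" unfolding Pk kc[symmetric] kk by simp
  show thesis
    using that[OF n P(3) R] revolve_disk[OF n m nm _ P(3) L Pn, of R] R P(3) T Q by auto
qed

lemma solid_torus_generated:
  assumes n: "norm n = 1" and r: "0 < r" "r < R"
  shows "\<exists>P Q L. torus_generated_by (solid_torus c n R r) P Q r L \<and> revolve L {Q} = round_circle c n R"
proof -
  obtain m where m: "norm m = 1" "n \<bullet> m = 0" using ex_orthonormal_pair[OF n] by metis
  define L where "L = range (\<lambda>t. c + t *\<^sub>R n)"
  define P where "P = {x. cross3 n m \<bullet> x = cross3 n m \<bullet> c}"
  have k: "norm (cross3 n m) = 1" using orthonormal_expansion(2)[OF n m] .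
  note rev = revolve_disk[OF n m _ r(1) L_def P_def, of R]
  have "is_plane P" unfolding P_def using k by (intro is_plane_hyperplane) auto
  moreover have "c + R *\<^sub>R m \<in> P" "L \<subseteq> P" by (auto simp: P_def L_def inner_add_right dot_cross_self)
  moreover have "is_line L" unfolding L_def using n by (rule is_line_range)
  moreover have "infdist (c + R *\<^sub>R m) L \<ge> R"
  proof -
    have "closed L" using \<open>is_line L\<close> affine_hull_eq closed_affine_hull unfolding is_line_def by metis
    moreover have "L \<noteq> {}" by (auto simp: L_def)
    ultimately obtain y where y: "y \<in> L" "infdist (c + R *\<^sub>R m) L = dist (c + R *\<^sub>R m) y"
      using infdist_attains_inf by metis
    obtain t where t: "y = c + t *\<^sub>R n" using y by (auto simp: L_def)
    have ty: "c + R *\<^sub>R m - y = (- t) *\<^sub>R n + R *\<^sub>R m" by (simp add: t)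
    have "norm (c + R *\<^sub>R m - y) ^ 2 = t\<^sup>2 + R\<^sup>2" unfolding ty using norm_orthonormal_comb[OF n m(1,2), of "-t" R] by simp
    then have "R\<^sup>2 \<le> norm (c + R *\<^sub>R m - y) ^ 2" by simp
    then show ?thesis unfolding y(2) dist_norm using power2_le_imp_le norm_ge_zero by blast
  qed
  ultimately have "torus_generated_by (solid_torus c n R r) P (c + R *\<^sub>R m) r L"
    unfolding torus_generated_by_def using r rev by auto
  then show ?thesis using rev r by (auto intro!: exI)
qed

lemma standard_solid_torus_solid_torus: "norm n = 1 \<Longrightarrow> 0 < r \<Longrightarrow> r < R \<Longrightarrow> standard_solid_torus (solid_torus c n R r)"
  using solid_torus_generated unfolding standard_solid_torus_def by blast

text \<open>The definite description is legitimate because all other generating data of the same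
  point set come from a tube by \<open>torus_generated_byE\<close>, and a tube determines its
  circle.\<close>

lemma central_circle_solid_torus:
  assumes n: "norm n = 1" and r: "0 < r" "r < R"
  shows "central_circle (solid_torus c n R r) = round_circle c n R"
  unfolding central_circle_def
proof (rule the_equality)
  show "\<exists>P Q r' L. torus_generated_by (solid_torus c n R r) P Q r' L \<and> round_circle c n R = revolve L {Q}"
    using solid_torus_generated[OF assms, of c] by metis
next
  fix C assume "\<exists>P Q r' L. torus_generated_by (solid_torus c n R r) P Q r' L \<and> C = revolve L {Q}"
  then obtain P Q r' L where g: "torus_generated_by (solid_torus c n R r) P Q r' L" "C = revolve L {Q}" by blast
  obtain c' n' R' where "norm n' = 1" "0 < r'" "r' < R'" "solid_torus c n R r = solid_torus c' n' R' r'"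
    "revolve L {Q} = round_circle c' n' R'" using torus_generated_byE[OF g(1)] .
  then show "C = round_circle c n R" using solid_torus_determines_circle n r g(2) by metis
qed

lemma torus_center_solid_torus: "norm n = 1 \<Longrightarrow> 0 < r \<Longrightarrow> r < R \<Longrightarrow> torus_center (solid_torus c n R r) = c"
  unfolding torus_center_def using central_circle_solid_torus circle_center_round_circle by simp

section \<open>Self-similar sets and the Cantor set\<close>

text \<open>An attractor with pairwise disjoint pieces, described intrinsically on X. The necklace
  and the middle-thirds set will both be instances with the same number q of maps, and matching the
  addresses of points is then a homeomorphism.\<close>

definition self_similar :: "'a::heine_borel set \<Rightarrow> nat \<Rightarrow> (nat \<Rightarrow> 'a \<Rightarrow> 'a) \<Rightarrow> real \<Rightarrow> bool" where
  "self_similar X q f \<kappa> \<longleftrightarrow> compact X \<and> X \<noteq> {} \<and> 0 \<le> \<kappa> \<and> \<kappa> < 1 \<and> X = (\<Union>k<q. f k ` X) \<and>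
     (\<forall>j<q. \<forall>k<q. j \<noteq> k \<longrightarrow> f j ` X \<inter> f k ` X = {}) \<and> (\<forall>k<q. inj_on (f k) X) \<and>
     (\<forall>k<q. \<forall>x\<in>X. \<forall>y\<in>X. dist (f k x) (f k y) \<le> \<kappa> * dist x y)"

definition words :: "nat \<Rightarrow> nat \<Rightarrow> nat list set" where
  "words q n = {w. set w \<subseteq> {..<q} \<and> length w = n}"

text \<open>The head of the word is applied last, so lengthening a word at its end passes to a
  smaller piece inside the old one.\<close>

fun word_map :: "(nat \<Rightarrow> 'a \<Rightarrow> 'a) \<Rightarrow> nat list \<Rightarrow> 'a \<Rightarrow> 'a" where
  "word_map f [] x = x"
| "word_map f (k # w) x = f k (word_map f w x)"

lemma word_map_append: "word_map f (v @ w) x = word_map f v (word_map f w x)"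
  by (induction v) auto

lemma finite_words: "finite (words q n)"
  unfolding words_def by (rule finite_lists_length_eq) simp

lemma word_map_closed:
  assumes "\<And>k x. k < q \<Longrightarrow> x \<in> X \<Longrightarrow> f k x \<in> X" "set w \<subseteq> {..<q}" "x \<in> X"
  shows "word_map f w x \<in> X"
  using assms(2) by (induction w) (use assms in auto)

lemma word_map_in:
  assumes "self_similar X q f \<kappa>" "set w \<subseteq> {..<q}" "x \<in> X"
  shows "word_map f w x \<in> X"
proof (rule word_map_closed[OF _ assms(2,3)])
  show "f k x \<in> X" if "k < q" "x \<in> X" for k x
    using assms(1) that unfolding self_similar_def by blast
qed

lemma word_map_dist:
  assumes "self_similar X q f \<kappa>" "set w \<subseteq> {..<q}" "x \<in> X" "y \<in> X"
  shows "dist (word_map f w x) (word_map f w y) \<le> \<kappa> ^ length w * dist x y"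
  using assms(2)
proof (induction w)
  case (Cons k w)
  have in': "word_map f w x \<in> X" "word_map f w y \<in> X" using word_map_in[OF assms(1)] Cons assms by auto
  have "dist (word_map f (k # w) x) (word_map f (k # w) y) \<le> \<kappa> * dist (word_map f w x) (word_map f w y)"
    using in' Cons.prems assms(1) by (auto simp: self_similar_def)
  also have "\<dots> \<le> \<kappa> * (\<kappa> ^ length w * dist x y)"
    using Cons assms(1) by (intro mult_left_mono) (auto simp: self_similar_def)
  finally show ?case by (simp add: mult_ac)
qed simp

lemma word_map_cover:
  assumes "self_similar X q f \<kappa>"
  shows "X = (\<Union>w\<in>words q n. word_map f w ` X)"
proof (induction n)
  case 0
  then show ?case by (simp add: words_def)
next
  case (Suc n)
  have "words q (Suc n) = (\<Union>k<q. (#) k ` words q n)"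
    by (auto simp: words_def length_Suc_conv)
  then have "(\<Union>w\<in>words q (Suc n). word_map f w ` X) = (\<Union>k<q. f k ` (\<Union>w\<in>words q n. word_map f w ` X))"
    by (auto simp: image_iff)
  also have "\<dots> = X" using assms unfolding Suc[symmetric] by (auto simp: self_similar_def)
  finally show ?case by simp
qed

lemma word_map_coverE:
  assumes "self_similar X q f \<kappa>" "x \<in> X"
  obtains w where "w \<in> words q n" "x \<in> word_map f w ` X"
proof -
  have "x \<in> (\<Union>w\<in>words q n. word_map f w ` X)"
    using assms(2) equalityD1[OF word_map_cover[OF assms(1), of n]] by (rule rev_subsetD)
  then show thesis using that by blast
qed

lemma words_Suc: "words q (Suc n) = (\<Union>k<q. (#) k ` words q n)"
  by (auto simp: words_def length_Suc_conv)

text \<open>The outermost letters agree by disjointness, and injectivity strips them off. The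
  hypotheses are the bare ones on the maps so that the result serves attractors and also the solid
  torus from which the stages are built.\<close>

lemma word_map_images_disjoint:
  assumes cl: "\<And>k x. k < q \<Longrightarrow> x \<in> X \<Longrightarrow> f k x \<in> X"
    and dj: "\<And>j k. j < q \<Longrightarrow> k < q \<Longrightarrow> j \<noteq> k \<Longrightarrow> f j ` X \<inter> f k ` X = {}"
    and inj: "\<And>k. k < q \<Longrightarrow> inj_on (f k) X"
    and "v \<in> words q n" "w \<in> words q n" "x \<in> word_map f v ` X" "x \<in> word_map f w ` X"
  shows "v = w"
  using assms(4-)
proof (induction n arbitrary: v w x)
  case (Suc n)
  obtain j v' where v: "v = j # v'" "j < q" "v' \<in> words q n" using Suc.prems(1) unfolding words_Suc by blast
  obtain k w' where w: "w = k # w'" "k < q" "w' \<in> words q n" using Suc.prems(2) unfolding words_Suc by blast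
  obtain a where a: "a \<in> X" "x = f j (word_map f v' a)" using Suc.prems(3) v by auto
  obtain b where b: "b \<in> X" "x = f k (word_map f w' b)" using Suc.prems(4) w by auto
  have in': "word_map f v' a \<in> X" "word_map f w' b \<in> X"
    using word_map_closed[of q X f, OF cl] a b v w by (auto simp: words_def)
  have "x \<in> f j ` X" unfolding a(2) using in'(1) by (rule imageI)
  moreover have "x \<in> f k ` X" unfolding b(2) using in'(2) by (rule imageI)
  ultimately have jk: "j = k" using dj[OF v(2) w(2)] by blast
  then have "word_map f v' a = word_map f w' b"
    using inj[OF w(2)] in' a(2) b(2) by (metis inj_onD)
  then have "v' = w'" using Suc.IH[OF v(3) w(3), of "word_map f v' a"] a(1) b(1) by (metis imageI)
  then show ?case using jk v w by simp
qed (auto simp: words_def)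

lemma word_map_disjoint:
  assumes X: "self_similar X q f \<kappa>"
    and vw: "v \<in> words q n" "w \<in> words q n" "x \<in> word_map f v ` X" "x \<in> word_map f w ` X"
  shows "v = w"
proof (rule word_map_images_disjoint[OF _ _ _ vw])
  show "f k y \<in> X" if "k < q" "y \<in> X" for k y
    using X that unfolding self_similar_def by blast
qed (use X in \<open>auto simp: self_similar_def\<close>)

lemma compact_word_map_image:
  assumes "self_similar X q f \<kappa>" "set w \<subseteq> {..<q}"
  shows "compact (word_map f w ` X)"
proof (rule compact_continuous_image)
  have "\<kappa> ^ length w \<ge> 0" using assms by (auto simp: self_similar_def)
  then have "lipschitz_on (\<kappa> ^ length w) X (word_map f w)"
    by (intro lipschitz_onI word_map_dist[OF assms])
  then show "continuous_on X (word_map f w)" by (rule lipschitz_on_continuous_on)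
qed (use assms in \<open>simp add: self_similar_def\<close>)

text \<open>Replaces infinite symbol sequences: two points correspond if, at every level, they lie
  in the pieces with the same words.\<close>

definition same_address ::
  "'a set \<Rightarrow> (nat \<Rightarrow> 'a \<Rightarrow> 'a) \<Rightarrow> 'b set \<Rightarrow> (nat \<Rightarrow> 'b \<Rightarrow> 'b) \<Rightarrow> nat \<Rightarrow> 'a \<Rightarrow> 'b \<Rightarrow> bool" where
  "same_address X f Y g q x y \<longleftrightarrow> (\<forall>n. \<forall>w\<in>words q n. x \<in> word_map f w ` X \<longleftrightarrow> y \<in> word_map g w ` Y)"

lemma same_address_commute: "same_address X f Y g q x y \<longleftrightarrow> same_address Y g X f q y x"
  by (auto simp: same_address_def)

text \<open>The words of the pieces containing x extend one another, so the corresponding pieces of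
  Y form a decreasing sequence of nonempty compact sets; any common point is a partner of x.\<close>

lemma same_address_exists:
  assumes X: "self_similar X q f \<kappa>" and Y: "self_similar Y q g \<mu>" and x: "x \<in> X"
  shows "\<exists>y\<in>Y. same_address X f Y g q x y"
proof -
  have "\<exists>w\<in>words q n. x \<in> word_map f w ` X" for n
    using word_map_coverE[OF X x] by metis
  then obtain w where w: "\<And>n. w n \<in> words q n" "\<And>n. x \<in> word_map f (w n) ` X" by metis
  have ws: "set (w n) \<subseteq> {..<q}" "length (w n) = n" for n using w(1)[of n] by (auto simp: words_def)
  define D where "D n = word_map g (w n) ` Y" for n
  have nest: "D (Suc n) \<subseteq> D n" for n
  proof -
    obtain u k where u: "w (Suc n) = u @ [k]" using ws(2)[of "Suc n"] by (metis length_Suc_conv_rev)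
    have uw: "u \<in> words q n" "k < q" using ws[of "Suc n"] u by (auto simp: words_def)
    have "x \<in> word_map f u ` X"
      using w(2)[of "Suc n"] word_map_in[OF X, of "[k]"] uw(2) unfolding u by (force simp: word_map_append)
    \<comment> \<open>Without its last letter the word for level n + 1 still describes a piece
      containing x, and there is only one such piece at level n.\<close>
    then have "u = w n" using word_map_disjoint[OF X uw(1) w(1)] w(2) by blast
    then show ?thesis unfolding D_def u using word_map_in[OF Y, of "[k]"] uw(2) by (force simp: word_map_append)
  qed
  have "(\<Inter>n. D n) \<noteq> {}"
  proof (rule compact_nest)
    show "compact (D n)" for n unfolding D_def by (rule compact_word_map_image[OF Y ws(1)])
    show "D n \<noteq> {}" for n using Y by (auto simp: D_def self_similar_def)
    show "\<And>m n. m \<le> n \<Longrightarrow> D n \<subseteq> D m" using nest by (simp add: lift_Suc_antimono_le)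
  qed
  then obtain y where y: "\<And>n. y \<in> D n" by blast
  have "same_address X f Y g q x y" unfolding same_address_def
    using word_map_disjoint[OF X _ w(1) _ w(2)] word_map_disjoint[OF Y _ w(1)] y w(2) unfolding D_def by blast
  moreover have "y \<in> Y" using y[of 0] ws(2)[of 0] by (simp add: D_def)
  ultimately show ?thesis by blast
qed

text \<open>At a level where pieces of Y have diameter below e, the point x has positive distance to
  all pieces of X except its own. Points near x share that piece, so their partners share a piece of
  Y. With x' = x this yields uniqueness of partners, and in general continuity.\<close>

lemma same_address_close:
  assumes X: "self_similar X q f \<kappa>" and Y: "self_similar Y q g \<mu>" and e: "e > 0" and x: "x \<in> X"
  shows "\<exists>d>0. \<forall>x'\<in>X. \<forall>y\<in>Y. \<forall>y'\<in>Y. dist x x' < d \<longrightarrow> same_address X f Y g q x y \<longrightarrow> same_address X f Y g q x' y' \<longrightarrow> dist y y' < e"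
proof -
  have "bounded Y" using Y by (simp add: self_similar_def compact_imp_bounded)
  then obtain B where B: "\<And>y y'. y \<in> Y \<Longrightarrow> y' \<in> Y \<Longrightarrow> dist y y' \<le> B" unfolding bounded_two_points by blast
  have "(\<lambda>n. \<mu> ^ n * B) \<longlonglongrightarrow> 0 * B"
    by (intro tendsto_intros LIMSEQ_realpow_zero) (use Y in \<open>auto simp: self_similar_def\<close>)
  then have "eventually (\<lambda>n. \<mu> ^ n * B < e) sequentially" using e by (intro order_tendstoD) auto
  then obtain n where n: "\<mu> ^ n * B < e" unfolding eventually_sequentially by blast
  obtain w where w: "w \<in> words q n" "x \<in> word_map f w ` X"
    using word_map_coverE[OF X x] .
  have wq: "set w \<subseteq> {..<q}" "length w = n" using w by (auto simp: words_def)
  define Z where "Z = (\<Union>v\<in>words q n - {w}. word_map f v ` X)"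
  have "compact Z" unfolding Z_def
    by (intro compact_UN finite_Diff finite_words compact_word_map_image[OF X]) (auto simp: words_def)
  moreover have "x \<notin> Z" using word_map_disjoint[OF X _ w(1) _ w(2)] unfolding Z_def by blast
  ultimately obtain d where d: "d > 0" "\<And>z. z \<in> Z \<Longrightarrow> d \<le> dist x z"
    using separate_point_closed[of Z x] compact_imp_closed by (metis dist_commute)
  have "dist y y' < e" if x': "x' \<in> X" and "y \<in> Y" "y' \<in> Y" "dist x x' < d"
    "same_address X f Y g q x y" "same_address X f Y g q x' y'" for x' y y'
  proof -
    have "x' \<notin> Z" using d that by force
    moreover obtain v where "v \<in> words q n" "x' \<in> word_map f v ` X"
      using word_map_coverE[OF X x'] .
    ultimately have "x' \<in> word_map f w ` X" unfolding Z_def by blast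
    then have "y \<in> word_map g w ` Y" "y' \<in> word_map g w ` Y" using that w unfolding same_address_def by auto
    then obtain a b where ab: "a \<in> Y" "b \<in> Y" "y = word_map g w a" "y' = word_map g w b" by auto
    have "dist y y' \<le> \<mu> ^ n * dist a b" using word_map_dist[OF Y wq(1)] wq(2) ab by simp
    also have "\<dots> \<le> \<mu> ^ n * B" using B ab Y by (intro mult_left_mono) (auto simp: self_similar_def)
    finally show ?thesis using n by simp
  qed
  then show ?thesis using d(1) by blast
qed

lemma same_address_unique:
  assumes X: "self_similar X q f \<kappa>" and Y: "self_similar Y q g \<mu>" and x: "x \<in> X"
    and "y \<in> Y" "y' \<in> Y" "same_address X f Y g q x y" "same_address X f Y g q x y'"
  shows "y = y'"
proof (rule ccontr)
  assume "y \<noteq> y'"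
  then show False using same_address_close[OF X Y _ x, of "dist y y'"] assms x by force
qed

lemma self_similar_homeomorphic:
  assumes X: "self_similar X q f \<kappa>" and Y: "self_similar Y q g \<mu>"
  shows "X homeomorphic Y"
proof -
  obtain h where h: "\<And>x. x \<in> X \<Longrightarrow> h x \<in> Y" "\<And>x. x \<in> X \<Longrightarrow> same_address X f Y g q x (h x)"
    using same_address_exists[OF X Y] by metis
  obtain k where k: "\<And>y. y \<in> Y \<Longrightarrow> k y \<in> X" "\<And>y. y \<in> Y \<Longrightarrow> same_address Y g X f q y (k y)"
    using same_address_exists[OF Y X] by metis
  have "continuous_on X h" unfolding continuous_on_iff
    using same_address_close[OF X Y] h by (metis dist_commute)
  moreover have "continuous_on Y k" unfolding continuous_on_iff
    using same_address_close[OF Y X] k by (metis dist_commute)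
  moreover have "k (h x) = x" if "x \<in> X" for x
    using same_address_unique[OF Y X h(1)[OF that]] k h that same_address_commute by metis
  moreover have "h (k y) = y" if "y \<in> Y" for y
    using same_address_unique[OF X Y k(1)[OF that]] k h that same_address_commute by metis
  ultimately show ?thesis unfolding homeomorphic_def homeomorphism_def using h(1) k(1)
    by (intro exI[of _ h] exI[of _ k]) force
qed

section \<open>The middle-thirds set as an attractor of q maps\<close>

lemma cantor_stage_subset: "cantor_stage n \<subseteq> {0..1}"
  by (induction n) auto

lemma zero_in_cantor_stage: "0 \<in> cantor_stage n"
  by (induction n) (auto simp: image_iff intro: bexI[of _ 0])

lemma compact_cantor_stage: "compact (cantor_stage n)"
  by (induction n) (auto intro!: compact_Un compact_continuous_image continuous_intros)

lemma cantor_set_subset: "middle_thirds_cantor_set \<subseteq> {0..1}"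
  using INT_lower[of 0 UNIV cantor_stage] by (simp add: middle_thirds_cantor_set_def)

lemma cantor_set_self_similar:
  "middle_thirds_cantor_set =
    (\<lambda>x. x / 3) ` middle_thirds_cantor_set \<union> (\<lambda>x. 2 / 3 + x / 3) ` middle_thirds_cantor_set" (is "?K = ?L \<union> ?R")
proof (intro equalityI subsetI)
  fix x assume "x \<in> ?L \<union> ?R"
  then have "x \<in> cantor_stage (Suc n)" for n by (auto simp: middle_thirds_cantor_set_def)
  moreover have "x \<in> cantor_stage 0" using cantor_stage_subset[of 1] calculation[of 0] by auto
  ultimately show "x \<in> ?K" unfolding middle_thirds_cantor_set_def by (metis INT_I not0_implies_Suc)
next
  fix x assume "x \<in> ?K"
  then have x: "x \<in> cantor_stage n" for n by (auto simp: middle_thirds_cantor_set_def)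
  have s: "x \<in> (\<lambda>x. x / 3) ` cantor_stage n \<or> x \<in> (\<lambda>x. 2 / 3 + x / 3) ` cantor_stage n" for n
    using x[of "Suc n"] by simp
  show "x \<in> ?L \<union> ?R"
  \<comment> \<open>The branch has to be the same at every stage. Comparison with 1/2 decides it,
    because the left copies lie in [0,1/3] and the right ones in [2/3,1].\<close>
  proof (cases "x \<le> 1/2")
    case True
    have "3 * x \<in> cantor_stage n" for n
      using s[of n] cantor_stage_subset[of n] True by force
    then have "3 * x \<in> ?K" by (auto simp: middle_thirds_cantor_set_def)
    then show ?thesis by (intro UnI1 image_eqI[of _ _ "3 * x"]) auto
  next
    case False
    have "3 * x - 2 \<in> cantor_stage n" for n
      using s[of n] cantor_stage_subset[of n] False by (force simp: field_simps)
    then have "3 * x - 2 \<in> ?K" by (auto simp: middle_thirds_cantor_set_def)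
    then show ?thesis by (intro UnI2 image_eqI[of _ _ "3 * x - 2"]) (auto simp: field_simps)
  qed
qed

text \<open>The complete prefix code \<open>0, 10, 110, \<dots>\<close>: the right map iterated \<open>k\<close> times, followed by the left
  map except for the last letter of the alphabet.\<close>

definition cantor_map :: "nat \<Rightarrow> nat \<Rightarrow> real \<Rightarrow> real" where
  "cantor_map q k x = (if Suc k = q then 1 - (1 - x) / 3 ^ k else 1 - (1 - x / 3) / 3 ^ k)"

text \<open>The right map is x -> 1 - (1 - x) / 3, so its iterates are 1 - (1 - x) / 3^m; each
  induction step splits the rightmost copy into its two halves.\<close>

lemma cantor_set_self_similar_prefix:
  "middle_thirds_cantor_set =
    (\<Union>k<m. (\<lambda>x. 1 - (1 - x / 3) / 3 ^ k) ` middle_thirds_cantor_set) \<union> (\<lambda>x. 1 - (1 - x) / 3 ^ m) ` middle_thirds_cantor_set"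
    (is "?K = _")
proof (induction m)
  case (Suc m)
  have "(\<lambda>x. 1 - (1 - x) / 3 ^ m) ` ?K = (\<lambda>x. 1 - (1 - x) / 3 ^ m) ` ((\<lambda>x. x / 3) ` ?K \<union> (\<lambda>x. 2 / 3 + x / 3) ` ?K)"
    using cantor_set_self_similar by simp
  also have "\<dots> = (\<lambda>x. 1 - (1 - x / 3) / 3 ^ m) ` ?K \<union> (\<lambda>x. 1 - (1 - x) / 3 ^ Suc m) ` ?K"
    unfolding image_Un image_image by (simp add: field_simps)
  finally have e: "(\<lambda>x. 1 - (1 - x) / 3 ^ m) ` ?K = (\<lambda>x. 1 - (1 - x / 3) / 3 ^ m) ` ?K \<union> (\<lambda>x. 1 - (1 - x) / 3 ^ Suc m) ` ?K" .
  have "(\<Union>k<Suc m. (\<lambda>x. 1 - (1 - x / 3) / 3 ^ k) ` ?K) \<union> (\<lambda>x. 1 - (1 - x) / 3 ^ Suc m) ` ?K =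
    (\<Union>k<m. (\<lambda>x. 1 - (1 - x / 3) / 3 ^ k) ` ?K) \<union> (\<lambda>x. 1 - (1 - x) / 3 ^ m) ` ?K"
    unfolding e lessThan_Suc by blast
  from trans[OF Suc this[symmetric]] show ?case .
qed simp

lemma self_similar_cantor_set:
  assumes "q \<ge> 2"
  shows "self_similar middle_thirds_cantor_set q (cantor_map q) (1/3)"
proof -
  let ?K = middle_thirds_cantor_set
  obtain m where m: "q = Suc m" "m \<ge> 1" using assms by (cases q) auto
  have cover: "?K = (\<Union>k<q. cantor_map q k ` ?K)"
  proof -
    have "(\<Union>k<q. cantor_map q k ` ?K) = (\<Union>k<m. cantor_map q k ` ?K) \<union> cantor_map q m ` ?K"
      unfolding m lessThan_Suc by blast
    also have "\<dots> = (\<Union>k<m. (\<lambda>x. 1 - (1 - x / 3) / 3 ^ k) ` ?K) \<union> (\<lambda>x. 1 - (1 - x) / 3 ^ m) ` ?K"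
      unfolding cantor_map_def m by (intro arg_cong2[of _ _ _ _ "(\<union>)"] SUP_cong) auto
    finally show ?thesis using cantor_set_self_similar_prefix[of m] by simp
  qed
  \<comment> \<open>Pieces are told apart by their distance to 1: piece k is within 3^(-k), at most
    a third of 3^(-j), while piece j stays at least two thirds of 3^(-j) away.\<close>
  have lt: "cantor_map q j x \<noteq> cantor_map q k y" if "x \<in> ?K" "y \<in> ?K" "j < k" "k < q" for j k x y
  proof -
    have xy: "0 \<le> x" "x \<le> 1" "0 \<le> y" "y \<le> 1" using cantor_set_subset that by auto
    have p: "(3::real) ^ j > 0" "(3::real) ^ k \<ge> 3 * 3 ^ j"
      using that(3) power_increasing[of "Suc j" k "3::real"] by auto
    have "1 - cantor_map q k y \<le> 1 / 3 ^ k" unfolding cantor_map_def using xy by (auto simp: divide_right_mono)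
    also have "\<dots> \<le> (1/3) / 3 ^ j" using p by (simp add: field_simps)
    also have "\<dots> < (1 - x / 3) / 3 ^ j" using p xy by (intro divide_strict_right_mono) auto
    also have "\<dots> = 1 - cantor_map q j x" using that by (auto simp: cantor_map_def)
    finally show ?thesis by auto
  qed
  \<comment> \<open>The last map lacks the additional factor 1/3, but there k = q - 1 is at least 1,
    so the ratio 1/3 holds for it too.\<close>
  have lip: "dist (cantor_map q k x) (cantor_map q k y) \<le> 1/3 * dist x y" if "k < q" for k x y
  proof (cases "Suc k = q")
    case True
    have "cantor_map q k x - cantor_map q k y = (x - y) / 3 ^ k" by (simp add: cantor_map_def True field_simps)
    moreover have "(3::real) ^ k \<ge> 3" using True m power_increasing[of 1 k "3::real"] by auto
    moreover have "\<bar>x - y\<bar> * 3 \<le> \<bar>x - y\<bar> * 3 ^ k" using calculation by (intro mult_left_mono) auto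
    ultimately show ?thesis by (simp add: dist_real_def pos_divide_le_eq)
  next
    case False
    have e: "cantor_map q k x - cantor_map q k y = (x - y) / 3 / 3 ^ k" using False by (simp add: cantor_map_def field_simps)
    have "\<bar>x - y\<bar> \<le> \<bar>x - y\<bar> * 3 ^ k" by (simp add: mult_le_cancel_left1)
    then show ?thesis unfolding dist_real_def e by (simp add: abs_mult pos_divide_le_eq)
  qed
  have "compact ?K" unfolding middle_thirds_cantor_set_def
    using compact_cantor_stage by (intro compact_Inter) auto
  moreover have "?K \<noteq> {}" using zero_in_cantor_stage by (auto simp: middle_thirds_cantor_set_def)
  moreover have "inj_on (cantor_map q k) ?K" for k by (auto simp: inj_on_def cantor_map_def)
  moreover have "cantor_map q j ` ?K \<inter> cantor_map q k ` ?K = {}" if "j < q" "k < q" "j \<noteq> k" for j k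
    using lt[of _ _ j k] lt[of _ _ k j] that by (cases "j < k") (auto, metis nat_neq_iff)
  ultimately show ?thesis unfolding self_similar_def using cover lip by auto
qed

section \<open>Covering dimension of planar sets\<close>

text \<open>At level n the image is covered by at most q^n squares of side 2 \<rho> s^n, with total
  area 4 \<rho>^2 (q s^2)^n, which tends to 0.\<close>

lemma negligible_planar_projection:
  fixes A :: "(real^3) set"
  assumes uv: "norm u \<le> 1" "norm v \<le> 1" and \<rho>: "\<rho> > 0" and s: "0 < s" "real q * s\<^sup>2 < 1"
    and cov: "\<And>n. \<exists>W. finite W \<and> card W \<le> q ^ n \<and> A \<subseteq> (\<Union>c\<in>W. cball c (\<rho> * s ^ n))"
  shows "negligible ((\<lambda>x. (x \<bullet> u, x \<bullet> v)) ` A)"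
  unfolding negligible_outer_le
proof (intro allI impI)
  fix e :: real assume e: "e > 0"
  have "(\<lambda>n. 4 * \<rho>\<^sup>2 * (real q * s\<^sup>2) ^ n) \<longlonglongrightarrow> 4 * \<rho>\<^sup>2 * 0"
    by (intro tendsto_intros LIMSEQ_realpow_zero) (use s in auto)
  then have "eventually (\<lambda>n. 4 * \<rho>\<^sup>2 * (real q * s\<^sup>2) ^ n < e) sequentially" using e by (intro order_tendstoD) auto
  then obtain n where n: "4 * \<rho>\<^sup>2 * (real q * s\<^sup>2) ^ n < e" unfolding eventually_sequentially by blast
  obtain W where W: "finite W" "card W \<le> q ^ n" "A \<subseteq> (\<Union>c\<in>W. cball c (\<rho> * s ^ n))" using cov by blast
  define \<epsilon> where "\<epsilon> = \<rho> * s ^ n"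
  have \<epsilon>: "\<epsilon> > 0" using \<rho> s by (simp add: \<epsilon>_def)
  define B where "B c = cbox (c \<bullet> u - \<epsilon>, c \<bullet> v - \<epsilon>) (c \<bullet> u + \<epsilon>, c \<bullet> v + \<epsilon>)" for c
  have mB: "measure lebesgue (B c) = 4 * \<epsilon>\<^sup>2" for c
  proof -
    have "measure lebesgue (B c) = measure lborel (B c)" by (simp add: B_def measure_completion)
    also have "\<dots> = (2 * \<epsilon>) * (2 * \<epsilon>)" unfolding B_def content_Pair using \<epsilon> by simp
    finally show ?thesis by (simp add: power2_eq_square)
  qed
  have "measure lebesgue (\<Union>c\<in>W. B c) \<le> (\<Sum>c\<in>W. measure lebesgue (B c))"
    by (rule measure_UNION_le) (use W in \<open>auto simp: B_def\<close>)
  also have "\<dots> = real (card W) * (4 * \<epsilon>\<^sup>2)" by (simp add: mB)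
  also have "\<dots> \<le> real (q ^ n) * (4 * \<epsilon>\<^sup>2)" using W(2) by (intro mult_right_mono) (auto simp del: of_nat_power)
  also have "\<dots> = 4 * \<rho>\<^sup>2 * (real q * s\<^sup>2) ^ n" by (simp add: \<epsilon>_def power_mult_distrib power2_eq_square)
  finally have m: "measure lebesgue (\<Union>c\<in>W. B c) \<le> e" using n by simp
  have "(\<lambda>x. (x \<bullet> u, x \<bullet> v)) ` A \<subseteq> (\<Union>c\<in>W. B c)"
  proof (rule image_subsetI)
    fix x assume "x \<in> A"
    then obtain c where c: "c \<in> W" "dist c x \<le> \<epsilon>" using W(3) unfolding \<epsilon>_def by auto
    have "\<bar>(x - c) \<bullet> w\<bar> \<le> \<epsilon>" if "norm w \<le> 1" for w
    proof -
      have "\<bar>(x - c) \<bullet> w\<bar> \<le> norm (x - c) * norm w" by (rule Cauchy_Schwarz_ineq2)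
      also have "\<dots> \<le> \<epsilon> * 1" using c that \<epsilon> by (intro mult_mono) (auto simp: dist_norm norm_minus_commute)
      finally show ?thesis by simp
    qed
    from this[OF uv(1)] this[OF uv(2)] have "(x \<bullet> u, x \<bullet> v) \<in> B c"
      by (auto simp: B_def cbox_Pair_eq inner_diff_left abs_le_iff)
    then show "(x \<bullet> u, x \<bullet> v) \<in> (\<Union>c\<in>W. B c)" using c by blast
  qed
  moreover have "(\<Union>c\<in>W. B c) \<in> lmeasurable" by (rule fmeasurable.finite_UN) (use W in \<open>auto simp: B_def\<close>)
  ultimately show "\<exists>T. (\<lambda>x. (x \<bullet> u, x \<bullet> v)) ` A \<subseteq> T \<and> T \<in> lmeasurable \<and> measure lebesgue T \<le> e"
    using m by blast
qed

text \<open>Countably many lattice translates of a null set do not fill the plane. A point outside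
  all of them is the origin of a grid none of whose vertices lies in S.\<close>

lemma negligible_avoids_lattice:
  fixes S :: "(real \<times> real) set"
  assumes S: "negligible S" and h: "h > 0"
  obtains a b where "\<And>x y. (x, y) \<in> S \<Longrightarrow> (x - a) / h \<in> \<int> \<Longrightarrow> (y - b) / h \<notin> \<int>"
proof -
  define F where "F = (\<lambda>(m::int, n::int). (+) (- (h * m), - (h * n)) ` S)"
  have "negligible (\<Union>(range F))"
    by (rule negligible_countable_Union) (auto simp: F_def intro!: negligible_translation S)
  then have "\<Union>(range F) \<noteq> UNIV" using non_negligible_UNIV by metis
  then obtain a b where ab: "(a, b) \<notin> \<Union>(range F)" by (metis UNIV_eq_I surj_pair)
  show thesis
  proof (rule that, rule notI)
    fix x y assume xy: "(x, y) \<in> S" "(x - a) / h \<in> \<int>" "(y - b) / h \<in> \<int>"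
    obtain m n :: int where "(x - a) / h = m" "(y - b) / h = n" using xy by (auto elim!: Ints_cases)
    then have "x - a = h * m" "y - b = h * n" using h by (auto simp: field_simps)
    then have "(a, b) = (- (h * m), - (h * n)) + (x, y)" by auto
    then have "(a, b) \<in> F (m, n)" using xy unfolding F_def by blast
    then show False using ab by blast
  qed
qed

text \<open>A point lies in two of the slightly thickened unit intervals only near an integer. This
  is the one-dimensional count from which the order of the planar cover is computed.\<close>

lemma overlapping_unit_intervals:
  fixes t \<eta> :: real assumes \<eta>: "0 < \<eta>" "\<eta> < 1/2"
  obtains m1 m2 :: int where "\<And>m::int. m - \<eta> < t \<Longrightarrow> t < m + 1 + \<eta> \<Longrightarrow> m = m1 \<or> m = m2"
    "infdist t \<int> \<ge> \<eta> \<Longrightarrow> m1 = m2"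
proof -
  define k where "k = \<lfloor>t\<rfloor>"
  have k: "k \<le> t" "t < k + 1" by (auto simp: k_def)
  have cases3: "m = k \<or> m = k - 1 \<and> t < k + \<eta> \<or> m = k + 1 \<and> t > k + 1 - \<eta>" if "m - \<eta> < t" "t < m + 1 + \<eta>" for m :: int
  proof -
    have "real_of_int m < k + 2" "real_of_int m > k - 2" using that k \<eta> by linarith+
    then have "m < k + 2" "m > k - 2" by linarith+
    then have "m = k - 1 \<or> m = k \<or> m = k + 1" by linarith
    then show ?thesis using that by auto
  qed
  have d: "infdist t \<int> \<le> \<bar>t - k\<bar>" "infdist t \<int> \<le> \<bar>t - (k + 1)\<bar>"
    using infdist_le[of "of_int k" "\<int>" t] infdist_le[of "of_int (k + 1)" "\<int>" t] by (auto simp: dist_real_def)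
  consider "t < k + \<eta>" | "t > k + 1 - \<eta>" | "t \<ge> k + \<eta>" "t \<le> k + 1 - \<eta>" by linarith
  then show thesis
  proof cases
    case 1
    show thesis by (rule that[of k "k - 1"]) (use cases3 1 d k \<eta> in \<open>force+\<close>)
  next
    case 2
    show thesis by (rule that[of k "k + 1"]) (use cases3 2 d k \<eta> in \<open>force+\<close>)
  next
    case 3
    show thesis by (rule that[of k k]) (use cases3 3 d k \<eta> in \<open>force+\<close>)
  qed
qed

text \<open>A square grid whose vertices avoid the planar image of \<open>X\<close> gives, after a slight thickening of its squares,
  covers of order two: a point of \<open>X\<close> cannot be close to grid lines in both directions.\<close>

lemma covering_dim_le_1_planar:
  fixes X :: "'a::real_normed_vector set" and f g :: "'a \<Rightarrow> real"
  assumes X: "compact X" and f: "continuous_on X f" and g: "continuous_on X g"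
    and d: "\<And>x y. x \<in> X \<Longrightarrow> y \<in> X \<Longrightarrow> dist x y \<le> \<bar>f x - f y\<bar> + \<bar>g x - g y\<bar>"
    and neg: "negligible ((\<lambda>x. (f x, g x)) ` X)"
  shows "covering_dim_le (top_of_set X) 1"
  unfolding covering_dim_le_def
proof (intro allI impI)
  fix \<U> assume U: "finite \<U> \<and> (\<forall>U\<in>\<U>. openin (top_of_set X) U) \<and> \<Union>\<U> = topspace (top_of_set X)"
  show "\<exists>\<V>. finite \<V> \<and> (\<forall>V\<in>\<V>. openin (top_of_set X) V) \<and> \<Union>\<V> = topspace (top_of_set X) \<and>
             (\<forall>V\<in>\<V>. \<exists>U\<in>\<U>. V \<subseteq> U) \<and> (\<forall>x\<in>topspace (top_of_set X). card {V \<in> \<V>. x \<in> V} \<le> 1 + 1)"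
  proof (cases "X = {}")
    case True
    have "\<forall>V\<in>\<U>. \<exists>U\<in>\<U>. V \<subseteq> U" by blast
    moreover have "\<forall>x\<in>topspace (top_of_set X). card {V \<in> \<U>. x \<in> V} \<le> 1 + 1" using True by simp
    ultimately show ?thesis using U by (intro exI[of _ \<U>]) (elim conjE, intro conjI)
  next
    case False
    \<comment> \<open>Ambient open sets cutting out members of the given relative cover, as the
      Lebesgue number lemma is about ambient open covers.\<close>
    define C where "C = {G. open G \<and> X \<inter> G \<in> \<U>}"
    have cov: "X \<subseteq> \<Union>C"
    proof
      fix x assume "x \<in> X"
      then obtain U where "U \<in> \<U>" "x \<in> U" using U by auto
      moreover obtain G where "open G" "U = X \<inter> G" using U \<open>U \<in> \<U>\<close> unfolding openin_open by blast
      ultimately show "x \<in> \<Union>C" unfolding C_def by blast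
    qed
    then have "C \<noteq> {}" using False by auto
    obtain \<delta> where \<delta>: "\<delta> > 0" "\<And>T. T \<subseteq> X \<Longrightarrow> diameter T < \<delta> \<Longrightarrow> \<exists>B\<in>C. T \<subseteq> B"
      using Lebesgue_number_lemma[OF X \<open>C \<noteq> {}\<close> cov] unfolding C_def by blast
    \<comment> \<open>Thickened squares have side below 2 h. Measured by |f x - f y| + |g x - g y|
      their diameter is at most 4 h, which is half of the Lebesgue number.\<close>
    define h where "h = \<delta> / 8"
    have h: "h > 0" using \<delta> by (simp add: h_def)
    obtain a b where ab: "\<And>x y. (x, y) \<in> (\<lambda>x. (f x, g x)) ` X \<Longrightarrow> (x - a) / h \<in> \<int> \<Longrightarrow> (y - b) / h \<notin> \<int>"
      using negligible_avoids_lattice[OF neg h] by blast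
    define F G where "F x = (f x - a) / h" and "G x = (g x - b) / h" for x
    have cF: "continuous_on X F" and cG: "continuous_on X G"
      unfolding F_def G_def using h f g by (auto intro!: continuous_intros)
    have FG: "F x \<notin> \<int> \<or> G x \<notin> \<int>" if "x \<in> X" for x using ab that unfolding F_def G_def by blast
    have "continuous_on X (\<lambda>x. max (infdist (F x) \<int>) (infdist (G x) \<int>))"
      by (intro continuous_on_max continuous_on_infdist cF cG)
    from continuous_attains_inf[OF X False this]
    obtain x0 where x0: "x0 \<in> X" "\<And>x. x \<in> X \<Longrightarrow> max (infdist (F x0) \<int>) (infdist (G x0) \<int>) \<le> max (infdist (F x) \<int>) (infdist (G x) \<int>)"
      by blast
    \<comment> \<open>The compact image misses the grid vertices, so the larger of the two distances
      to grid lines has a positive minimum. Thickening by at most this amount keeps every point far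
      from the lines in one of the directions.\<close>
    define \<eta> where "\<eta> = min (1/4) (max (infdist (F x0) \<int>) (infdist (G x0) \<int>))"
    have "infdist t \<int> > 0" if "t \<notin> \<int>" for t :: real
      using that in_closed_iff_infdist_zero[of "\<int>::real set" t] infdist_nonneg[of t "\<int>"] closed_Ints Ints_0
      by (metis empty_iff order_le_less)
    then have "max (infdist (F x0) \<int>) (infdist (G x0) \<int>) > 0" using FG[OF x0(1)] by (auto simp: less_max_iff_disj)
    then have \<eta>: "0 < \<eta>" "\<eta> < 1/2" by (auto simp: \<eta>_def)
    have far: "infdist (F x) \<int> \<ge> \<eta> \<or> infdist (G x) \<int> \<ge> \<eta>" if "x \<in> X" for x
      using x0(2)[OF that] by (auto simp: \<eta>_def)
    define V where "V = (\<lambda>(m::int, n::int). {x \<in> X. m - \<eta> < F x \<and> F x < m + 1 + \<eta> \<and> n - \<eta> < G x \<and> G x < n + 1 + \<eta>})"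
    have "bounded (F ` X)" "bounded (G ` X)"
      using X cF cG compact_continuous_image compact_imp_bounded by blast+
    then obtain B1 B2 where B: "\<And>x. x \<in> X \<Longrightarrow> \<bar>F x\<bar> \<le> B1" "\<And>x. x \<in> X \<Longrightarrow> \<bar>G x\<bar> \<le> B2"
      unfolding bounded_iff by auto
    define N where "N = \<lceil>max B1 B2\<rceil> + 1"
    define \<V> where "\<V> = V ` ({-N..N} \<times> {-N..N})"
    have opn: "openin (top_of_set X) (V p)" for p
    proof -
      obtain m n where p: "p = (m, n)" by force
      have "V p = (X \<inter> F -` {m - \<eta> <..< m + 1 + \<eta>}) \<inter> (X \<inter> G -` {n - \<eta> <..< n + 1 + \<eta>})"
        by (auto simp: V_def p)
      then show ?thesis using continuous_openin_preimage_gen[OF cF] continuous_openin_preimage_gen[OF cG] by auto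
    qed
    have cover: "\<Union>\<V> = X"
    proof (intro equalityI subsetI)
      fix x assume x: "x \<in> X"
      have "x \<in> V (\<lfloor>F x\<rfloor>, \<lfloor>G x\<rfloor>)"
        using x \<eta> by (auto simp: V_def) linarith+
      moreover have "\<lfloor>F x\<rfloor> \<in> {-N..N}" "\<lfloor>G x\<rfloor> \<in> {-N..N}"
        using B[OF x] unfolding N_def by (auto simp: abs_le_iff) linarith+
      ultimately show "x \<in> \<Union>\<V>" unfolding \<V>_def by blast
    qed (auto simp: \<V>_def V_def)
    have fine: "\<exists>U\<in>\<U>. W \<subseteq> U" if W: "W \<in> \<V>" for W
    proof -
      obtain m n where mn: "W = V (m, n)" using W by (auto simp: \<V>_def)
      have "dist x y \<le> 4 * h" if xy: "x \<in> W" "y \<in> W" for x y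
      proof -
        have "\<bar>F x - F y\<bar> \<le> 2" "\<bar>G x - G y\<bar> \<le> 2" using xy \<eta> by (auto simp: mn V_def)
        moreover have "f x - f y = h * (F x - F y)" "g x - g y = h * (G x - G y)"
          using h by (auto simp: F_def G_def field_simps)
        ultimately have "\<bar>f x - f y\<bar> \<le> 2 * h" "\<bar>g x - g y\<bar> \<le> 2 * h" using h by (auto simp: abs_mult)
        moreover have "x \<in> X" "y \<in> X" using xy by (auto simp: mn V_def)
        ultimately show ?thesis using d by fastforce
      qed
      then have "diameter W \<le> 4 * h" using h by (intro diameter_le) (auto simp: dist_norm)
      then have "diameter W < \<delta>" using \<delta> by (simp add: h_def)
      moreover have "W \<subseteq> X" by (auto simp: mn V_def)
      ultimately obtain B where "B \<in> C" "W \<subseteq> B" using \<delta>(2) by blast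
      then show ?thesis using \<open>W \<subseteq> X\<close> unfolding C_def by blast
    qed
    have order2: "card {W \<in> \<V>. x \<in> W} \<le> 2" if x: "x \<in> X" for x
    proof -
      obtain m1 m2 :: int where m: "\<And>m::int. m - \<eta> < F x \<Longrightarrow> F x < m + 1 + \<eta> \<Longrightarrow> m = m1 \<or> m = m2" "infdist (F x) \<int> \<ge> \<eta> \<Longrightarrow> m1 = m2"
        using overlapping_unit_intervals[OF \<eta>, of "F x"] by blast
      obtain n1 n2 :: int where n: "\<And>m::int. m - \<eta> < G x \<Longrightarrow> G x < m + 1 + \<eta> \<Longrightarrow> m = n1 \<or> m = n2" "infdist (G x) \<int> \<ge> \<eta> \<Longrightarrow> n1 = n2"
        using overlapping_unit_intervals[OF \<eta>, of "G x"] by blast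
      \<comment> \<open>In the direction where x is far from the lines the two candidate indices
        coincide, so of the four combinations only two different squares remain.\<close>
      have "{W \<in> \<V>. x \<in> W} \<subseteq> {V (m1, n1), V (m2, n2)}"
      proof
        fix W assume "W \<in> {W \<in> \<V>. x \<in> W}"
        then obtain i j where W: "W = V (i, j)" "x \<in> V (i, j)" by (auto simp: \<V>_def)
        then have "i = m1 \<or> i = m2" "j = n1 \<or> j = n2" using m(1) n(1) by (auto simp: V_def)
        then show "W \<in> {V (m1, n1), V (m2, n2)}" using far[OF x] m(2) n(2) W(1) by auto
      qed
      then have "card {W \<in> \<V>. x \<in> W} \<le> card {V (m1, n1), V (m2, n2)}" by (intro card_mono) auto
      also have "\<dots> \<le> 2" by (simp add: card_insert_if)
      finally show ?thesis .
    qed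
    show ?thesis
    proof (intro exI[of _ \<V>] conjI)
      show "finite \<V>" by (simp add: \<V>_def)
      show "\<forall>V\<in>\<V>. openin (top_of_set X) V" using opn by (auto simp: \<V>_def)
      show "\<Union>\<V> = topspace (top_of_set X)" using cover by simp
      show "\<forall>V\<in>\<V>. \<exists>U\<in>\<U>. V \<subseteq> U" using fine by blast
      show "\<forall>x\<in>topspace (top_of_set X). card {V \<in> \<V>. x \<in> V} \<le> 1 + 1"
        unfolding one_add_one using order2 by simp
    qed
  qed
qed

text \<open>Refine the cover by the complements of x and of y. A refinement of order one consists of
  pairwise disjoint open sets, so connectedness leaves a single member, which would have to omit x
  or y.\<close>

lemma not_covering_dim_le_0:
  fixes X :: "'a::t1_space set"
  assumes con: "connected X" and xy: "x \<in> X" "y \<in> X" "x \<noteq> y"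
  shows "\<not> covering_dim_le (top_of_set X) 0"
proof
  assume c: "covering_dim_le (top_of_set X) 0"
  have o: "openin (top_of_set X) (X - {z})" for z
    by (metis Diff_eq closed_singleton open_Compl openin_open)
  have "finite {X - {x}, X - {y}} \<and> (\<forall>U\<in>{X - {x}, X - {y}}. openin (top_of_set X) U) \<and> \<Union>{X - {x}, X - {y}} = topspace (top_of_set X)"
    using o xy by auto
  from c[unfolded covering_dim_le_def, rule_format, OF this]
  obtain \<V> where V: "finite \<V>" "\<forall>V\<in>\<V>. openin (top_of_set X) V" "\<Union>\<V> = X"
    "\<forall>V\<in>\<V>. \<exists>U\<in>{X - {x}, X - {y}}. V \<subseteq> U" "\<forall>z\<in>X. card {V \<in> \<V>. z \<in> V} \<le> 1"
    unfolding add_0 topspace_euclidean_subtopology by blast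
  obtain V where v: "V \<in> \<V>" "x \<in> V" using V(3) xy by blast
  define W where "W = \<Union>(\<V> - {V})"
  have "openin (top_of_set X) W" unfolding W_def using V(2) by (intro openin_Union) auto
  moreover have "V \<inter> W = {}"
  proof (rule ccontr)
    assume "V \<inter> W \<noteq> {}"
    then obtain z V' where z: "z \<in> V" "z \<in> V'" "V' \<in> \<V>" "V' \<noteq> V" by (auto simp: W_def)
    then have "z \<in> X" using V(3) by blast
    have "card {V, V'} \<le> card {V \<in> \<V>. z \<in> V}" using z v V(1) by (intro card_mono) auto
    then show False using V(5) \<open>z \<in> X\<close> z by force
  qed
  moreover have "X \<subseteq> V \<union> W" using V(3) by (auto simp: W_def)
  ultimately have "W = {}" using con V(2) v unfolding connected_openin by blast
  then have "X = V" using V(3) v by (auto simp: W_def)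
  then show False using V(4) v xy by auto
qed

section \<open>Crossing shadows\<close>

text \<open>A path crossing the rectangle from left to right meets one crossing it from bottom to
  top. The paths may overshoot the sides, hence they are clamped in their direction of travel before
  the planar crossing theorem is applied.\<close>

lemma crossing_path_connected:
  fixes S T :: "(real^3) set"
  assumes S: "path_connected S" and T: "path_connected T"
    and x: "x0 \<in> S" "x1 \<in> S" "x0 \<bullet> a \<le> \<alpha>0" "x1 \<bullet> a \<ge> \<alpha>1"
    and y: "y0 \<in> T" "y1 \<in> T" "y0 \<bullet> b \<le> \<beta>0" "y1 \<bullet> b \<ge> \<beta>1"
    and Sb: "\<And>x. x \<in> S \<Longrightarrow> \<beta>0 < x \<bullet> b \<and> x \<bullet> b < \<beta>1"
    and Ta: "\<And>y. y \<in> T \<Longrightarrow> \<alpha>0 < y \<bullet> a \<and> y \<bullet> a < \<alpha>1"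
  obtains p p' where "p \<in> S" "p' \<in> T" "p \<bullet> a = p' \<bullet> a" "p \<bullet> b = p' \<bullet> b"
proof -
  obtain f where f: "path f" "path_image f \<subseteq> S" "pathstart f = x0" "pathfinish f = x1"
    using S x unfolding path_connected_def by metis
  obtain g where g: "path g" "path_image g \<subseteq> T" "pathstart g = y0" "pathfinish g = y1"
    using T y unfolding path_connected_def by metis
  have ab: "\<alpha>0 < \<alpha>1" "\<beta>0 < \<beta>1" using Sb[OF x(1)] Ta[OF y(1)] by auto
  define F :: "real \<Rightarrow> real^2" where "F t = vector [max \<alpha>0 (min \<alpha>1 (f t \<bullet> a)), f t \<bullet> b]" for t
  define G :: "real \<Rightarrow> real^2" where "G t = vector [g t \<bullet> a, max \<beta>0 (min \<beta>1 (g t \<bullet> b))]" for t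
  define l u :: "real^2" where "l = vector [\<alpha>0, \<beta>0]" and "u = vector [\<alpha>1, \<beta>1]"
  have v2: "continuous_on A (\<lambda>t. vector [p t, q t] :: real^2)" if "continuous_on A p" "continuous_on A q" for A :: "real set" and p q :: "real \<Rightarrow> real"
  proof -
    have "continuous_on A (\<lambda>t. (vector [p t, q t] :: real^2) $ i)" for i
      using exhaust_2[of i] that by (auto simp: vector_2)
    then have "continuous_on A (\<lambda>t. \<chi> i. (vector [p t, q t] :: real^2) $ i)" by (intro continuous_on_vec_lambda)
    then show ?thesis by simp
  qed
  have "path F" using f(1) unfolding path_def F_def by (intro v2 continuous_intros)
  moreover have "path G" using g(1) unfolding path_def G_def by (intro v2 continuous_intros)
  moreover have fS: "f t \<in> S" "g t \<in> T" if "t \<in> {0..1}" for t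
    using f(2) g(2) that by (auto simp: path_image_def)
  moreover have "path_image F \<subseteq> cbox l u"
  proof -
    have "F t \<in> cbox l u" if "t \<in> {0..1}" for t
      using Sb[OF fS(1)[OF that]] ab unfolding mem_box_cart l_def u_def F_def forall_2 vector_2 by auto
    then show ?thesis by (auto simp: path_image_def)
  qed
  moreover have "path_image G \<subseteq> cbox l u"
  proof -
    have "G t \<in> cbox l u" if "t \<in> {0..1}" for t
      using Ta[OF fS(2)[OF that]] ab unfolding mem_box_cart l_def u_def G_def forall_2 vector_2 by auto
    then show ?thesis by (auto simp: path_image_def)
  qed
  moreover have "pathstart F $ 1 = l $ 1" "pathfinish F $ 1 = u $ 1" "pathstart G $ 2 = l $ 2" "pathfinish G $ 2 = u $ 2"
    using f(3,4) g(3,4) x y ab by (auto simp: pathstart_def pathfinish_def F_def G_def l_def u_def vector_2)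
  ultimately obtain z where z: "z \<in> path_image F" "z \<in> path_image G" using fashoda[of F G l u] by blast
  then obtain s t where st: "s \<in> {0..1}" "t \<in> {0..1}" "F s = G t" by (auto simp: path_image_def)
  then have "max \<alpha>0 (min \<alpha>1 (f s \<bullet> a)) = g t \<bullet> a" "f s \<bullet> b = max \<beta>0 (min \<beta>1 (g t \<bullet> b))"
    by (auto simp: F_def G_def vec_eq_iff forall_2 vector_2)
  \<comment> \<open>Clamping does not create false meetings: at the meeting point the coordinate of
    the other path lies strictly inside the rectangle, so neither clamp was active.\<close>
  then have "f s \<bullet> a = g t \<bullet> a" "f s \<bullet> b = g t \<bullet> b"
    using Sb[OF fS(1)[OF st(1)]] Ta[OF fS(2)[OF st(2)]] by (auto simp: max_def min_def split: if_splits)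
  then show thesis using that fS st by blast
qed

text \<open>Projection along the unit vector d onto the plane through the origin, kept inside the
  ambient space. Shadows in all directions are thus handled without choosing bases of image planes;
  the projection onto a parallel plane differs by a translation.\<close>

definition flatten :: "real^3 \<Rightarrow> real^3 \<Rightarrow> real^3" where
  "flatten d x = x - (x \<bullet> d) *\<^sub>R d"

lemma linear_flatten: "linear (flatten d)"
  by (rule linearI) (simp_all add: flatten_def inner_add_left algebra_simps)

lemma flatten_inner: "a \<bullet> d = 0 \<Longrightarrow> flatten d x \<bullet> a = x \<bullet> a"
  by (simp add: flatten_def inner_diff_left inner_commute[of d])

lemma flatten_uminus: "flatten (- d) = flatten d"
  by (simp add: flatten_def fun_eq_iff)

lemma flatten_eqI:
  assumes d: "norm d = 1" and ab: "a \<bullet> d = 0" "b \<bullet> d = 0" and ind: "\<And>w. w \<bullet> a = 0 \<Longrightarrow> w \<bullet> b = 0 \<Longrightarrow> w \<bullet> d = 0 \<Longrightarrow> w = 0"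
    and e: "flatten d x \<bullet> a = flatten d y \<bullet> a" "flatten d x \<bullet> b = flatten d y \<bullet> b"
  shows "flatten d x = flatten d y"
proof -
  have "d \<bullet> d = 1" using d by (simp add: norm_eq_1)
  then have "(flatten d x - flatten d y) \<bullet> d = 0" by (simp add: flatten_def inner_diff_left)
  then have "flatten d x - flatten d y = 0" using ind[of "flatten d x - flatten d y"] e by (simp add: inner_diff_left)
  then show ?thesis by simp
qed

text \<open>The vectors a and b serve as linear, possibly oblique, coordinates on the image plane:
  with d they separate points, so agreement in both is agreement of shadows. The rectangle is
  measured from c in units of s.\<close>

lemma crossing_flatten:
  fixes X Y :: "(real^3) set"
  assumes X: "path_connected (flatten d ` X)" and Y: "path_connected (flatten d ` Y)" and d: "norm d = 1"
    and s: "s > 0"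
    and ab: "a \<bullet> d = 0" "b \<bullet> d = 0" and ind: "\<And>w. w \<bullet> a = 0 \<Longrightarrow> w \<bullet> b = 0 \<Longrightarrow> w \<bullet> d = 0 \<Longrightarrow> w = 0"
    and x: "x0 \<in> X" "x1 \<in> X" "(x0 - c) \<bullet> a \<le> s * \<alpha>0" "(x1 - c) \<bullet> a \<ge> s * \<alpha>1"
    and y: "y0 \<in> Y" "y1 \<in> Y" "(y0 - c) \<bullet> b \<le> s * \<beta>0" "(y1 - c) \<bullet> b \<ge> s * \<beta>1"
    and Xb: "\<And>x. x \<in> X \<Longrightarrow> s * \<beta>0 < (x - c) \<bullet> b \<and> (x - c) \<bullet> b < s * \<beta>1"
    and Ya: "\<And>y. y \<in> Y \<Longrightarrow> s * \<alpha>0 < (y - c) \<bullet> a \<and> (y - c) \<bullet> a < s * \<alpha>1"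
  shows "flatten d ` X \<inter> flatten d ` Y \<noteq> {}"
proof -
  have fb: "flatten d p \<bullet> a = (p - c) \<bullet> a + c \<bullet> a" "flatten d p \<bullet> b = (p - c) \<bullet> b + c \<bullet> b" for p
    using ab by (simp_all add: flatten_inner inner_diff_left)
  have x': "flatten d x0 \<bullet> a \<le> s * \<alpha>0 + c \<bullet> a" "flatten d x1 \<bullet> a \<ge> s * \<alpha>1 + c \<bullet> a"
    and y': "flatten d y0 \<bullet> b \<le> s * \<beta>0 + c \<bullet> b" "flatten d y1 \<bullet> b \<ge> s * \<beta>1 + c \<bullet> b"
    using x y by (auto simp: fb)
  have Xb': "s * \<beta>0 + c \<bullet> b < p \<bullet> b \<and> p \<bullet> b < s * \<beta>1 + c \<bullet> b" if "p \<in> flatten d ` X" for p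
    using that Xb by (auto simp: fb)
  have Ya': "s * \<alpha>0 + c \<bullet> a < p \<bullet> a \<and> p \<bullet> a < s * \<alpha>1 + c \<bullet> a" if "p \<in> flatten d ` Y" for p
    using that Ya by (auto simp: fb)
  obtain p p' where p: "p \<in> flatten d ` X" "p' \<in> flatten d ` Y" "p \<bullet> a = p' \<bullet> a" "p \<bullet> b = p' \<bullet> b"
    using crossing_path_connected[OF X Y imageI[OF x(1)] imageI[OF x(2)] x' imageI[OF y(1)] imageI[OF y(2)] y' Xb' Ya'] .
  then obtain q q' where q: "q \<in> X" "q' \<in> Y" "p = flatten d q" "p' = flatten d q'" by blast
  have "flatten d q = flatten d q'" using flatten_eqI[OF d ab ind, of q q'] p(3,4) unfolding q by blast
  then show ?thesis using q by blast
qed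

lemma path_connected_flatten_chain:
  fixes X :: "int \<Rightarrow> (real^3) set"
  assumes pc: "\<And>l. path_connected (flatten d ` X l)" and ov: "\<And>l. flatten d ` X l \<inter> flatten d ` X (l + 1) \<noteq> {}"
  shows "path_connected (flatten d ` (\<Union>l\<in>{i..i + int n}. X l))"
proof (induction n)
  case (Suc n)
  have e: "{i..i + int (Suc n)} = insert (i + int n + 1) {i..i + int n}" by auto
  have "flatten d ` (\<Union>l\<in>{i..i + int n}. X l) \<inter> flatten d ` X (i + int n + 1) \<noteq> {}"
    using ov[of "i + int n"] by fastforce
  from path_connected_Un[OF Suc pc this] show ?case
    unfolding e by (simp add: image_Un image_UN Un_commute)
qed (simp add: pc)

text \<open>The coordinate vectors used for crossings are not normalised but have length at most 2;
  a position error of 1/300 becomes the coordinate error 1/150 seen throughout the estimates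
  below.\<close>

lemma inner_approx:
  fixes p c a :: "'a::real_inner"
  assumes "norm (p - c - s *\<^sub>R w) \<le> \<epsilon> * s" "norm a \<le> 2"
  shows "s * (w \<bullet> a - 2 * \<epsilon>) \<le> (p - c) \<bullet> a \<and> (p - c) \<bullet> a \<le> s * (w \<bullet> a + 2 * \<epsilon>)"
proof -
  have e: "(p - c - s *\<^sub>R w) \<bullet> a = (p - c) \<bullet> a - s * (w \<bullet> a)" by (simp add: inner_diff_left)
  have "\<bar>(p - c - s *\<^sub>R w) \<bullet> a\<bar> \<le> norm (p - c - s *\<^sub>R w) * norm a" by (rule Cauchy_Schwarz_ineq2)
  also have "\<dots> \<le> (\<epsilon> * s) * 2" by (intro mult_mono) (use assms order_trans[OF norm_ge_zero assms(1)] in auto)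
  finally show ?thesis unfolding e by (simp add: abs_le_iff algebra_simps)
qed

text \<open>Divisibility by 8 places the angles pi/4 and pi/2 at the vertices with indices m and 2
  m, so that the arcs used for crossings end exactly there.\<close>

lemma cos_sin_quarter:
  fixes q m :: nat assumes q: "q = 8 * m" "m > 0"
  shows "\<bar>l\<bar> \<le> int m \<Longrightarrow> cos (2 * pi * l / q) \<ge> sqrt 2 / 2"
    and "cos (2 * pi * int m / q) = sqrt 2 / 2" "sin (2 * pi * int m / q) = sqrt 2 / 2"
    and "0 \<le> l \<Longrightarrow> l \<le> 2 * int m \<Longrightarrow> cos (2 * pi * l / q) \<ge> 0"
    and "0 \<le> l \<Longrightarrow> l \<le> 2 * int m \<Longrightarrow> sin (2 * pi * l / q) \<ge> 0"
    and "cos (2 * pi * (2 * int m) / q) = 0" "sin (2 * pi * (2 * int m) / q) = 1"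
proof -
  have m4: "2 * pi * int m / q = pi / 4" "2 * pi * (2 * int m) / q = pi / 2" using q by (simp_all add: field_simps)
  show "cos (2 * pi * int m / q) = sqrt 2 / 2" "sin (2 * pi * int m / q) = sqrt 2 / 2"
    unfolding m4 by (simp_all add: cos_45 sin_45)
  show "cos (2 * pi * (2 * int m) / q) = 0" "sin (2 * pi * (2 * int m) / q) = 1"
    unfolding m4 by simp_all
  have r: "2 * pi * l / q \<le> pi / 2" "2 * pi * l / q \<ge> 0" if "0 \<le> l" "l \<le> 2 * int m" for l
  proof -
    have "real_of_int l \<le> 2 * m" using that by linarith
    then have "2 * pi * l \<le> 2 * pi * (2 * m)" by (intro mult_left_mono) auto
    then show "2 * pi * l / q \<le> pi / 2" using q by (simp add: field_simps)
    show "2 * pi * l / q \<ge> 0" using that by simp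
  qed
  show "0 \<le> l \<Longrightarrow> l \<le> 2 * int m \<Longrightarrow> cos (2 * pi * l / q) \<ge> 0" using r[of l] pi_ge_zero by (intro cos_ge_zero) linarith+
  show "0 \<le> l \<Longrightarrow> l \<le> 2 * int m \<Longrightarrow> sin (2 * pi * l / q) \<ge> 0" using r[of l] pi_ge_zero by (intro sin_ge_zero) linarith+
  assume l: "\<bar>l\<bar> \<le> int m"
  have "real_of_int \<bar>l\<bar> \<le> m" using l by linarith
  then have "2 * pi * \<bar>real_of_int l\<bar> \<le> 2 * pi * m" by (intro mult_left_mono) auto
  then have "2 * pi * \<bar>real_of_int l\<bar> / q \<le> pi / 4" using q by (simp add: field_simps)
  then have "cos (pi / 4) \<le> cos (2 * pi * \<bar>real_of_int l\<bar> / q)" by (intro cos_monotone_0_pi_le) auto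
  also have "cos (2 * pi * \<bar>real_of_int l\<bar> / q) = cos (2 * pi * l / q)" by (cases "l \<ge> 0") auto
  finally show "cos (2 * pi * l / q) \<ge> sqrt 2 / 2" by (simp add: cos_45)
qed

definition circle_point :: "real^3 \<Rightarrow> real^3 \<Rightarrow> real \<Rightarrow> real^3" where
  "circle_point e y t = cos t *\<^sub>R e + sin t *\<^sub>R y"

text \<open>The shadows of two chains of small sets along perpendicular unit circles, the second centred on the axis of
  the first at distance \<open>3/2\<close>, cross in every direction \<open>d\<close>: two quarter or half arcs and two linear
  coordinates \<open>a\<close>, \<open>b\<close> on the image plane are chosen such that the arcs traverse a rectangle in
  perpendicular directions.\<close>

lemma crossing_chains_octant:
  fixes X Y :: "int \<Rightarrow> (real^3) set" and e y z :: "real^3" and q m :: nat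
  assumes q: "q = 8 * m" "m > 0"
    and on: "norm e = 1" "norm y = 1" "norm z = 1" "e \<bullet> y = 0" "e \<bullet> z = 0" "y \<bullet> z = 0"
    and d: "d = d1 *\<^sub>R e + d2 *\<^sub>R y + d3 *\<^sub>R z" "norm d = 1" "0 \<le> d1" "0 \<le> d3" "d3 \<le> d2"
    and s: "s > 0"
    and X: "\<And>l p. p \<in> X l \<Longrightarrow> norm (p - c - s *\<^sub>R circle_point e y (2 * pi * l / q)) \<le> (1/300) * s"
    and Y: "\<And>l p. p \<in> Y l \<Longrightarrow> norm (p - c - s *\<^sub>R ((3/2) *\<^sub>R e + circle_point (- e) z (2 * pi * l / q))) \<le> (1/300) * s"
    and ne: "\<And>l. X l \<noteq> {}" "\<And>l. Y l \<noteq> {}"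
    and pcX: "\<And>l. path_connected (flatten d ` X l)" and ovX: "\<And>l. flatten d ` X l \<inter> flatten d ` X (l + 1) \<noteq> {}"
    and pcY: "\<And>l. path_connected (flatten d ` Y l)" and ovY: "\<And>l. flatten d ` Y l \<inter> flatten d ` Y (l + 1) \<noteq> {}"
  shows "\<exists>l l'. flatten d ` X l \<inter> flatten d ` Y l' \<noteq> {}"
proof -
  have on': "e \<bullet> e = 1" "y \<bullet> y = 1" "z \<bullet> z = 1" "y \<bullet> e = 0" "z \<bullet> e = 0" "z \<bullet> y = 0"
    using on by (simp_all add: norm_eq_1 inner_commute)
  note inn = on on' inner_add_left inner_add_right inner_diff_left inner_diff_right inner_minus_left inner_minus_right inner_scaleR_left inner_scaleR_right
  have dd: "d1\<^sup>2 + d2\<^sup>2 + d3\<^sup>2 = 1"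
  proof -
    have "d \<bullet> d = 1" using d(2) by (simp add: norm_eq_1)
    then show ?thesis unfolding d(1) by (simp add: inn power2_eq_square)
  qed
  have sqs: "d1\<^sup>2 \<ge> 0" "d2\<^sup>2 \<ge> 0" "d3\<^sup>2 \<ge> 0" by simp_all
  have len: "norm (k1 *\<^sub>R e + k2 *\<^sub>R y + k3 *\<^sub>R z) \<le> 2" if "k1\<^sup>2 + k2\<^sup>2 + k3\<^sup>2 \<le> 4" for k1 k2 k3
  proof -
    have "norm (k1 *\<^sub>R e + k2 *\<^sub>R y + k3 *\<^sub>R z) ^ 2 \<le> 2 ^ 2"
      unfolding power2_norm_eq_inner using that by (simp add: inn power2_eq_square)
    then show ?thesis by (rule power2_le_imp_le) simp
  qed
  have zero: "w = 0" if "w \<bullet> e = 0" "w \<bullet> y = 0" "w \<bullet> z = 0" for w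
  proof -
    have "z = (z \<bullet> cross3 e y) *\<^sub>R cross3 e y" using orthonormal_expansion(1)[OF on(1,2,4), of z] on' by simp
    moreover have "z \<noteq> 0" using on(3) by auto
    ultimately have "z \<bullet> cross3 e y \<noteq> 0" "w \<bullet> z = (z \<bullet> cross3 e y) * (w \<bullet> cross3 e y)"
      by (force, metis inner_scaleR_right)
    then have "w \<bullet> cross3 e y = 0" using that(3) by simp
    then show ?thesis using orthonormal_expansion(1)[OF on(1,2,4), of w] that by simp
  qed
  define c4 where "c4 = sqrt 2 / 2"
  have "sqrt 2 \<ge> 14/10" by (rule real_le_rsqrt) (simp add: power2_eq_square)
  moreover have "sqrt 2 \<le> 14144/10000" by (rule real_le_lsqrt) (simp_all add: power2_eq_square)
  ultimately have c4: "c4 \<ge> 7/10" "c4 \<le> 7072/10000" by (simp_all add: c4_def)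
  have c4m: "7/10 * t \<le> t * c4" "t * c4 \<le> 7072/10000 * t" if "t \<ge> 0" for t
    using mult_left_mono[OF c4(1) that] mult_left_mono[OF c4(2) that] by (simp_all add: mult.commute)
  define C S where "C l = cos (2 * pi * real_of_int l / q)" and "S l = sin (2 * pi * real_of_int l / q)" for l
  have CS: "(C l)\<^sup>2 + (S l)\<^sup>2 = 1" "C l \<le> 1" "S l \<le> 1" "C l \<ge> -1" "S l \<ge> -1" "C (- l) = C l" "S (- l) = - S l" for l
    by (auto simp: C_def S_def)
  have Cm: "C (int m) = c4" "S (int m) = c4" "C (2 * int m) = 0" "S (2 * int m) = 1" "C 0 = 1" "S 0 = 0"
    using cos_sin_quarter[OF q] by (auto simp: C_def S_def c4_def)
  have Cq: "\<bar>l\<bar> \<le> int m \<Longrightarrow> C l \<ge> c4" "0 \<le> l \<Longrightarrow> l \<le> 2 * int m \<Longrightarrow> C l \<ge> 0" "0 \<le> l \<Longrightarrow> l \<le> 2 * int m \<Longrightarrow> S l \<ge> 0" for l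
    using cos_sin_quarter[OF q] by (auto simp: C_def S_def c4_def)
  have XA: "s * ((C l * (e \<bullet> a) + S l * (y \<bullet> a)) - 1/150) \<le> (p - c) \<bullet> a \<and> (p - c) \<bullet> a \<le> s * ((C l * (e \<bullet> a) + S l * (y \<bullet> a)) + 1/150)"
    if "p \<in> X l" "norm a \<le> 2" for p l a
    using inner_approx[OF X[OF that(1)] that(2)] by (simp add: circle_point_def C_def S_def inner_add_left)
  have YA: "s * (((3/2 - C l) * (e \<bullet> a) + S l * (z \<bullet> a)) - 1/150) \<le> (p - c) \<bullet> a \<and> (p - c) \<bullet> a \<le> s * (((3/2 - C l) * (e \<bullet> a) + S l * (z \<bullet> a)) + 1/150)"
    if "p \<in> Y l" "norm a \<le> 2" for p l a
    using inner_approx[OF Y[OF that(1)] that(2)] by (simp add: circle_point_def C_def S_def inner_add_left algebra_simps)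
  \<comment> \<open>The rectangle argument for arcs \<open>i \<le> l \<le> i + j\<close> and \<open>i' \<le> l \<le> i' + j'\<close> and coordinates \<open>a\<close>, \<open>b\<close>.\<close>
  have main: "\<exists>l l'. flatten d ` X l \<inter> flatten d ` Y l' \<noteq> {}"
    if ab: "a \<bullet> d = 0" "b \<bullet> d = 0" "norm a \<le> 2" "norm b \<le> 2"
      and ind: "\<And>w. w \<bullet> a = 0 \<Longrightarrow> w \<bullet> b = 0 \<Longrightarrow> w \<bullet> d = 0 \<Longrightarrow> w = 0"
      and la: "la \<in> {i..i + int j}" "C la * (e \<bullet> a) + S la * (y \<bullet> a) \<le> \<alpha> - 1/150"
      and lb: "lb \<in> {i..i + int j}" "C lb * (e \<bullet> a) + S lb * (y \<bullet> a) \<ge> \<alpha>' + 1/150"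
      and ka: "ka \<in> {i'..i' + int j'}" "(3/2 - C ka) * (e \<bullet> b) + S ka * (z \<bullet> b) \<le> \<beta> - 1/150"
      and kb: "kb \<in> {i'..i' + int j'}" "(3/2 - C kb) * (e \<bullet> b) + S kb * (z \<bullet> b) \<ge> \<beta>' + 1/150"
      and Xb: "\<And>l. l \<in> {i..i + int j} \<Longrightarrow> \<beta> + 1/150 < C l * (e \<bullet> b) + S l * (y \<bullet> b) \<and> C l * (e \<bullet> b) + S l * (y \<bullet> b) < \<beta>' - 1/150"
      and Ya: "\<And>l. l \<in> {i'..i' + int j'} \<Longrightarrow> \<alpha> + 1/150 < (3/2 - C l) * (e \<bullet> a) + S l * (z \<bullet> a) \<and> (3/2 - C l) * (e \<bullet> a) + S l * (z \<bullet> a) < \<alpha>' - 1/150"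
    for a b la lb ka kb i i' j j' \<alpha> \<alpha>' \<beta> \<beta>'
  proof -
    let ?X = "\<Union>l\<in>{i..i + int j}. X l" and ?Y = "\<Union>l\<in>{i'..i' + int j'}. Y l"
    obtain x0 x1 y0 y1 where p: "x0 \<in> X la" "x1 \<in> X lb" "y0 \<in> Y ka" "y1 \<in> Y kb" using ne by (metis ex_in_conv)
    have up: "t \<le> s * r \<Longrightarrow> r \<le> r' \<Longrightarrow> t \<le> s * r'" and up': "t \<le> s * r \<Longrightarrow> r < r' \<Longrightarrow> t < s * r'"
      and lo: "s * r \<le> t \<Longrightarrow> r' \<le> r \<Longrightarrow> s * r' \<le> t" and lo': "s * r \<le> t \<Longrightarrow> r' < r \<Longrightarrow> s * r' < t" for t r r'
      using s by (smt (verit) mult_left_mono mult_strict_left_mono)+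
    have pX: "path_connected (flatten d ` ?X)" by (rule path_connected_flatten_chain) (rule pcX ovX)+
    have pY: "path_connected (flatten d ` ?Y)" by (rule path_connected_flatten_chain) (rule pcY ovY)+
    have "flatten d ` ?X \<inter> flatten d ` ?Y \<noteq> {}"
    proof (rule crossing_flatten[OF pX pY d(2) s ab(1,2) ind])
      show "x0 \<in> ?X" "x1 \<in> ?X" "y0 \<in> ?Y" "y1 \<in> ?Y" using p la lb ka kb by blast+
      show "(x0 - c) \<bullet> a \<le> s * \<alpha>" using XA[OF p(1) ab(3)] la(2) by (intro up[OF conjunct2]) auto
      show "s * \<alpha>' \<le> (x1 - c) \<bullet> a" using XA[OF p(2) ab(3)] lb(2) by (intro lo[OF conjunct1]) auto
      show "(y0 - c) \<bullet> b \<le> s * \<beta>" using YA[OF p(3) ab(4)] ka(2) by (intro up[OF conjunct2]) auto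
      show "s * \<beta>' \<le> (y1 - c) \<bullet> b" using YA[OF p(4) ab(4)] kb(2) by (intro lo[OF conjunct1]) auto
      show "s * \<beta> < (x - c) \<bullet> b \<and> (x - c) \<bullet> b < s * \<beta>'" if x: "x \<in> ?X" for x
      proof -
        obtain l where l: "l \<in> {i..i + int j}" "x \<in> X l" using x by blast
        show ?thesis using XA[OF l(2) ab(4)] Xb[OF l(1)] by (intro conjI lo'[OF conjunct1] up'[OF conjunct2]) auto
      qed
      show "s * \<alpha> < (x - c) \<bullet> a \<and> (x - c) \<bullet> a < s * \<alpha>'" if x: "x \<in> ?Y" for x
      proof -
        obtain l where l: "l \<in> {i'..i' + int j'}" "x \<in> Y l" using x by blast
        show ?thesis using YA[OF l(2) ab(3)] Ya[OF l(1)] by (intro conjI lo'[OF conjunct1] up'[OF conjunct2]) auto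
      qed
    qed
    then show ?thesis by blast
  qed
  have dw: "w \<bullet> d = d1 * (w \<bullet> e) + d2 * (w \<bullet> y) + d3 * (w \<bullet> z)" for w by (simp add: d(1) inner_add_right)
  show ?thesis
  \<comment> \<open>Here e points from one centre to the other. If d has a substantial component
    along e, the facing arcs cross in the shadow. Otherwise d2 is forced to be at least 2/3 and
    serves as the unit for the rectangle.\<close>
  proof (cases "d1 \<ge> 2/5 * d2")
    case True
    have d1: "d1 \<ge> 1/4"
    proof (rule ccontr)
      assume "\<not> d1 \<ge> 1/4"
      then have "d1 \<le> 1/4" "d2 \<le> 5/8" "d3 \<le> 5/8" using True d by linarith+
      then have "d1\<^sup>2 \<le> (1/4)\<^sup>2" "d2\<^sup>2 \<le> (5/8)\<^sup>2" "d3\<^sup>2 \<le> (5/8)\<^sup>2" using d by (intro power_mono; linarith)+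
      then show False using dd by (simp add: power2_eq_square)
    qed
    \<comment> \<open>The arcs are the quarter circles facing each other, with angles between -pi/4
      and pi/4. On the first circle only a contains the sine, on the second only b, so the arcs
      travel in different coordinates. The bound d1 \<ge> 1/4 leaves room for the errors
      1/150.\<close>
    define a b where "a = (- d2) *\<^sub>R e + d1 *\<^sub>R y + 0 *\<^sub>R z" and "b = (- d3) *\<^sub>R e + 0 *\<^sub>R y + d1 *\<^sub>R z"
    have co: "e \<bullet> a = - d2" "y \<bullet> a = d1" "z \<bullet> a = 0" "e \<bullet> b = - d3" "y \<bullet> b = 0" "z \<bullet> b = d1"
      by (simp_all add: a_def b_def inn)
    have pr: "d1 * c4 \<ge> 7/10 * d1" "d2 * c4 \<ge> 7/10 * d2" "d2 * c4 \<le> 7072/10000 * d2" "d3 * c4 \<ge> 7/10 * d3" "d3 * c4 \<le> 7072/10000 * d3"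
      using c4m[of d1] c4m[of d2] c4m[of d3] d by auto
    have bd: "d2 * C l \<ge> d2 * c4" "d2 * C l \<le> d2" "d3 * C l \<ge> d3 * c4" "d3 * C l \<le> d3" if "l \<in> {- int m..- int m + int (2 * m)}" for l
    proof -
      have C: "C l \<ge> c4" "C l \<le> 1" using Cq(1)[of l] CS(2)[of l] that by auto
      have "d2 \<ge> 0" using d by simp
      then show "d2 * C l \<ge> d2 * c4" "d2 * C l \<le> d2" "d3 * C l \<ge> d3 * c4" "d3 * C l \<le> d3"
        using C d by (simp_all add: mult_left_mono mult_left_le)
    qed
    show ?thesis
    proof (rule main[where a = a and b = b and la = "- int m" and lb = "int m" and i = "- int m" and j = "2 * m"
         and ka = "- int m" and kb = "int m" and i' = "- int m" and j' = "2 * m"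
         and \<alpha> = "- (d2 * c4) - d1 * c4 + 1/150" and \<alpha>' = "- (d2 * c4) + d1 * c4 - 1/150"
         and \<beta> = "- (3/2 * d3) + d3 * c4 - d1 * c4 + 1/150" and \<beta>' = "- (3/2 * d3) + d3 * c4 + d1 * c4 - 1/150"])
      show "a \<bullet> d = 0" "b \<bullet> d = 0" by (simp_all add: dw a_def b_def inn)
      show "norm a \<le> 2" unfolding a_def by (rule len) (unfold power2_minus zero_power2, insert dd sqs, linarith)
      show "norm b \<le> 2" unfolding b_def by (rule len) (unfold power2_minus zero_power2, insert dd sqs, linarith)
      fix w assume w: "w \<bullet> a = 0" "w \<bullet> b = 0" "w \<bullet> d = 0"
      have e: "d1 * (w \<bullet> y) = d2 * (w \<bullet> e)" "d1 * (w \<bullet> z) = d3 * (w \<bullet> e)" using w by (simp_all add: a_def b_def inner_add_right inner_diff_right)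
      have "0 = d1 * (w \<bullet> d)" using w by simp
      also have "\<dots> = d1\<^sup>2 * (w \<bullet> e) + d2 * (d1 * (w \<bullet> y)) + d3 * (d1 * (w \<bullet> z))" by (simp add: dw algebra_simps power2_eq_square)
      also have "\<dots> = (d1\<^sup>2 + d2\<^sup>2 + d3\<^sup>2) * (w \<bullet> e)" unfolding e by (simp add: algebra_simps power2_eq_square)
      finally have "w \<bullet> e = 0" using dd by simp
      then show "w = 0" using e d1 by (intro zero) auto
    next
      show "- int m \<in> {- int m..- int m + int (2 * m)}" "- int m \<in> {- int m..- int m + int (2 * m)}"
        "int m \<in> {- int m..- int m + int (2 * m)}" "int m \<in> {- int m..- int m + int (2 * m)}" by auto
    next
      fix l :: int assume l: "l \<in> {- int m..- int m + int (2 * m)}"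
      have x: "C l * (e \<bullet> b) + S l * (y \<bullet> b) = - (d3 * C l)" by (simp add: co)
      show "- (3/2 * d3) + d3 * c4 - d1 * c4 + 1/150 + 1/150 < C l * (e \<bullet> b) + S l * (y \<bullet> b) \<and>
          C l * (e \<bullet> b) + S l * (y \<bullet> b) < - (3/2 * d3) + d3 * c4 + d1 * c4 - 1/150 - 1/150"
        unfolding x using bd[OF l] pr d d1 True by (intro conjI; linarith)
      have y: "(3/2 - C l) * (e \<bullet> a) + S l * (z \<bullet> a) = d2 * C l - 3/2 * d2" by (simp add: co algebra_simps)
      show "- (d2 * c4) - d1 * c4 + 1/150 + 1/150 < (3/2 - C l) * (e \<bullet> a) + S l * (z \<bullet> a) \<and>
          (3/2 - C l) * (e \<bullet> a) + S l * (z \<bullet> a) < - (d2 * c4) + d1 * c4 - 1/150 - 1/150"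
        unfolding y using bd[OF l] pr d d1 True by (intro conjI; linarith)
    qed (simp_all add: co CS Cm algebra_simps)
  next
    case False
    have d2: "d2 \<ge> 2/3"
    proof (rule ccontr)
      assume "\<not> d2 \<ge> 2/3"
      then have "d1 \<le> 4/15" "d2 \<le> 2/3" "d3 \<le> 2/3" using False d by linarith+
      then have "d1\<^sup>2 \<le> (4/15)\<^sup>2" "d2\<^sup>2 \<le> (2/3)\<^sup>2" "d3\<^sup>2 \<le> (2/3)\<^sup>2" using d False by (intro power_mono; linarith)+
      then show False using dd by (simp add: power2_eq_square)
    qed
    \<comment> \<open>Two vectors orthogonal to d, obtained by solving for the dominant coordinate
      d2. On the second circle they read off d2 times the e- and z-coordinates.\<close>
    define a0 b0 where "a0 = d2 *\<^sub>R e + (- d1) *\<^sub>R y + 0 *\<^sub>R z" and "b0 = 0 *\<^sub>R e + (- d3) *\<^sub>R y + d2 *\<^sub>R z"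
    have co: "e \<bullet> a0 = d2" "y \<bullet> a0 = - d1" "z \<bullet> a0 = 0" "e \<bullet> b0 = 0" "y \<bullet> b0 = - d3" "z \<bullet> b0 = d2"
      by (simp_all add: a0_def b0_def inn)
    have perp: "a0 \<bullet> d = 0" "b0 \<bullet> d = 0" by (simp_all add: dw a0_def b0_def inn)
    have ind: "w = 0" if w: "w \<bullet> a0 = 0" "w \<bullet> b0 = 0" "w \<bullet> d = 0" for w
    proof -
      have e: "d2 * (w \<bullet> e) = d1 * (w \<bullet> y)" "d2 * (w \<bullet> z) = d3 * (w \<bullet> y)" using w by (simp_all add: a0_def b0_def inner_add_right inner_diff_right)
      have "0 = d2 * (w \<bullet> d)" using w by simp
      also have "\<dots> = d1 * (d2 * (w \<bullet> e)) + d2\<^sup>2 * (w \<bullet> y) + d3 * (d2 * (w \<bullet> z))" by (simp add: dw algebra_simps power2_eq_square)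
      also have "\<dots> = (d1\<^sup>2 + d2\<^sup>2 + d3\<^sup>2) * (w \<bullet> y)" unfolding e by (simp add: algebra_simps power2_eq_square)
      finally have "w \<bullet> y = 0" using dd by simp
      then show "w = 0" using e d2 by (intro zero) auto
    qed
    have d1: "d1 \<le> 2/5 * d2" using False by simp
    have half: "C l \<ge> 0" "S l \<le> 0" "C l - S l \<ge> 1" "C l - S l \<le> 14143/10000" if "l \<in> {- (2 * int m)..- (2 * int m) + int (2 * m)}" for l
    proof -
      show c: "C l \<ge> 0" and s: "S l \<le> 0" using Cq(2,3)[of "- l"] CS(6,7)[of l] that by auto
      have sq: "(C l - S l)\<^sup>2 = 1 - 2 * (C l * S l)" using CS(1)[of l] by (simp add: power2_eq_square algebra_simps)
      have "C l * S l \<le> 0" using c s by (simp add: mult_nonneg_nonpos)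
      then have "(C l - S l)\<^sup>2 \<ge> 1\<^sup>2" using sq by simp
      then show "C l - S l \<ge> 1" using c s by (intro power2_le_imp_le[of 1]) auto
      have "(C l + S l)\<^sup>2 \<ge> 0" by simp
      then have "(C l - S l)\<^sup>2 \<le> 2" using CS(1)[of l] unfolding sq by (simp add: power2_eq_square algebra_simps)
      then have "(C l - S l)\<^sup>2 \<le> (14143/10000)\<^sup>2" by (simp add: power2_eq_square)
      then show "C l - S l \<le> 14143/10000" by (rule power2_le_imp_le) simp
    qed
    show ?thesis
    \<comment> \<open>If d3 is comparable to d2, the shadow of the first circle is open and the
      diagonals a0 - b0 and a0 + b0 are used as coordinates. If d3 is smaller, that shadow is low in
      the b0-direction and a0, b0 themselves work.\<close>
    proof (cases "d3 \<ge> 3/5 * d2")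
      case True
      have sq: "0 \<le> d1 * d3" using d by simp
      have n: "norm (a0 - b0) \<le> 2" "norm (a0 + b0) \<le> 2"
      proof -
        have e: "a0 - b0 = d2 *\<^sub>R e + (d3 - d1) *\<^sub>R y + (- d2) *\<^sub>R z" by (simp add: a0_def b0_def algebra_simps)
        have "(d3 - d1)\<^sup>2 \<le> d3\<^sup>2 + d1\<^sup>2" using sq by (simp add: power2_eq_square algebra_simps)
        then show "norm (a0 - b0) \<le> 2" unfolding e
          by (rule_tac len, unfold power2_minus) (insert dd sqs, linarith)
      next
        have e: "a0 + b0 = d2 *\<^sub>R e + (- (d3 + d1)) *\<^sub>R y + d2 *\<^sub>R z" by (simp add: a0_def b0_def algebra_simps)
        have "(- (d3 + d1))\<^sup>2 \<le> 2 * (d3\<^sup>2 + d1\<^sup>2)" using zero_le_power2[of "d3 - d1"] by (simp add: power2_eq_square algebra_simps)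
        moreover have "d2\<^sup>2 + k + d2\<^sup>2 \<le> 4" if "k \<le> 2 * (d3\<^sup>2 + d1\<^sup>2)" for k using that dd sqs by argo
        ultimately show "norm (a0 + b0) \<le> 2" unfolding e by (intro len) blast
      qed
      have bX: "C l * d2 - S l * (d1 + d3) \<ge> 3/5 * d2" "C l * d2 - S l * (d1 + d3) \<le> 12/5 * d2"
        if "l \<in> {- (2 * int m)..- (2 * int m) + int (2 * m)}" for l
      proof -
        note h = half[OF that]
        have "(- S l) * (d1 + d3) \<ge> (- S l) * (3/5 * d2)" using h True d by (intro mult_left_mono) auto
        moreover have "(- S l) * (d1 + d3) \<le> 1 * (7/5 * d2)" using h CS(5)[of l] d1 d by (intro mult_mono) auto
        moreover have "3/5 * d2 * 1 \<le> 3/5 * d2 * (C l - S l)" using h d by (intro mult_left_mono) auto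
        moreover have "C l * d2 \<ge> 3/5 * (C l * d2)" "C l * d2 \<le> 1 * d2"
          using mult_nonneg_nonneg[of "C l" d2] mult_right_mono[OF CS(2)[of l], of d2] h d by auto
        ultimately show "C l * d2 - S l * (d1 + d3) \<ge> 3/5 * d2" "C l * d2 - S l * (d1 + d3) \<le> 12/5 * d2"
          by (simp_all add: algebra_simps)
      qed
      have bY: "C l * d2 + S l * d2 \<ge> d2" "C l * d2 + S l * d2 \<le> 14143/10000 * d2" if "l \<in> {0..0 + int (2 * m)}" for l
      proof -
        have "- l \<in> {- (2 * int m)..- (2 * int m) + int (2 * m)}" using that by auto
        note h = half(3,4)[OF this, unfolded CS(6,7)]
        have "1 * d2 \<le> (C l + S l) * d2" "(C l + S l) * d2 \<le> 14143/10000 * d2" using h d by (intro mult_right_mono; simp)+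
        then show "C l * d2 + S l * d2 \<ge> d2" "C l * d2 + S l * d2 \<le> 14143/10000 * d2" by (simp_all add: algebra_simps)
      qed
      show ?thesis
      \<comment> \<open>The first arc has angles from -pi/2 to 0, and a0 - b0 goes from d1 - d3 to
        d2 along it. The second has angles from 0 to pi/2, and a0 + b0 goes from d2/2 to 5/2 d2. The
        sides of the rectangle lie inside these ranges with at least 1/150 to spare.\<close>
      proof (rule main[where a = "a0 - b0" and b = "a0 + b0" and la = "- (2 * int m)" and lb = 0 and i = "- (2 * int m)" and j = "2 * m"
         and ka = 0 and kb = "2 * int m" and i' = 0 and j' = "2 * m"
         and \<alpha> = 0 and \<alpha>' = "3/5 * d2" and \<beta> = "11/20 * d2" and \<beta>' = "49/20 * d2"])
        show "(a0 - b0) \<bullet> d = 0" "(a0 + b0) \<bullet> d = 0" using perp by (simp_all add: inner_diff_left inner_add_left)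
        show "norm (a0 - b0) \<le> 2" "norm (a0 + b0) \<le> 2" using n by auto
        fix w assume w: "w \<bullet> (a0 - b0) = 0" "w \<bullet> (a0 + b0) = 0" "w \<bullet> d = 0"
        then have "w \<bullet> a0 = 0" "w \<bullet> b0 = 0" by (simp_all add: inner_add_right inner_diff_right)
        then show "w = 0" using ind w by blast
      next
        show "- (2 * int m) \<in> {- (2 * int m)..- (2 * int m) + int (2 * m)}" "0 \<in> {- (2 * int m)..- (2 * int m) + int (2 * m)}"
          "0 \<in> {0..0 + int (2 * m)}" "2 * int m \<in> {0..0 + int (2 * m)}" by auto
      next
        fix l :: int assume l: "l \<in> {- (2 * int m)..- (2 * int m) + int (2 * m)}"
        have x: "C l * (e \<bullet> (a0 + b0)) + S l * (y \<bullet> (a0 + b0)) = C l * d2 - S l * (d1 + d3)"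
          by (simp add: co inner_add_right algebra_simps)
        show "11/20 * d2 + 1/150 < C l * (e \<bullet> (a0 + b0)) + S l * (y \<bullet> (a0 + b0)) \<and>
          C l * (e \<bullet> (a0 + b0)) + S l * (y \<bullet> (a0 + b0)) < 49/20 * d2 - 1/150"
          unfolding x using bX[OF l] d2 by (intro conjI; linarith)
      next
        fix l :: int assume l: "l \<in> {0..0 + int (2 * m)}"
        have y: "(3/2 - C l) * (e \<bullet> (a0 - b0)) + S l * (z \<bullet> (a0 - b0)) = 3/2 * d2 - (C l * d2 + S l * d2)"
          by (simp add: co inner_diff_right algebra_simps)
        show "0 + 1/150 < (3/2 - C l) * (e \<bullet> (a0 - b0)) + S l * (z \<bullet> (a0 - b0)) \<and>
          (3/2 - C l) * (e \<bullet> (a0 - b0)) + S l * (z \<bullet> (a0 - b0)) < 3/5 * d2 - 1/150"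
          unfolding y using bY[OF l] d2 by (intro conjI; linarith)
      qed (use d d1 d2 True in \<open>simp_all add: co CS Cm inner_diff_right inner_add_right\<close>)
    next
      case False
      have n: "norm a0 \<le> 2" unfolding a0_def by (rule len) (unfold power2_minus zero_power2, insert dd sqs, linarith)
      have n': "norm b0 \<le> 2" unfolding b0_def by (rule len) (unfold power2_minus zero_power2, insert dd sqs, linarith)
      have bX: "- S l * d3 \<ge> 0" "- S l * d3 \<le> 3/5 * d2" if "l \<in> {- (2 * int m)..- (2 * int m) + int (2 * m)}" for l
      proof -
        show "- S l * d3 \<ge> 0" using half(2)[OF that] d by (intro mult_nonneg_nonneg) auto
        have "- S l * d3 \<le> 1 * d3" using CS(5)[of l] d by (intro mult_right_mono) auto
        then show "- S l * d3 \<le> 3/5 * d2" using False by simp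
      qed
      have bY: "C l * d2 \<ge> 7/10 * d2" "C l * d2 \<le> d2" if "l \<in> {- int m..- int m + int (2 * m)}" for l
      proof -
        have "\<bar>l\<bar> \<le> int m" using that by (simp add: abs_le_iff)
        then have "C l \<ge> 7/10" using Cq(1)[of l] c4 by linarith
        then show "C l * d2 \<ge> 7/10 * d2" using d by (intro mult_right_mono) auto
        show "C l * d2 \<le> d2" using mult_right_mono[OF CS(2)[of l], of d2] d by auto
      qed
      have c4d: "c4 * d2 \<ge> 13 * d2 / 20 + 1/150" using c4m(1)[of d2] d d2 mult.commute[of c4 d2] by linarith
      show ?thesis
      \<comment> \<open>Along the first arc, from -pi/2 to 0, a0 goes from d1 to d2 and b0 stays in
        [0, 3/5 d2]. Along the second, from -pi/4 to pi/4, b0 sweeps about 7/10 d2 to either side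
        and a0 stays in [1/2 d2, 4/5 d2].\<close>
      proof (rule main[where a = a0 and b = b0 and la = "- (2 * int m)" and lb = 0 and i = "- (2 * int m)" and j = "2 * m"
         and ka = "- int m" and kb = "int m" and i' = "- int m" and j' = "2 * m"
         and \<alpha> = "9/20 * d2" and \<alpha>' = "9/10 * d2" and \<beta> = "- (13/20 * d2)" and \<beta>' = "13/20 * d2"])
        show "a0 \<bullet> d = 0" "b0 \<bullet> d = 0" "norm a0 \<le> 2" "norm b0 \<le> 2" using perp n n' by auto
        show "\<And>w. w \<bullet> a0 = 0 \<Longrightarrow> w \<bullet> b0 = 0 \<Longrightarrow> w \<bullet> d = 0 \<Longrightarrow> w = 0" by (rule ind)
      next
        show "- (2 * int m) \<in> {- (2 * int m)..- (2 * int m) + int (2 * m)}" "0 \<in> {- (2 * int m)..- (2 * int m) + int (2 * m)}"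
          "- int m \<in> {- int m..- int m + int (2 * m)}" "int m \<in> {- int m..- int m + int (2 * m)}" by auto
      next
        fix l :: int assume l: "l \<in> {- (2 * int m)..- (2 * int m) + int (2 * m)}"
        have x: "C l * (e \<bullet> b0) + S l * (y \<bullet> b0) = - S l * d3" by (simp add: co)
        show "- (13/20 * d2) + 1/150 < C l * (e \<bullet> b0) + S l * (y \<bullet> b0) \<and> C l * (e \<bullet> b0) + S l * (y \<bullet> b0) < 13/20 * d2 - 1/150"
          unfolding x using bX[OF l] d2 by (intro conjI; linarith)
      next
        fix l :: int assume l: "l \<in> {- int m..- int m + int (2 * m)}"
        have y: "(3/2 - C l) * (e \<bullet> a0) + S l * (z \<bullet> a0) = 3/2 * d2 - C l * d2" by (simp add: co algebra_simps)
        show "9/20 * d2 + 1/150 < (3/2 - C l) * (e \<bullet> a0) + S l * (z \<bullet> a0) \<and>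
          (3/2 - C l) * (e \<bullet> a0) + S l * (z \<bullet> a0) < 9/10 * d2 - 1/150"
          unfolding y using bY[OF l] d2 by (intro conjI; linarith)
      qed (use d d1 d2 c4d in \<open>simp_all add: co CS Cm\<close>)
    qed
  qed
qed

text \<open>Removes the sign conditions. A shadow along d is a shadow along - d, and reversing y or
  z is the same as traversing the respective chain backwards, hence the reindexing by \<sigma> l and
  \<rho> l.\<close>

lemma crossing_chains_aux:
  fixes X Y :: "int \<Rightarrow> (real^3) set" and e y z :: "real^3" and q m :: nat
  assumes q: "q = 8 * m" "m > 0"
    and on: "norm e = 1" "norm y = 1" "norm z = 1" "e \<bullet> y = 0" "e \<bullet> z = 0" "y \<bullet> z = 0"
    and d: "norm d = 1" "\<bar>d \<bullet> z\<bar> \<le> \<bar>d \<bullet> y\<bar>"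
    and s: "s > 0"
    and X: "\<And>l p. p \<in> X l \<Longrightarrow> norm (p - c - s *\<^sub>R circle_point e y (2 * pi * l / q)) \<le> (1/300) * s"
    and Y: "\<And>l p. p \<in> Y l \<Longrightarrow> norm (p - c - s *\<^sub>R ((3/2) *\<^sub>R e + circle_point (- e) z (2 * pi * l / q))) \<le> (1/300) * s"
    and ne: "\<And>l. X l \<noteq> {}" "\<And>l. Y l \<noteq> {}"
    and pcX: "\<And>l. path_connected (flatten d ` X l)" and ovX: "\<And>l. flatten d ` X l \<inter> flatten d ` X (l + 1) \<noteq> {}"
    and pcY: "\<And>l. path_connected (flatten d ` Y l)" and ovY: "\<And>l. flatten d ` Y l \<inter> flatten d ` Y (l + 1) \<noteq> {}"
  shows "\<exists>l l'. flatten d ` X l \<inter> flatten d ` Y l' \<noteq> {}"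
proof -
  define \<tau> where "\<tau> = (if d \<bullet> e \<ge> 0 then 1 else -1 :: int)"
  define d' where "d' = of_int \<tau> *\<^sub>R d"
  have fl: "flatten d' = flatten d" by (simp add: d'_def \<tau>_def flatten_uminus)
  define \<sigma> \<rho> where "\<sigma> = (if d' \<bullet> y \<ge> 0 then 1 else -1 :: int)" and "\<rho> = (if d' \<bullet> z \<ge> 0 then 1 else -1 :: int)"
  have sg: "\<sigma> = 1 \<or> \<sigma> = -1" "\<rho> = 1 \<or> \<rho> = -1" by (auto simp: \<sigma>_def \<rho>_def)
  have ex: "d' = (d' \<bullet> e) *\<^sub>R e + (d' \<bullet> y) *\<^sub>R y + (d' \<bullet> z) *\<^sub>R z"
  proof -
    have "z = (z \<bullet> cross3 e y) *\<^sub>R cross3 e y"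
      using orthonormal_expansion(1)[OF on(1,2,4), of z] on by (simp add: inner_commute)
    then obtain k where k: "z = k *\<^sub>R cross3 e y" by blast
    then have "\<bar>k\<bar> = 1" using on(3) orthonormal_expansion(2)[OF on(1,2,4)] by simp
    then have "(d' \<bullet> z) *\<^sub>R z = (d' \<bullet> cross3 e y) *\<^sub>R cross3 e y" unfolding k by (auto simp: abs_if split: if_splits)
    then show ?thesis using orthonormal_expansion(1)[OF on(1,2,4), of d'] by simp
  qed
  have ex': "d' = (d' \<bullet> e) *\<^sub>R e + \<bar>d' \<bullet> y\<bar> *\<^sub>R (of_int \<sigma> *\<^sub>R y) + \<bar>d' \<bullet> z\<bar> *\<^sub>R (of_int \<rho> *\<^sub>R z)"
    by (subst ex) (auto simp: \<sigma>_def \<rho>_def)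
  have cp: "circle_point u (of_int k *\<^sub>R v) (2 * pi * real_of_int l / real q) = circle_point u v (2 * pi * real_of_int (k * l) / real q)"
    if "k = 1 \<or> k = -1" for u v :: "real^3" and k l :: int
    using that by (auto simp: circle_point_def)
  have ov: "flatten d' ` Z (k * l) \<inter> flatten d' ` Z (k * (l + 1)) \<noteq> {}"
    if "k = 1 \<or> k = -1" "\<And>l. flatten d ` Z l \<inter> flatten d ` Z (l + 1) \<noteq> {}" for Z :: "int \<Rightarrow> (real^3) set" and k l
  proof (cases "k = 1")
    case True
    then show ?thesis using that(2)[of l] unfolding fl by simp
  next
    case False
    then have e: "k * l = - l - 1 + 1" "k * (l + 1) = - l - 1" using that(1) by auto
    show ?thesis unfolding fl e using that(2)[of "- l - 1"] by blast
  qed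
  have "\<exists>l l'. flatten d' ` X (\<sigma> * l) \<inter> flatten d' ` Y (\<rho> * l') \<noteq> {}"
  proof (rule crossing_chains_octant[OF q, where e = e and y = "of_int \<sigma> *\<^sub>R y" and z = "of_int \<rho> *\<^sub>R z" and s = s and c = c])
    show "d' = (d' \<bullet> e) *\<^sub>R e + \<bar>d' \<bullet> y\<bar> *\<^sub>R (of_int \<sigma> *\<^sub>R y) + \<bar>d' \<bullet> z\<bar> *\<^sub>R (of_int \<rho> *\<^sub>R z)" by (rule ex')
    show "norm d' = 1" using d by (simp add: d'_def \<tau>_def)
    show "0 \<le> d' \<bullet> e" by (simp add: d'_def \<tau>_def)
    show "\<bar>d' \<bullet> z\<bar> \<le> \<bar>d' \<bullet> y\<bar>" using d by (simp add: d'_def \<tau>_def)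
    show "norm (of_int \<sigma> *\<^sub>R y) = 1" "norm (of_int \<rho> *\<^sub>R z) = 1" using on sg by auto
    show "norm (p - c - s *\<^sub>R circle_point e (of_int \<sigma> *\<^sub>R y) (2 * pi * real_of_int l / real q)) \<le> (1/300) * s" if "p \<in> X (\<sigma> * l)" for p l
      unfolding cp[OF sg(1)] by (rule X[OF that])
    show "norm (p - c - s *\<^sub>R ((3/2) *\<^sub>R e + circle_point (- e) (of_int \<rho> *\<^sub>R z) (2 * pi * real_of_int l / real q))) \<le> (1/300) * s" if "p \<in> Y (\<rho> * l)" for p l
      unfolding cp[OF sg(2)] by (rule Y[OF that])
    show "flatten d' ` X (\<sigma> * l) \<inter> flatten d' ` X (\<sigma> * (l + 1)) \<noteq> {}" for l by (rule ov[where Z = X and k = \<sigma> and l = l, OF sg(1) ovX])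
    show "flatten d' ` Y (\<rho> * l) \<inter> flatten d' ` Y (\<rho> * (l + 1)) \<noteq> {}" for l by (rule ov[where Z = Y and k = \<rho> and l = l, OF sg(2) ovY])
  qed (use on s ne pcX pcY in \<open>simp_all add: fl\<close>)
  then show ?thesis unfolding fl by blast
qed

text \<open>Removes the comparison of the y- and z-components. The configuration is symmetric: seen
  from the centre of the second circle, with - e for e and with y and z exchanged, the first circle
  is the second.\<close>

lemma crossing_chains:
  fixes X Y :: "int \<Rightarrow> (real^3) set" and e y z :: "real^3" and q m :: nat
  assumes q: "q = 8 * m" "m > 0"
    and on: "norm e = 1" "norm y = 1" "norm z = 1" "e \<bullet> y = 0" "e \<bullet> z = 0" "y \<bullet> z = 0"
    and d: "norm d = 1"
    and s: "s > 0"
    and X: "\<And>l p. p \<in> X l \<Longrightarrow> norm (p - c - s *\<^sub>R circle_point e y (2 * pi * l / q)) \<le> (1/300) * s"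
    and Y: "\<And>l p. p \<in> Y l \<Longrightarrow> norm (p - c - s *\<^sub>R ((3/2) *\<^sub>R e + circle_point (- e) z (2 * pi * l / q))) \<le> (1/300) * s"
    and ne: "\<And>l. X l \<noteq> {}" "\<And>l. Y l \<noteq> {}"
    and pcX: "\<And>l. path_connected (flatten d ` X l)" and ovX: "\<And>l. flatten d ` X l \<inter> flatten d ` X (l + 1) \<noteq> {}"
    and pcY: "\<And>l. path_connected (flatten d ` Y l)" and ovY: "\<And>l. flatten d ` Y l \<inter> flatten d ` Y (l + 1) \<noteq> {}"
  shows "\<exists>l l'. flatten d ` X l \<inter> flatten d ` Y l' \<noteq> {}"
proof (cases "\<bar>d \<bullet> z\<bar> \<le> \<bar>d \<bullet> y\<bar>")
  case True
  show ?thesis by (rule crossing_chains_aux[OF q on d True s X Y ne]) (rule pcX ovX pcY ovY | assumption)+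
next
  case False
  have "\<exists>l l'. flatten d ` Y l \<inter> flatten d ` X l' \<noteq> {}"
  proof (rule crossing_chains_aux[OF q, where e = "- e" and y = z and z = y and s = s and c = "c + s *\<^sub>R ((3/2) *\<^sub>R e)"])
    show "\<bar>d \<bullet> y\<bar> \<le> \<bar>d \<bullet> z\<bar>" using False by simp
    fix p l
    show "norm (p - (c + s *\<^sub>R ((3/2) *\<^sub>R e)) - s *\<^sub>R circle_point (- e) z (2 * pi * real_of_int l / real q)) \<le> (1/300) * s" if p: "p \<in> Y l"
      using Y[OF p] by (simp add: scaleR_add_right diff_diff_eq2 algebra_simps)
    have e': "c + s *\<^sub>R ((3/2) *\<^sub>R e) + s *\<^sub>R ((3/2) *\<^sub>R (- e) + circle_point (- (- e)) y t) = c + s *\<^sub>R circle_point e y t" for t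
      by (simp add: algebra_simps)
    show "norm (p - (c + s *\<^sub>R ((3/2) *\<^sub>R e)) - s *\<^sub>R ((3/2) *\<^sub>R (- e) + circle_point (- (- e)) y (2 * pi * real_of_int l / real q))) \<le> (1/300) * s" if p: "p \<in> X l"
      unfolding diff_diff_eq e' using X[OF p] unfolding diff_diff_eq .
  qed (use on s d ne pcX pcY ovX ovY in \<open>simp_all add: inner_commute\<close>)
  then show ?thesis by blast
qed

section \<open>Links on a regular polygon\<close>

definition e1 :: "real^3" where "e1 = axis 1 1"
definition e2 :: "real^3" where "e2 = axis 2 1"
definition e3 :: "real^3" where "e3 = axis 3 1"

lemma e_inner [simp]:
  "e1 \<bullet> e1 = 1" "e2 \<bullet> e2 = 1" "e3 \<bullet> e3 = 1" "e1 \<bullet> e2 = 0" "e2 \<bullet> e1 = 0" "e1 \<bullet> e3 = 0" "e3 \<bullet> e1 = 0"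
  "e2 \<bullet> e3 = 0" "e3 \<bullet> e2 = 0"
  by (simp_all add: e1_def e2_def e3_def inner_axis_axis)

lemma e_norm [simp]: "norm e1 = 1" "norm e2 = 1" "norm e3 = 1"
  by (simp_all add: norm_eq_1)

lemma e_expand: "x = (x \<bullet> e1) *\<^sub>R e1 + (x \<bullet> e2) *\<^sub>R e2 + (x \<bullet> e3) *\<^sub>R e3"
proof -
  have "cross3 e1 e2 = e3" by (simp add: e1_def e2_def e3_def cross_basis)
  then show ?thesis using orthonormal_expansion(1)[of e1 e2 x] by simp
qed

definition chain_q :: nat where "chain_q = 16000"
definition chain_angle :: "int \<Rightarrow> real" where "chain_angle k = 2 * pi * k / chain_q"
definition half_step :: real where "half_step = pi / chain_q"
text \<open>Solves 2 sin \<open>half_step\<close> = 3/2 \<rho> for \<rho>: neighbouring vertices of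
  the polygon are exactly 3/2 link radii apart.\<close>

definition chain_ratio :: real where "chain_ratio = 4/3 * sin half_step"

definition radial :: "int \<Rightarrow> real^3" where
  "radial k = cos (chain_angle k) *\<^sub>R e1 + sin (chain_angle k) *\<^sub>R e2"
definition tangent :: "int \<Rightarrow> real^3" where
  "tangent k = - sin (chain_angle k) *\<^sub>R e1 + cos (chain_angle k) *\<^sub>R e2"

text \<open>Every link contains the tangent direction in its plane. The second direction of that
  plane is radial for even links, which are horizontal, and vertical for odd links.\<close>

definition link_second :: "int \<Rightarrow> real^3" where "link_second k = (if even k then radial k else e3)"
definition link_normal :: "int \<Rightarrow> real^3" where "link_normal k = (if even k then e3 else radial k)"

text \<open>Sends the standard frame to tangent, second direction and normal of the link. For even k
  this frame is left-handed, so the map is orthogonal without being a rotation; congruence of sets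
  permits this.\<close>

definition link_rot :: "int \<Rightarrow> real^3 \<Rightarrow> real^3" where
  "link_rot k x = (x \<bullet> e1) *\<^sub>R tangent k + (x \<bullet> e2) *\<^sub>R link_second k + (x \<bullet> e3) *\<^sub>R link_normal k"

definition link_map :: "int \<Rightarrow> real^3 \<Rightarrow> real^3" where
  "link_map k x = radial k + chain_ratio *\<^sub>R link_rot k x"

lemma half_step: "0 < half_step" "half_step < 1/4000"
  using pi_gt_zero pi_less_4 by (simp_all add: half_step_def chain_q_def)

lemma chain_ratio: "0 < chain_ratio" "chain_ratio < 1/3000"
proof -
  have "half_step < pi" using pi_gt_zero by (simp add: half_step_def chain_q_def)
  then show "0 < chain_ratio" using half_step sin_gt_zero by (simp add: chain_ratio_def)
  show "chain_ratio < 1/3000" using half_step sin_x_le_x[of half_step] by (simp add: chain_ratio_def)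
qed

lemma chain_angle_add: "chain_angle (k + l) = chain_angle k + chain_angle l"
  by (simp add: chain_angle_def add_divide_distrib algebra_simps)

lemma chain_angle_1: "chain_angle 1 = 2 * half_step" "chain_angle (-1) = - (2 * half_step)"
  by (simp_all add: chain_angle_def half_step_def)

lemma chain_angle_q: "chain_angle (int chain_q * k) = 2 * pi * k"
  by (simp add: chain_angle_def chain_q_def)

lemma periodic_q [simp]: "radial (k + int chain_q) = radial k" "tangent (k + int chain_q) = tangent k"
  using chain_angle_q[of 1] by (simp_all add: radial_def tangent_def chain_angle_add)

lemma link_map_periodic: "link_map (k + int chain_q) = link_map k"
proof -
  have "even (k + int chain_q) = even k" by (simp add: chain_q_def)
  then show ?thesis by (simp add: link_map_def[abs_def] link_rot_def[abs_def] link_second_def link_normal_def)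
qed

lemma radial_tangent_inner [simp]:
  "radial k \<bullet> radial k = 1" "tangent k \<bullet> tangent k = 1" "radial k \<bullet> tangent k = 0" "tangent k \<bullet> radial k = 0"
  "radial k \<bullet> e3 = 0" "e3 \<bullet> radial k = 0" "tangent k \<bullet> e3 = 0" "e3 \<bullet> tangent k = 0"
  using sin_cos_squared_add[of "chain_angle k"]
  by (simp_all add: radial_def tangent_def inner_add_left inner_add_right inner_diff_left inner_diff_right power2_eq_square)

lemma radial_tangent_norm [simp]: "norm (radial k) = 1" "norm (tangent k) = 1"
  by (simp_all add: norm_eq_1)

lemma link_frame [simp]:
  "norm (link_second k) = 1" "norm (link_normal k) = 1" "tangent k \<bullet> link_second k = 0" "link_second k \<bullet> tangent k = 0"
  "tangent k \<bullet> link_normal k = 0" "link_normal k \<bullet> tangent k = 0" "link_second k \<bullet> link_normal k = 0" "link_normal k \<bullet> link_second k = 0"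
  "link_second k \<bullet> link_second k = 1" "link_normal k \<bullet> link_normal k = 1"
  by (auto simp: link_second_def link_normal_def)

lemma radial_add:
  "radial (k + l) = cos (chain_angle l) *\<^sub>R radial k + sin (chain_angle l) *\<^sub>R tangent k"
  "tangent (k + l) = cos (chain_angle l) *\<^sub>R tangent k - sin (chain_angle l) *\<^sub>R radial k"
  unfolding radial_def tangent_def chain_angle_add by (simp_all add: cos_add sin_add algebra_simps)

lemma orthogonal_link_rot: "orthogonal_transformation (link_rot k)"
  unfolding orthogonal_transformation_def
proof (intro conjI allI)
  show "linear (link_rot k)" by (rule linearI) (simp_all add: link_rot_def inner_add_left algebra_simps)
  fix v w :: "real^3"
  have "v \<bullet> w = (v \<bullet> e1) * (w \<bullet> e1) + (v \<bullet> e2) * (w \<bullet> e2) + (v \<bullet> e3) * (w \<bullet> e3)"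
    by (subst e_expand[of w]) (simp add: inner_add_right mult_ac)
  then show "link_rot k v \<bullet> link_rot k w = v \<bullet> w"
    by (simp add: link_rot_def inner_add_left inner_add_right mult_ac)
qed

section \<open>Similarities and their action on circles and tubes\<close>

definition similarity :: "real \<Rightarrow> (real^3 \<Rightarrow> real^3) \<Rightarrow> (real^3 \<Rightarrow> real^3) \<Rightarrow> bool" where
  "similarity \<mu> U f \<longleftrightarrow> \<mu> > 0 \<and> orthogonal_transformation U \<and> (\<forall>x. f x = f 0 + \<mu> *\<^sub>R U x)"

lemma similarity_link_map: "similarity chain_ratio (link_rot k) (link_map k)"
proof -
  have "link_rot k 0 = 0" by (simp add: link_rot_def)
  then show ?thesis using chain_ratio orthogonal_link_rot by (simp add: similarity_def link_map_def)
qed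

lemma similarity_pos: "similarity \<mu> U f \<Longrightarrow> \<mu> > 0"
  and similarity_orthogonal: "similarity \<mu> U f \<Longrightarrow> orthogonal_transformation U"
  and similarity_apply: "similarity \<mu> U f \<Longrightarrow> f x = f 0 + \<mu> *\<^sub>R U x"
  unfolding similarity_def by blast+

lemma similarity_linear: "similarity \<mu> U f \<Longrightarrow> linear U"
  using similarity_orthogonal orthogonal_transformation_linear by blast

lemma similarity_norm:
  assumes "similarity \<mu> U f" shows "norm (U x) = norm x" "U x \<bullet> U y = x \<bullet> y"
  using similarity_orthogonal[OF assms] by (simp_all add: orthogonal_transformation_norm) (simp add: orthogonal_transformation_def)

lemma similarity_diff:
  assumes "similarity \<mu> U f" shows "f x - f y = \<mu> *\<^sub>R U (x - y)"
proof -
  have "f x - f y = \<mu> *\<^sub>R U x - \<mu> *\<^sub>R U y"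
    unfolding similarity_apply[OF assms, of x] similarity_apply[OF assms, of y] by simp
  then show ?thesis by (simp add: linear_diff[OF similarity_linear[OF assms]] scaleR_diff_right)
qed

lemma similarity_dist:
  assumes "similarity \<mu> U f" shows "dist (f x) (f y) = \<mu> * dist x y"
  unfolding dist_norm similarity_diff[OF assms] using similarity_norm(1)[OF assms] similarity_pos[OF assms] by simp

lemma similarity_id: "similarity 1 id id"
  by (simp add: similarity_def orthogonal_transformation_def linear_id)

lemma similarity_compose:
  assumes f: "similarity \<mu> U f" and g: "similarity \<nu> V g"
  shows "similarity (\<mu> * \<nu>) (U \<circ> V) (f \<circ> g)"
  unfolding similarity_def
proof (intro conjI allI)
  show "\<mu> * \<nu> > 0" using similarity_pos[OF f] similarity_pos[OF g] by simp
  show "orthogonal_transformation (U \<circ> V)"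
    by (rule orthogonal_transformation_compose[OF similarity_orthogonal[OF f] similarity_orthogonal[OF g]])
  fix x
  have "f (g x) - f (g 0) = \<mu> *\<^sub>R U (\<nu> *\<^sub>R V x)" unfolding similarity_diff[OF f]
    unfolding similarity_apply[OF g, of x] add_diff_cancel_left' ..
  then show "(f \<circ> g) x = (f \<circ> g) 0 + (\<mu> * \<nu>) *\<^sub>R (U \<circ> V) x"
    by (simp add: linear_cmul[OF similarity_linear[OF f]] algebra_simps)
qed

lemma similarity_surj:
  assumes "similarity \<mu> U f" obtains x where "y = f x"
proof -
  have "surj U" using similarity_orthogonal[OF assms] by (rule orthogonal_transformation_surj)
  from surjD[OF this, of "(y - f 0) /\<^sub>R \<mu>"] obtain x where x: "(y - f 0) /\<^sub>R \<mu> = U x" by blast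
  have "f x = y" using similarity_pos[OF assms] unfolding similarity_apply[OF assms, of x] x[symmetric] by simp
  then show thesis using that by blast
qed

lemma similarity_image_eqI:
  assumes f: "similarity \<mu> U f" and "\<And>x. f x \<in> T \<longleftrightarrow> x \<in> S"
  shows "f ` S = T"
proof (intro equalityI subsetI)
  fix y assume "y \<in> T"
  obtain x where "y = f x" using similarity_surj[OF f] .
  then show "y \<in> f ` S" using assms(2) \<open>y \<in> T\<close> by blast
qed (use assms in auto)

lemma similarity_inj:
  assumes "similarity \<mu> U f" shows "inj f"
proof (rule injI)
  fix x y assume "f x = f y"
  then have "\<mu> * dist x y = 0" using similarity_dist[OF assms, of x y] by simp
  then show "x = y" using similarity_pos[OF assms] by simp
qed

lemma similarity_continuous:
  assumes "similarity \<mu> U f" shows "continuous_on S f"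
proof -
  have "lipschitz_on \<mu> S f" using similarity_pos[OF assms] by (intro lipschitz_onI) (auto simp: similarity_dist[OF assms])
  then show ?thesis by (rule lipschitz_on_continuous_on)
qed

lemma similarity_cball:
  assumes f: "similarity \<mu> U f" shows "f ` cball c r = cball (f c) (\<mu> * r)"
  by (rule similarity_image_eqI[OF f]) (simp add: similarity_dist[OF f] similarity_pos[OF f])

lemma similarity_ball:
  assumes f: "similarity \<mu> U f" shows "f ` ball c r = ball (f c) (\<mu> * r)"
  by (rule similarity_image_eqI[OF f]) (simp add: similarity_dist[OF f] similarity_pos[OF f])

lemma similarity_round_circle:
  assumes f: "similarity \<mu> U f" shows "f ` round_circle c n R = round_circle (f c) (U n) (\<mu> * R)"
  by (rule similarity_image_eqI[OF f])
     (use similarity_pos[OF f] in \<open>simp add: round_circle_def similarity_diff[OF f] similarity_norm[OF f]\<close>)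

lemma similarity_solid_torus:
  assumes f: "similarity \<mu> U f" shows "f ` solid_torus c n R r = solid_torus (f c) (U n) (\<mu> * R) (\<mu> * r)"
  unfolding solid_torus_def image_UN similarity_cball[OF f] similarity_round_circle[OF f, symmetric] by auto

lemma similarity_circle_path:
  assumes f: "similarity \<mu> U f" shows "f (circle_path c R u v t) = circle_path (f c) (\<mu> * R) (U u) (U v) t"
proof -
  note U = similarity_linear[OF f]
  have "f (circle_path c R u v t) - f c = \<mu> *\<^sub>R U (R *\<^sub>R (cos (2 * pi * t) *\<^sub>R u + sin (2 * pi * t) *\<^sub>R v))"
    unfolding similarity_diff[OF f] by (simp add: circle_path_def)
  then have "f (circle_path c R u v t) = f c + \<mu> *\<^sub>R U (R *\<^sub>R (cos (2 * pi * t) *\<^sub>R u + sin (2 * pi * t) *\<^sub>R v))"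
    by (metis add.commute diff_add_cancel)
  then show ?thesis by (simp add: circle_path_def linear_cmul[OF U] linear_add[OF U])
qed

section \<open>Position of a link relative to its neighbour\<close>

lemma link_rot_radial: "link_rot k (radial l) = cos (chain_angle l) *\<^sub>R tangent k + sin (chain_angle l) *\<^sub>R link_second k"
  by (simp add: link_rot_def radial_def inner_add_left)

text \<open>The number 8000 is half of \<open>chain_q\<close>. Renumbering by l -> 8000 - l reverses
  the first vector of a link frame and keeps the second.\<close>

lemma chain_angle_half: "cos (chain_angle (8000 - l)) = - cos (chain_angle l)" "sin (chain_angle (8000 - l)) = sin (chain_angle l)"
proof -
  have "chain_angle (8000 - l) = pi - chain_angle l" by (simp add: chain_angle_def chain_q_def field_simps)
  then show "cos (chain_angle (8000 - l)) = - cos (chain_angle l)" "sin (chain_angle (8000 - l)) = sin (chain_angle l)" by simp_all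
qed

lemma one_minus_cos_le:
  fixes x :: real
  assumes "0 \<le> x" "x \<le> 1" shows "\<bar>cos x - 1\<bar> \<le> x" "\<bar>sin x\<bar> \<le> x"
proof -
  have "x \<le> pi / 2" using assms pi_ge_two by linarith
  then have s: "0 \<le> sin x" "0 \<le> cos x" using assms by (auto intro!: sin_ge_zero cos_ge_zero)
  have sx: "sin x \<le> x" using assms by (simp add: sin_x_le_x)
  then show "\<bar>sin x\<bar> \<le> x" using s by simp
  have "(1 - cos x) * (1 + cos x) = sin x * sin x"
    using sin_cos_squared_add[of x] by (simp add: algebra_simps power2_eq_square)
  moreover have "(1 - cos x) * 1 \<le> (1 - cos x) * (1 + cos x)" using s by (intro mult_left_mono) auto
  moreover have "sin x * sin x \<le> 1 * sin x" using s sin_le_one by (intro mult_right_mono) auto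
  ultimately have "1 - cos x \<le> x" using sx by simp
  then show "\<bar>cos x - 1\<bar> \<le> x" using cos_le_one[of x] by simp
qed

text \<open>Double-angle formulas factor the displacement exactly: its deviation from 3/2 \<rho>
  times the tangent is 3/2 \<rho> times a vector with components - sin h and cos h - 1, where h is
  the half step and hence below 1/4000.\<close>

lemma neighbour_center:
  assumes s: "s = 1 \<or> s = (-1::int)"
  shows "norm (radial (k + s) - radial k - chain_ratio *\<^sub>R ((3/2) *\<^sub>R (of_int s *\<^sub>R tangent k))) \<le> (1/1000) * chain_ratio"
proof -
  let ?h = half_step
  have ca: "cos (chain_angle s) = cos (2 * ?h)" "sin (chain_angle s) = of_int s * sin (2 * ?h)"
    using s chain_angle_1 by auto
  have "radial (k + s) - radial k - chain_ratio *\<^sub>R ((3/2) *\<^sub>R (of_int s *\<^sub>R tangent k)) =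
    (cos (2 * ?h) - 1) *\<^sub>R radial k + (sin (2 * ?h) - 3/2 * chain_ratio) *\<^sub>R (of_int s *\<^sub>R tangent k)"
    unfolding radial_add ca by (simp add: algebra_simps)
  also have "cos (2 * ?h) - 1 = (3/2 * chain_ratio) * - sin ?h"
    by (simp add: cos_double_sin chain_ratio_def power2_eq_square)
  also have "sin (2 * ?h) - 3/2 * chain_ratio = (3/2 * chain_ratio) * (cos ?h - 1)"
    unfolding sin_double chain_ratio_def by (simp add: algebra_simps)
  also have "((3/2 * chain_ratio) * - sin ?h) *\<^sub>R radial k + ((3/2 * chain_ratio) * (cos ?h - 1)) *\<^sub>R (of_int s *\<^sub>R tangent k)
    = (3/2 * chain_ratio) *\<^sub>R (- sin ?h *\<^sub>R radial k + (cos ?h - 1) *\<^sub>R (of_int s *\<^sub>R tangent k))"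
    by (simp only: scaleR_add_right scaleR_scaleR mult.assoc)
  finally have e: "radial (k + s) - radial k - chain_ratio *\<^sub>R ((3/2) *\<^sub>R (of_int s *\<^sub>R tangent k)) =
    (3/2 * chain_ratio) *\<^sub>R (- sin ?h *\<^sub>R radial k + (cos ?h - 1) *\<^sub>R (of_int s *\<^sub>R tangent k))" .
  have "norm (- sin ?h *\<^sub>R radial k + (cos ?h - 1) *\<^sub>R (of_int s *\<^sub>R tangent k)) \<le> \<bar>sin ?h\<bar> + \<bar>cos ?h - 1\<bar>"
    using s by (intro norm_triangle_le) auto
  also have "\<dots> \<le> 2 * ?h" using one_minus_cos_le[of ?h] half_step by simp
  also have "\<dots> \<le> 1/2000" using half_step by simp
  finally have "3/2 * chain_ratio * norm (- sin ?h *\<^sub>R radial k + (cos ?h - 1) *\<^sub>R (of_int s *\<^sub>R tangent k)) \<le> 3/2 * chain_ratio * (1/2000)"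
    using chain_ratio by (intro mult_left_mono) auto
  then show ?thesis unfolding e using chain_ratio by simp
qed

lemma neighbour_tangent:
  assumes s: "s = 1 \<or> s = (-1::int)"
  shows "norm (tangent (k + s) - tangent k) \<le> 1/1000"
proof -
  let ?h = half_step
  have ca: "cos (chain_angle s) = cos (2 * ?h)" "sin (chain_angle s) = of_int s * sin (2 * ?h)"
    using s chain_angle_1 by auto
  have e: "tangent (k + s) - tangent k = (cos (2 * ?h) - 1) *\<^sub>R tangent k - (of_int s * sin (2 * ?h)) *\<^sub>R radial k"
    unfolding radial_add ca by (simp add: algebra_simps)
  have "norm (tangent (k + s) - tangent k) \<le> \<bar>cos (2 * ?h) - 1\<bar> + \<bar>sin (2 * ?h)\<bar>"
    unfolding e using s by (intro norm_triangle_le_diff) (auto simp: abs_mult)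
  also have "\<dots> \<le> 2 * (2 * ?h)" using one_minus_cos_le[of "2 * ?h"] half_step by simp
  also have "\<dots> \<le> 1/1000" using half_step by simp
  finally show ?thesis .
qed

section \<open>Passing the shadow property from one stage to the next\<close>

lemma flatten_similarity:
  assumes f: "similarity \<mu> U f"
  shows "flatten (U d) (f x) = flatten (U d) (f 0) + \<mu> *\<^sub>R U (flatten d x)"
proof -
  note U = similarity_linear[OF f]
  have "flatten (U d) (f x) = flatten (U d) (f 0) + flatten (U d) (\<mu> *\<^sub>R U x)"
    unfolding similarity_apply[OF f, of x] by (rule linear_add[OF linear_flatten])
  also have "flatten (U d) (\<mu> *\<^sub>R U x) = \<mu> *\<^sub>R U (flatten d x)"
    by (simp add: flatten_def similarity_norm(2)[OF f] linear_diff[OF U] linear_cmul[OF U] algebra_simps)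
  finally show ?thesis .
qed

lemma similarity_direction:
  assumes f: "similarity \<mu> U f" and d: "norm d = 1" obtains d' where "norm d' = 1" "d = U d'"
proof -
  have "surj U" using similarity_orthogonal[OF f] by (rule orthogonal_transformation_surj)
  from surjD[OF this, of d] obtain d' where "d = U d'" by blast
  then show thesis using that[of d'] d similarity_norm(1)[OF f, of d'] by simp
qed

text \<open>Seen along d, the similar copy looks like N seen along the direction d' with d = U d'.
  This is why the hypothesis on N ranges over all unit directions.\<close>

lemma path_connected_flatten_similarity:
  assumes f: "similarity \<mu> U f" and d: "norm d = 1" and N: "\<And>d. norm d = 1 \<Longrightarrow> path_connected (flatten d ` N)"
  shows "path_connected (flatten d ` f ` N)"
proof -
  obtain d' where d': "norm d' = 1" "d = U d'" using similarity_direction[OF f d] .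
  have "flatten d ` f ` N = (\<lambda>x. flatten d (f 0) + \<mu> *\<^sub>R U x) ` flatten d' ` N"
    unfolding d'(2) image_image flatten_similarity[OF f, symmetric] ..
  moreover have "continuous_on S (\<lambda>x. flatten d (f 0) + \<mu> *\<^sub>R U x)" for S
    by (intro continuous_intros linear_continuous_on linear_conv_bounded_linear[THEN iffD1] similarity_linear[OF f])
  ultimately show ?thesis using path_connected_continuous_image N d' by metis
qed

lemma flatten_meet_similarity:
  assumes f: "similarity \<mu> U f" and d: "norm d = 1" and N: "\<And>d. norm d = 1 \<Longrightarrow> flatten d ` N \<inter> flatten d ` N' \<noteq> {}"
  shows "flatten d ` f ` N \<inter> flatten d ` f ` N' \<noteq> {}"
proof -
  obtain d' where d': "norm d' = 1" "d = U d'" using similarity_direction[OF f d] .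
  obtain x y where xy: "x \<in> N" "y \<in> N'" "flatten d' x = flatten d' y" using N[OF d'(1)] by blast
  then have "flatten d (f x) = flatten d (f y)"
    unfolding d'(2) flatten_similarity[OF f, of d' x] flatten_similarity[OF f, of d' y] by simp
  then show ?thesis using xy by blast
qed

text \<open>The induction invariant. Besides connected shadows it records that neighbouring copies
  of N inside a chain have meeting shadows, which is the form in which the next stage consumes
  it.\<close>

definition shadow_linked :: "(real^3) set \<Rightarrow> bool" where
  "shadow_linked N \<longleftrightarrow> N \<noteq> {} \<and> N \<subseteq> cball 0 (101/100) \<and>
    (\<forall>d. norm d = 1 \<longrightarrow> path_connected (flatten d ` N) \<and>
      (\<forall>k. flatten d ` link_map k ` N \<inter> flatten d ` link_map (k + 1) ` N \<noteq> {}))"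

text \<open>The union runs over all integers although the maps have period \<open>chain_q\<close>,
  so that the closing neighbours of the chain need no separate treatment.\<close>

definition chain_step :: "(real^3) set \<Rightarrow> (real^3) set" where
  "chain_step N = (\<Union>l. link_map l ` N)"

lemma link_map_mod: "link_map (k mod int chain_q) = link_map k"
proof -
  have "link_map (k + int chain_q * j) = link_map k" for j :: nat and k
  proof (induction j)
    case (Suc j)
    then show ?case using link_map_periodic[of "k + int chain_q * j"] by (simp add: algebra_simps)
  qed simp
  note p = this
  have q: "int chain_q > 0" by (simp add: chain_q_def)
  show ?thesis
  proof (cases "k div int chain_q \<ge> 0")
    case True
    then show ?thesis using p[of "k mod int chain_q" "nat (k div int chain_q)"] by simp
  next
    case False
    have "k + int chain_q * (- (k div int chain_q)) = k mod int chain_q" by (simp add: minus_mult_div_eq_mod)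
    then show ?thesis using p[of k "nat (- (k div int chain_q))"] False by simp
  qed
qed

lemma chain_step_finite: "chain_step N = (\<Union>k<chain_q. link_map (int k) ` N)"
proof -
  have "link_map l ` N \<subseteq> (\<Union>k<chain_q. link_map (int k) ` N)" for l
  proof -
    have q: "int chain_q > 0" by (simp add: chain_q_def)
    define k where "k = nat (l mod int chain_q)"
    have "k < chain_q" "int k = l mod int chain_q" using q by (auto simp: k_def nat_less_iff)
    then show ?thesis using link_map_mod[of l] by (metis UN_upper lessThan_iff)
  qed
  then show ?thesis unfolding chain_step_def by blast
qed

lemma link_map_0: "link_map k 0 = radial k"
  by (simp add: link_map_def link_rot_def)

lemma link_map_cball: "link_map k ` cball 0 r = cball (radial k) (chain_ratio * r)"
  unfolding similarity_cball[OF similarity_link_map] link_map_0 ..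

lemma chain_step_bound:
  assumes "N \<subseteq> cball 0 (101/100)" shows "chain_step N \<subseteq> cball 0 (101/100)"
proof -
  have "link_map l ` N \<subseteq> cball 0 (101/100)" for l
  proof -
    have "link_map l ` N \<subseteq> cball (radial l) (chain_ratio * (101/100))"
      using assms image_mono link_map_cball by metis
    also have "\<dots> \<subseteq> cball 0 (101/100)" using chain_ratio by (subst cball_subset_cball_iff) simp
    finally show ?thesis .
  qed
  then show ?thesis unfolding chain_step_def by blast
qed

text \<open>Connectedness of the next shadow is immediate from the meeting of neighbours. For the
  meeting itself, each of two neighbouring links is resolved into its own chain of copies of N;
  these are tiny against the link and follow its central circle closely enough for
  \<open>crossing_chains\<close>.\<close>

lemma shadow_linked_step:
  assumes N: "shadow_linked N" shows "shadow_linked (chain_step N)"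
  unfolding shadow_linked_def
proof (intro conjI allI impI)
  have ne: "N \<noteq> {}" and bd: "N \<subseteq> cball 0 (101/100)" and pc: "\<And>d. norm d = 1 \<Longrightarrow> path_connected (flatten d ` N)"
    and ov: "\<And>d k. norm d = 1 \<Longrightarrow> flatten d ` link_map k ` N \<inter> flatten d ` link_map (k + 1) ` N \<noteq> {}"
    using N by (auto simp: shadow_linked_def)
  show "chain_step N \<noteq> {}" using ne by (auto simp: chain_step_def)
  show "chain_step N \<subseteq> cball 0 (101/100)" by (rule chain_step_bound[OF bd])
  fix d :: "real^3" assume d: "norm d = 1"
  have e: "chain_step N = (\<Union>l\<in>{0..0 + int (chain_q - 1)}. link_map l ` N)"
  proof -
    have "(\<Union>k<chain_q. link_map (int k) ` N) \<subseteq> (\<Union>l\<in>{0..0 + int (chain_q - 1)}. link_map l ` N)"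
      by (intro UN_least UN_upper) auto
    then have "chain_step N \<subseteq> (\<Union>l\<in>{0..0 + int (chain_q - 1)}. link_map l ` N)" unfolding chain_step_finite .
    moreover have "(\<Union>l\<in>{0..0 + int (chain_q - 1)}. link_map l ` N) \<subseteq> chain_step N" unfolding chain_step_def by blast
    ultimately show ?thesis by (rule subset_antisym)
  qed
  show "path_connected (flatten d ` chain_step N)" unfolding e
  proof (rule path_connected_flatten_chain[where X = "\<lambda>l. link_map l ` N"])
    show "path_connected (flatten d ` link_map l ` N)" for l
      by (rule path_connected_flatten_similarity[OF similarity_link_map d]) (rule pc)
    show "flatten d ` link_map l ` N \<inter> flatten d ` link_map (l + 1) ` N \<noteq> {}" for l
      by (rule ov[OF d])
  qed
  fix k :: int
  \<comment> \<open>The horizontal link always comes first and s tells on which side the vertical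
    one lies; an odd k is treated as the even k + 1 with s = -1.\<close>
  have adj: "flatten d ` link_map H ` chain_step N \<inter> flatten d ` link_map (H + s) ` chain_step N \<noteq> {}"
    if H: "even H" and s: "s = 1 \<or> s = -1" for H s
  proof -
    \<comment> \<open>Chooses the numbering so that index 0 of either chain faces the other link:
      direction ?e on the link H, nearly - ?e on its neighbour.\<close>
    define idx where "idx t l = (if t = 1 then l else 8000 - l)" for t l :: int
    have idx: "idx t (l + 1) = idx t l + 1 \<or> idx t l = idx t (l + 1) + 1" for t l by (auto simp: idx_def)
    have ci: "cos (chain_angle (idx t l)) = of_int t * cos (chain_angle l)" "sin (chain_angle (idx t l)) = sin (chain_angle l)"
      if "t = 1 \<or> t = -1" for t l using that by (auto simp: idx_def chain_angle_half)
    define X where "X l = link_map H ` link_map (idx s l) ` N" for l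
    define Y where "Y l = link_map (H + s) ` link_map (idx (- s) l) ` N" for l
    have s': "- s = 1 \<or> - s = -1" using s by auto
    let ?e = "of_int s *\<^sub>R tangent H"
    have V: "link_second (H + s) = e3" "link_second H = radial H" using H s by (auto simp: link_second_def)
    \<comment> \<open>Two contractions leave a copy of size 101/100 times the square of
      \<open>chain_ratio\<close>; relative to the link radius it is almost a point of the
      circle.\<close>
    have near: "norm (link_map j p - radial j - chain_ratio *\<^sub>R link_rot j (radial m)) \<le> (1/2000) * chain_ratio"
      if p: "p \<in> link_map m ` N" for j m p
    proof -
      have "p \<in> cball (radial m) (chain_ratio * (101/100))" using p bd link_map_cball image_mono by blast
      then have n: "norm (p - radial m) \<le> chain_ratio * (101/100)" by (simp add: dist_norm norm_minus_commute)
      have "link_map j p - radial j - chain_ratio *\<^sub>R link_rot j (radial m) = chain_ratio *\<^sub>R link_rot j (p - radial m)"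
        by (simp add: link_map_def linear_diff[OF similarity_linear[OF similarity_link_map]] scaleR_diff_right)
      then have "norm (link_map j p - radial j - chain_ratio *\<^sub>R link_rot j (radial m)) = chain_ratio * norm (p - radial m)"
        using chain_ratio similarity_norm(1)[OF similarity_link_map] by simp
      also have "\<dots> \<le> chain_ratio * (1/2000)" using n chain_ratio by (intro mult_left_mono) auto
      finally show ?thesis by simp
    qed
    have "\<exists>l l'. flatten d ` X l \<inter> flatten d ` Y l' \<noteq> {}"
    proof (rule crossing_chains[where q = chain_q and m = 2000 and e = ?e and y = "radial H" and z = e3 and s = chain_ratio and c = "radial H"])
      fix l p assume "p \<in> X l"
      then obtain p1 where p1: "p = link_map H p1" "p1 \<in> link_map (idx s l) ` N" by (auto simp: X_def)
      have "link_rot H (radial (idx s l)) = circle_point ?e (radial H) (2 * pi * real_of_int l / real chain_q)"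
        unfolding link_rot_radial V ci[OF s] circle_point_def chain_angle_def[symmetric] by simp
      then show "norm (p - radial H - chain_ratio *\<^sub>R circle_point ?e (radial H) (2 * pi * real_of_int l / real chain_q)) \<le> 1 / 300 * chain_ratio"
        using near[OF p1(2), of H] chain_ratio p1(1) by simp
    next
      fix l p assume "p \<in> Y l"
      then obtain p1 where p1: "p = link_map (H + s) p1" "p1 \<in> link_map (idx (- s) l) ` N" by (auto simp: Y_def)
      let ?t = "of_int s *\<^sub>R tangent (H + s)"
      have r: "link_rot (H + s) (radial (idx (- s) l)) = - cos (chain_angle l) *\<^sub>R ?t + sin (chain_angle l) *\<^sub>R e3"
        unfolding link_rot_radial V ci[OF s'] by simp
      \<comment> \<open>Three errors are added: the size of the small copy, the deviation of the
        neighbour's centre from 3/2 ?e, and the turning of the tangent. Their bounds 1/2000, 1/1000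
        and 1/1000 sum to less than 1/300.\<close>
      define a where "a = p - radial (H + s) - chain_ratio *\<^sub>R link_rot (H + s) (radial (idx (- s) l))"
      define b where "b = radial (H + s) - radial H - chain_ratio *\<^sub>R ((3/2) *\<^sub>R ?e)"
      define c where "c = chain_ratio *\<^sub>R (- cos (chain_angle l) *\<^sub>R (?t - ?e))"
      have na: "norm a \<le> (1/2000) * chain_ratio" using near[OF p1(2), of "H + s"] p1(1) by (simp add: a_def)
      have nb: "norm b \<le> (1/1000) * chain_ratio" unfolding b_def by (rule neighbour_center[OF s])
      have nc: "norm c \<le> chain_ratio * (1/1000)"
      proof -
        have "norm (?t - ?e) \<le> 1/1000" using neighbour_tangent[OF s, of H] s by (auto simp: norm_minus_commute)
        then have "\<bar>cos (chain_angle l)\<bar> * norm (?t - ?e) \<le> 1 * (1/1000)" by (intro mult_mono) auto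
        then have "chain_ratio * (\<bar>cos (chain_angle l)\<bar> * norm (?t - ?e)) \<le> chain_ratio * (1 * (1/1000))"
          using chain_ratio by (intro mult_left_mono) auto
        then show ?thesis unfolding c_def using chain_ratio by (simp add: abs_mult)
      qed
      have "p - radial H - chain_ratio *\<^sub>R ((3/2) *\<^sub>R ?e + circle_point (- ?e) e3 (chain_angle l)) = a + b + c"
        unfolding a_def b_def c_def r circle_point_def by (simp add: algebra_simps)
      moreover have "norm (a + b + c) \<le> norm a + norm b + norm c" by (meson norm_triangle_ineq norm_triangle_mono order_refl order_trans add_right_mono)
      ultimately show "norm (p - radial H - chain_ratio *\<^sub>R ((3/2) *\<^sub>R ?e + circle_point (- ?e) e3 (2 * pi * real_of_int l / real chain_q))) \<le> 1 / 300 * chain_ratio"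
        using na nb nc chain_ratio unfolding chain_angle_def by simp
    next
      have pc2: "path_connected (flatten d ` link_map j ` link_map m ` N)" for j m
        by (rule path_connected_flatten_similarity[OF similarity_link_map d], rule path_connected_flatten_similarity[OF similarity_link_map], assumption, rule pc)
      then show "path_connected (flatten d ` X l)" "path_connected (flatten d ` Y l)" for l by (simp_all add: X_def Y_def)
      have ov2: "flatten d ` link_map j ` link_map m ` N \<inter> flatten d ` link_map j ` link_map m' ` N \<noteq> {}"
        if "m' = m + 1 \<or> m = m' + 1" for j m m'
      proof (rule flatten_meet_similarity[OF similarity_link_map d])
        fix d' :: "real^3" assume "norm d' = 1"
        then show "flatten d' ` link_map m ` N \<inter> flatten d' ` link_map m' ` N \<noteq> {}"
          using that ov[of d' m] ov[of d' m'] by blast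
      qed
      show "flatten d ` X l \<inter> flatten d ` X (l + 1) \<noteq> {}" "flatten d ` Y l \<inter> flatten d ` Y (l + 1) \<noteq> {}" for l
        unfolding X_def Y_def by (intro ov2 idx)+
      show "X l \<noteq> {}" "Y l \<noteq> {}" for l using ne by (simp_all add: X_def Y_def)
      show "norm ?e = 1" using s by auto
    qed (use d s chain_ratio in \<open>auto simp: chain_q_def\<close>)
    then obtain l l' where ll: "flatten d ` X l \<inter> flatten d ` Y l' \<noteq> {}" by blast
    have "X l \<subseteq> link_map H ` chain_step N" "Y l' \<subseteq> link_map (H + s) ` chain_step N"
      unfolding X_def Y_def chain_step_def by blast+
    then show ?thesis using ll by blast
  qed
  show "flatten d ` link_map k ` chain_step N \<inter> flatten d ` link_map (k + 1) ` chain_step N \<noteq> {}"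
  proof (cases "even k")
    case True
    then show ?thesis using adj[of k 1] by simp
  next
    case False
    then show ?thesis using adj[of "k + 1" "-1"] by (auto simp: Int_commute)
  qed
qed

text \<open>The start is a ball, whose shadows are convex. Neighbouring balls share the midpoint of
  their centres, these being at most 16/10 link radii apart.\<close>

lemma shadow_linked_cball: "shadow_linked (cball 0 (101/100))"
  unfolding shadow_linked_def
proof (intro conjI allI impI)
  fix d :: "real^3" and k :: int assume d: "norm d = 1"
  show "path_connected (flatten d ` cball 0 (101/100))"
    by (intro convex_imp_path_connected convex_linear_image linear_flatten) simp
  let ?x = "radial k + (1/2) *\<^sub>R (radial (k + 1) - radial k)"
  have "norm (radial (k + 1) - radial k) \<le> 16/10 * chain_ratio"
  proof -
    let ?w = "chain_ratio *\<^sub>R ((3/2) *\<^sub>R tangent k)"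
    have "norm ((radial (k + 1) - radial k - ?w) + ?w) \<le> norm (radial (k + 1) - radial k - ?w) + norm ?w" by (rule norm_triangle_ineq)
    then show ?thesis using neighbour_center[of 1 k] chain_ratio by simp
  qed
  then have "?x \<in> cball (radial k) (chain_ratio * (101/100))" "?x \<in> cball (radial (k + 1)) (chain_ratio * (101/100))"
  proof -
    assume a: "norm (radial (k + 1) - radial k) \<le> 16/10 * chain_ratio"
    show "?x \<in> cball (radial k) (chain_ratio * (101/100))" using a chain_ratio by (simp add: dist_norm)
    have e: "radial (k + 1) - ?x = (1/2) *\<^sub>R (radial (k + 1) - radial k)" by (simp add: vec_eq_iff field_simps)
    have "dist (radial (k + 1)) ?x = 1/2 * norm (radial (k + 1) - radial k)" unfolding dist_norm e by simp
    then show "?x \<in> cball (radial (k + 1)) (chain_ratio * (101/100))" using a chain_ratio unfolding mem_cball by simp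
  qed
  then show "flatten d ` link_map k ` cball 0 (101/100) \<inter> flatten d ` link_map (k + 1) ` cball 0 (101/100) \<noteq> {}"
    unfolding link_map_cball by blast
qed auto

section \<open>Disjointness and linking of the tori in a chain\<close>

definition core_torus :: "(real^3) set" where "core_torus = solid_torus 0 e3 1 (1/100)"

lemma core_torus_subset: "core_torus \<subseteq> cball 0 (101/100)"
  unfolding core_torus_def using solid_torus_farthest(1)[of "1/100" 1 _ 0 e3] by (auto simp: dist_norm)

lemma radial_in_circle: "radial k \<in> round_circle 0 e3 1"
  by (simp add: round_circle_def)

text \<open>A link fits into a ball around its vertex that still lies in the big torus. This one
  ball yields both containment in the interior and, by convexity, contractibility of the central
  circle of the link.\<close>

lemma link_map_core_subset: "link_map k ` core_torus \<subseteq> ball (radial k) (1/100)" "ball (radial k) (1/100) \<subseteq> core_torus"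
proof -
  have "link_map k ` core_torus \<subseteq> cball (radial k) (chain_ratio * (101/100))"
    using core_torus_subset link_map_cball image_mono by metis
  also have "\<dots> \<subseteq> ball (radial k) (1/100)" using chain_ratio by (auto simp: cball_subset_ball_iff)
  finally show "link_map k ` core_torus \<subseteq> ball (radial k) (1/100)" .
  show "ball (radial k) (1/100) \<subseteq> core_torus"
    unfolding core_torus_def solid_torus_def using radial_in_circle[of k] ball_subset_cball by blast
qed

lemma link_rot_e3: "link_rot k e3 = link_normal k"
  by (simp add: link_rot_def)

lemma link_map_core: "link_map k ` core_torus = solid_torus (radial k) (link_normal k) chain_ratio (chain_ratio / 100)"
  unfolding core_torus_def similarity_solid_torus[OF similarity_link_map] link_map_0 link_rot_e3 by simp

text \<open>The chord over n steps is 2 |sin (n h)|, and away from the neighbours it is smallest for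
  n = 2, where it equals 3 \<open>chain_ratio\<close> cos h. Anything above twice the link radius
  separates the links.\<close>

lemma radial_dist_far:
  assumes n: "2 \<le> \<bar>n\<bar>" "\<bar>n\<bar> \<le> int chain_q - 2"
  shows "norm (radial (k + n) - radial k) \<ge> 29/10 * chain_ratio"
proof -
  let ?h = half_step
  define x where "x = real_of_int \<bar>n\<bar> * ?h"
  have qh: "real chain_q * ?h = pi" by (simp add: half_step_def chain_q_def)
  have "2 \<le> real_of_int \<bar>n\<bar>" "real_of_int \<bar>n\<bar> \<le> real chain_q - 2" using n by linarith+
  then have "2 * ?h \<le> x" "x \<le> (real chain_q - 2) * ?h" unfolding x_def using half_step by (intro mult_right_mono; simp)+
  then have x: "2 * ?h \<le> x" "x \<le> pi - 2 * ?h" using qh by (simp_all add: algebra_simps)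
  have h2: "2 * ?h \<le> pi / 2" using half_step pi_ge_two by linarith
  \<comment> \<open>On [2 h, pi - 2 h] the sine is smallest at the end points, which take equal
    values.\<close>
  have sx: "sin x \<ge> sin (2 * ?h)"
  proof (cases "x \<le> pi / 2")
    case True
    then show ?thesis using x half_step h2 by (intro sin_monotone_2pi_le) auto
  next
    case False
    then have "sin (2 * ?h) \<le> sin (pi - x)" using x half_step h2 by (intro sin_monotone_2pi_le) auto
    then show ?thesis by simp
  qed
  have ang: "chain_angle n = 2 * (real_of_int n * ?h)" by (simp add: chain_angle_def half_step_def)
  have "norm (radial (k + n) - radial k) ^ 2 = (2 * sin (real_of_int n * ?h))\<^sup>2"
  proof -
    have "radial (k + n) - radial k = (cos (chain_angle n) - 1) *\<^sub>R radial k + sin (chain_angle n) *\<^sub>R tangent k"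
      unfolding radial_add by (simp add: algebra_simps)
    then have "norm (radial (k + n) - radial k) ^ 2 = (cos (chain_angle n) - 1)\<^sup>2 + (sin (chain_angle n))\<^sup>2"
      using norm_orthonormal_comb[of "radial k" "tangent k"] by simp
    also have "\<dots> = 2 - 2 * cos (chain_angle n)"
      using sin_cos_squared_add[of "chain_angle n"] by (simp add: power2_eq_square algebra_simps)
    also have "\<dots> = (2 * sin (real_of_int n * ?h))\<^sup>2"
      unfolding ang cos_double_sin by (simp add: power2_eq_square)
    finally show ?thesis .
  qed
  then have "norm (radial (k + n) - radial k) = \<bar>2 * sin (real_of_int n * ?h)\<bar>"
    by (metis abs_norm_cancel power2_eq_iff_nonneg abs_ge_zero power2_abs)
  also have "\<bar>2 * sin (real_of_int n * ?h)\<bar> = \<bar>2 * sin x\<bar>" unfolding x_def by (cases "n \<ge> 0") (auto simp: abs_mult)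
  finally have "norm (radial (k + n) - radial k) \<ge> 2 * sin (2 * ?h)" using sx by simp
  moreover have "2 * sin (2 * ?h) = 3 * chain_ratio * cos ?h" unfolding sin_double chain_ratio_def by simp
  moreover have "3 * chain_ratio * cos ?h \<ge> 3 * chain_ratio * (29/30)"
    using one_minus_cos_le(1)[of ?h] half_step chain_ratio by (intro mult_left_mono) auto
  ultimately show ?thesis by simp
qed

text \<open>In the exact model of perpendicular circles with centres 3/2 radii apart the smallest
  distance is 1/2 radius; the bound 1/4 absorbs the displacement of the centre and the turning of
  the tangent.\<close>

lemma neighbour_circles_far:
  assumes H: "even H" and s: "s = 1 \<or> s = (-1::int)"
    and x: "x \<in> round_circle (radial H) (link_normal H) chain_ratio"
    and y: "y \<in> round_circle (radial (H + s)) (link_normal (H + s)) chain_ratio"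
  shows "norm (x - y) \<ge> chain_ratio / 4"
proof -
  let ?e = "of_int s *\<^sub>R tangent H" and ?t = "of_int s *\<^sub>R tangent (H + s)"
  have V: "link_normal H = e3" "link_normal (H + s) = radial (H + s)" using H s by (auto simp: link_normal_def)
  obtain a where a: "x = radial H + chain_ratio *\<^sub>R (cos a *\<^sub>R ?e + sin a *\<^sub>R radial H)"
    using x mem_round_circle_iff(1)[of ?e "radial H" e3 chain_ratio x "radial H"] s chain_ratio unfolding V by auto
  obtain b where b: "y = radial (H + s) + chain_ratio *\<^sub>R (cos b *\<^sub>R ?t + sin b *\<^sub>R e3)"
    using y mem_round_circle_iff(1)[of ?t e3 "radial (H + s)" chain_ratio y "radial (H + s)"] s chain_ratio unfolding V by auto
  define w where "w = (cos a - 3/2 - cos b) *\<^sub>R ?e + sin a *\<^sub>R radial H + (- sin b) *\<^sub>R e3"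
  define p where "p = radial (H + s) - radial H - chain_ratio *\<^sub>R ((3/2) *\<^sub>R ?e)"
  define r where "r = chain_ratio *\<^sub>R (cos b *\<^sub>R (?t - ?e))"
  have e: "x - y = chain_ratio *\<^sub>R w - (p + r)"
    unfolding a b w_def p_def r_def by (simp add: algebra_simps)
  have np: "norm p \<le> (1/1000) * chain_ratio" unfolding p_def by (rule neighbour_center[OF s])
  have nr: "norm r \<le> chain_ratio * (1/1000)"
  proof -
    have "norm (?t - ?e) \<le> 1/1000" using neighbour_tangent[OF s, of H] s by (auto simp: norm_minus_commute)
    then have "\<bar>cos b\<bar> * norm (?t - ?e) \<le> 1 * (1/1000)" by (intro mult_mono) auto
    then have "chain_ratio * (\<bar>cos b\<bar> * norm (?t - ?e)) \<le> chain_ratio * (1 * (1/1000))"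
      using chain_ratio by (intro mult_left_mono) auto
    then show ?thesis unfolding r_def using chain_ratio by (simp add: abs_mult)
  qed
  have "norm w ^ 2 = (cos a - 3/2 - cos b)\<^sup>2 + (sin a)\<^sup>2 + (sin b)\<^sup>2"
    unfolding power2_norm_eq_inner w_def using s
    by (auto simp: inner_add_left inner_add_right inner_diff_left inner_diff_right power2_eq_square)
  also have "\<dots> = 17/4 - 3 * cos a + 3 * cos b - 2 * cos a * cos b"
    unfolding sin_squared_eq by (simp add: power2_eq_square algebra_simps)
  \<comment> \<open>Grouped so that the remaining terms are visibly nonnegative.\<close>
  also have "\<dots> = 1/4 + (1 - cos a) * (3 + 2 * cos b) + (1 + cos b)"
    by (simp add: algebra_simps)
  also have "\<dots> \<ge> 1/4"
  proof -
    have "(1 - cos a) * (3 + 2 * cos b) \<ge> 0" using cos_ge_minus_one[of b] cos_le_one[of a] by (intro mult_nonneg_nonneg) linarith+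
    then show ?thesis using cos_ge_minus_one[of b] by linarith
  qed
  finally have "(1/2)\<^sup>2 \<le> norm w ^ 2" by (simp add: power2_eq_square)
  then have nw: "1/2 \<le> norm w" by (rule power2_le_imp_le) simp
  have "norm (chain_ratio *\<^sub>R w) - norm (p + r) \<le> norm (x - y)" unfolding e by (rule norm_triangle_ineq2)
  moreover have "norm (p + r) \<le> norm p + norm r" by (rule norm_triangle_ineq)
  moreover have "norm (chain_ratio *\<^sub>R w) \<ge> chain_ratio * (1/2)" using nw chain_ratio by simp
  ultimately show ?thesis using np nr chain_ratio by linarith
qed

text \<open>Absorbs the wrap-around of the index range: in the adjacent case the data of link j are
  those of index i + s, also when i and j are 1 and \<open>chain_q\<close>.\<close>

lemma neighbours_cases:
  assumes i: "i \<in> {1..chain_q}" "j \<in> {1..chain_q}" "i \<noteq> j"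
  obtains (adj) s where "s = 1 \<or> s = -1" "link_map (int j) = link_map (int i + s)" "radial (int j) = radial (int i + s)"
      "link_normal (int j) = link_normal (int i + s)"
      "[int i - int j = 1] (mod int chain_q) \<or> [int i - int j = - 1] (mod int chain_q)"
  | (far) "2 \<le> \<bar>int j - int i\<bar>" "\<bar>int j - int i\<bar> \<le> int chain_q - 2"
      "\<not> ([int i - int j = 1] (mod int chain_q) \<or> [int i - int j = - 1] (mod int chain_q))"
proof -
  define n where "n = int j - int i"
  have n: "n \<noteq> 0" "\<bar>n\<bar> < int chain_q" using i by (auto simp: n_def)
  have q: "int chain_q = 16000" by (simp add: chain_q_def)
  have ij: "int i - int j = - n" "int j = int i + n" by (simp_all add: n_def)
  have ev: "even (k + int chain_q) = even k" for k by (simp add: q)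
  have pn: "link_normal (k + int chain_q) = link_normal k" for k unfolding link_normal_def ev periodic_q ..
  note per = link_map_periodic periodic_q(1) pn
  consider "n = 1" | "n = -1" | "n = int chain_q - 1" | "n = 1 - int chain_q" | "2 \<le> \<bar>n\<bar>" "\<bar>n\<bar> \<le> int chain_q - 2"
    using n q by linarith
  then show thesis
  proof cases
    case 1
    then show thesis using adj[of 1] unfolding ij by (simp add: cong_def)
  next
    case 2
    then show thesis using adj[of "-1"] unfolding ij by (simp add: cong_def)
  next
    case 3
    have "k + n = (k - 1) + int chain_q" for k using 3 by simp
    then show thesis using adj[of "-1"] per[of "int i - 1"] unfolding ij using 3 by (simp add: cong_def q add.commute[of "15999"])
  next
    case 4
    have "k + 1 = (k + n) + int chain_q" for k using 4 by simp
    then show thesis using adj[of "1"] per[of "int i + n"] unfolding ij using 4 by (simp add: cong_def q add.commute[of 1])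
  next
    case 5
    have "\<not> ([- n = 1] (mod int chain_q) \<or> [- n = - 1] (mod int chain_q))"
    proof
      assume "[- n = 1] (mod int chain_q) \<or> [- n = - 1] (mod int chain_q)"
      then have "int chain_q dvd - n - 1 \<or> int chain_q dvd - n + 1" by (simp add: cong_iff_dvd_diff)
      then show False
      proof
        assume "int chain_q dvd - n - 1"
        from dvd_imp_le_int[OF _ this] show False using 5 by linarith
      next
        assume "int chain_q dvd - n + 1"
        from dvd_imp_le_int[OF _ this] show False using 5 by linarith
      qed
    qed
    then show thesis using far 5 unfolding ij(1) n_def[symmetric] by blast
  qed
qed

lemma link_circles_far:
  assumes i: "i \<in> {1..chain_q}" "j \<in> {1..chain_q}" "i \<noteq> j"
    and x: "x \<in> round_circle (radial (int i)) (link_normal (int i)) chain_ratio"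
    and y: "y \<in> round_circle (radial (int j)) (link_normal (int j)) chain_ratio"
  shows "norm (x - y) \<ge> chain_ratio / 4"
  using i
proof (cases rule: neighbours_cases)
  case (adj s)
  show ?thesis
  proof (cases "even (int i)")
    case True
    then show ?thesis using neighbour_circles_far[OF True adj(1) x] y unfolding adj by blast
  next
    case False
    have "even (int i + s)" "- s = 1 \<or> - s = -1" using adj(1) False by auto
    from neighbour_circles_far[OF this, of y x] show ?thesis
      using x y unfolding adj by (simp add: norm_minus_commute)
  qed
next
  case far
  have "norm (radial (int j) - radial (int i)) \<ge> 29/10 * chain_ratio"
    using radial_dist_far[OF far(1,2), of "int i"] by simp
  moreover have "norm (x - radial (int i)) = chain_ratio" "norm (y - radial (int j)) = chain_ratio"
    using x y by (auto simp: round_circle_def)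
  moreover have "norm (radial (int j) - radial (int i)) \<le> norm (y - radial (int j)) + norm (x - y) + norm (x - radial (int i))"
    by (smt (verit) dist_norm dist_triangle norm_minus_commute dist_commute)
  ultimately show ?thesis using chain_ratio by linarith
qed

lemma links_disjoint:
  assumes i: "i \<in> {1..chain_q}" "j \<in> {1..chain_q}" "i \<noteq> j"
  shows "link_map (int i) ` core_torus \<inter> link_map (int j) ` core_torus = {}"
proof (rule ccontr)
  assume "link_map (int i) ` core_torus \<inter> link_map (int j) ` core_torus \<noteq> {}"
  then obtain z x y where x: "x \<in> round_circle (radial (int i)) (link_normal (int i)) chain_ratio" "dist x z \<le> chain_ratio / 100"
    and y: "y \<in> round_circle (radial (int j)) (link_normal (int j)) chain_ratio" "dist y z \<le> chain_ratio / 100"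
    unfolding link_map_core solid_torus_def by auto
  have "norm (x - y) \<le> chain_ratio / 50" using dist_triangle2[of x y z] x(2) y(2) by (simp add: dist_norm)
  then show False using link_circles_far[OF i x(1) y(1)] chain_ratio by linarith
qed

lemma similarity_link_compose:
  assumes F: "similarity \<mu> U F"
  shows "similarity (\<mu> * chain_ratio) (U \<circ> link_rot k) (F \<circ> link_map k)"
  by (rule similarity_compose[OF F similarity_link_map])

lemma image_link_torus:
  assumes F: "similarity \<mu> U F"
  shows "F ` link_map k ` core_torus = solid_torus (F (radial k)) (U (link_normal k)) (\<mu> * chain_ratio) (\<mu> * chain_ratio / 100)"
  unfolding link_map_core similarity_solid_torus[OF F] by simp

lemma image_core_torus:
  assumes F: "similarity \<mu> U F"
  shows "F ` core_torus = solid_torus (F 0) (U e3) \<mu> (\<mu> / 100)"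
  unfolding core_torus_def similarity_solid_torus[OF F] by simp

lemma image_link_torus_facts:
  assumes F: "similarity \<mu> U F"
  shows "standard_solid_torus (F ` link_map k ` core_torus)"
    and "central_circle (F ` link_map k ` core_torus) = round_circle (F (radial k)) (U (link_normal k)) (\<mu> * chain_ratio)"
    and "torus_center (F ` link_map k ` core_torus) = F (radial k)"
proof -
  have n: "norm (U (link_normal k)) = 1" using similarity_norm(1)[OF F] by simp
  have r: "0 < \<mu> * chain_ratio / 100" "\<mu> * chain_ratio / 100 < \<mu> * chain_ratio"
    using similarity_pos[OF F] chain_ratio by simp_all
  show "standard_solid_torus (F ` link_map k ` core_torus)"
    "central_circle (F ` link_map k ` core_torus) = round_circle (F (radial k)) (U (link_normal k)) (\<mu> * chain_ratio)"
    "torus_center (F ` link_map k ` core_torus) = F (radial k)"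
    unfolding image_link_torus[OF F]
    using standard_solid_torus_solid_torus[OF n r] central_circle_solid_torus[OF n r] torus_center_solid_torus[OF n r] by auto
qed

lemma image_core_torus_facts:
  assumes F: "similarity \<mu> U F"
  shows "standard_solid_torus (F ` core_torus)"
    and "central_circle (F ` core_torus) = round_circle (F 0) (U e3) \<mu>"
proof -
  have n: "norm (U e3) = 1" using similarity_norm(1)[OF F] by simp
  have r: "0 < \<mu> / 100" "\<mu> / 100 < \<mu>" using similarity_pos[OF F] by simp_all
  show "standard_solid_torus (F ` core_torus)" "central_circle (F ` core_torus) = round_circle (F 0) (U e3) \<mu>"
    unfolding image_core_torus[OF F]
    using standard_solid_torus_solid_torus[OF n r] central_circle_solid_torus[OF n r] by auto
qed

text \<open>In link radii, the vertical circle meets the plane of the horizontal one at distances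
  close to 1/2 and 5/2 from the centre of the latter, one point inside and one outside. The errors
  total at most 2/1000.\<close>

lemma neighbours_linked:
  assumes F: "similarity \<mu> U F" and H: "even H" and s: "s = 1 \<or> s = (-1::int)"
  shows "linked_circles (round_circle (F (radial H)) (U (link_normal H)) (\<mu> * chain_ratio))
    (round_circle (F (radial (H + s))) (U (link_normal (H + s))) (\<mu> * chain_ratio))"
proof -
  have V: "link_normal H = e3" "link_normal (H + s) = radial (H + s)" using H s by (auto simp: link_normal_def)
  let ?t = "of_int s *\<^sub>R tangent (H + s)" and ?e = "of_int s *\<^sub>R tangent H"
  have t: "norm ?t = 1" "?t \<bullet> e3 = 0" "radial (H + s) \<bullet> ?t = 0" using s by auto
  note UN = similarity_norm[OF F] and U = similarity_linear[OF F] and \<mu> = similarity_pos[OF F]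
  let ?p = "radial (H + s) - radial H - chain_ratio *\<^sub>R ((3/2) *\<^sub>R ?e)" and ?r = "chain_ratio *\<^sub>R (?t - ?e)"
  have np: "norm ?p \<le> (1/1000) * chain_ratio" by (rule neighbour_center[OF s])
  have nr: "norm ?r \<le> (1/1000) * chain_ratio"
    using neighbour_tangent[OF s, of H] s chain_ratio by (auto simp: norm_minus_commute)
  have ne: "norm (chain_ratio *\<^sub>R ?e) = chain_ratio" using s chain_ratio by auto
  have far: "norm (radial (H + s) + chain_ratio *\<^sub>R ?t - radial H) > chain_ratio"
  proof -
    have "radial (H + s) + chain_ratio *\<^sub>R ?t - radial H = (5/2) *\<^sub>R (chain_ratio *\<^sub>R ?e) - (- ?p - ?r)"
      by (simp add: algebra_simps) (simp add: algebra_simps flip: scaleR_add_left)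
    then have "norm (radial (H + s) + chain_ratio *\<^sub>R ?t - radial H) \<ge> norm ((5/2) *\<^sub>R (chain_ratio *\<^sub>R ?e)) - norm (- ?p - ?r)"
      using norm_triangle_ineq2 by metis
    moreover have "norm (- ?p - ?r) \<le> norm ?p + norm ?r" using norm_triangle_ineq4[of "- ?p" ?r] by (simp only: norm_minus_cancel)
    moreover have "norm ((5/2) *\<^sub>R (chain_ratio *\<^sub>R ?e)) = 5/2 * chain_ratio" unfolding norm_scaleR[of "5/2"] ne by simp
    ultimately show ?thesis using np nr chain_ratio by linarith
  qed
  have near: "norm (radial (H + s) - chain_ratio *\<^sub>R ?t - radial H) < chain_ratio"
  proof -
    have e: "radial (H + s) - chain_ratio *\<^sub>R ?t - radial H = (1/2) *\<^sub>R (chain_ratio *\<^sub>R ?e) + (?p - ?r)"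
      by (simp add: algebra_simps) (simp add: algebra_simps flip: scaleR_add_left)
    have "norm (radial (H + s) - chain_ratio *\<^sub>R ?t - radial H) \<le> norm ((1/2) *\<^sub>R (chain_ratio *\<^sub>R ?e)) + norm (?p - ?r)"
      unfolding e by (rule norm_triangle_ineq)
    moreover have "norm (?p - ?r) \<le> norm ?p + norm ?r" by (rule norm_triangle_ineq4)
    moreover have "norm ((1/2) *\<^sub>R (chain_ratio *\<^sub>R ?e)) = 1/2 * chain_ratio" unfolding norm_scaleR[of "1/2"] ne by simp
    ultimately show ?thesis using np nr chain_ratio by linarith
  qed
  have FV: "F (radial (H + s)) - F (radial H) = \<mu> *\<^sub>R U (radial (H + s) - radial H)" by (rule similarity_diff[OF F])
  have e1: "F (radial (H + s)) + (\<mu> * chain_ratio) *\<^sub>R U ?t - F (radial H) = \<mu> *\<^sub>R U (radial (H + s) + chain_ratio *\<^sub>R ?t - radial H)"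
    "F (radial (H + s)) - (\<mu> * chain_ratio) *\<^sub>R U ?t - F (radial H) = \<mu> *\<^sub>R U (radial (H + s) - chain_ratio *\<^sub>R ?t - radial H)"
    using FV by (simp_all add: linear_add[OF U] linear_diff[OF U] linear_cmul[OF U] algebra_simps)
  show ?thesis unfolding V
  proof (rule linked_circles_perpendicular[where u' = "U ?t" and v' = "U e3"])
    show "norm (U e3) = 1" "norm (U ?t) = 1" "norm (U e3) = 1" "norm (U (radial (H + s))) = 1"
      unfolding UN using t by simp_all
    show "U ?t \<bullet> U e3 = 0" "U (radial (H + s)) \<bullet> U ?t = 0" "U (radial (H + s)) \<bullet> U e3 = 0"
      unfolding UN using t by simp_all
    show "(F (radial (H + s)) - F (radial H)) \<bullet> U e3 = 0" unfolding FV by (simp add: UN inner_diff_left)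
    show "norm (F (radial (H + s)) + (\<mu> * chain_ratio) *\<^sub>R U ?t - F (radial H)) > \<mu> * chain_ratio"
      unfolding e1 norm_scaleR UN using far \<mu> by simp
    show "norm (F (radial (H + s)) - (\<mu> * chain_ratio) *\<^sub>R U ?t - F (radial H)) < \<mu> * chain_ratio"
      unfolding e1 norm_scaleR UN using near \<mu> by simp
    show "0 < \<mu> * chain_ratio" "0 < \<mu> * chain_ratio" using \<mu> chain_ratio by simp_all
  qed simp
qed

text \<open>Centres at least 29/10 radii apart leave room for a plane orthogonal to the line of
  centres that separates the circles, whatever their normals are.\<close>

lemma far_links_unlinked:
  assumes F: "similarity \<mu> U F" and n: "2 \<le> \<bar>j - i\<bar>" "\<bar>j - i\<bar> \<le> int chain_q - 2"
  shows "\<not> linked_circles (round_circle (F (radial i)) m (\<mu> * chain_ratio)) (round_circle (F (radial j)) m' (\<mu> * chain_ratio))"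
proof (rule not_linked_separated[where d = "F (radial i) - F (radial j)"])
  fix x y assume x: "x \<in> round_circle (F (radial i)) m (\<mu> * chain_ratio)" and y: "y \<in> round_circle (F (radial j)) m' (\<mu> * chain_ratio)"
  let ?d = "F (radial i) - F (radial j)"
  note \<mu> = similarity_pos[OF F]
  have "norm (radial j - radial i) \<ge> 29/10 * chain_ratio" using radial_dist_far[of "j - i" i] n by simp
  then have "\<mu> * norm (radial i - radial j) \<ge> \<mu> * (29/10 * chain_ratio)"
    using \<mu> by (simp add: norm_minus_commute)
  then have nd: "norm ?d \<ge> 29/10 * (\<mu> * chain_ratio)"
    unfolding similarity_diff[OF F] norm_scaleR similarity_norm[OF F] using \<mu> by simp
  have mc: "\<mu> * chain_ratio > 0" using \<mu> chain_ratio by simp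
  have "\<bar>?d \<bullet> (x - F (radial i))\<bar> \<le> norm ?d * (\<mu> * chain_ratio)" "\<bar>?d \<bullet> (y - F (radial j))\<bar> \<le> norm ?d * (\<mu> * chain_ratio)"
    using Cauchy_Schwarz_ineq2[of ?d "x - F (radial i)"] Cauchy_Schwarz_ineq2[of ?d "y - F (radial j)"] x y
    by (auto simp: round_circle_def)
  moreover have "?d \<bullet> (x - y) = ?d \<bullet> ?d + ?d \<bullet> (x - F (radial i)) - ?d \<bullet> (y - F (radial j))"
    by (simp add: inner_diff_right)
  moreover have "?d \<bullet> ?d = norm ?d * norm ?d" by (simp add: power2_norm_eq_inner[symmetric] power2_eq_square)
  moreover have "norm ?d * norm ?d \<ge> norm ?d * (29/10 * (\<mu> * chain_ratio))" using nd by (intro mult_left_mono) auto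
  moreover have "norm ?d * (\<mu> * chain_ratio) > 0"
  proof (rule mult_pos_pos[OF _ mc])
    show "0 < norm ?d" using nd mc by linarith
  qed
  ultimately show "?d \<bullet> (x - y) > 0" by (simp add: algebra_simps)
qed

lemma links_linked_iff:
  assumes F: "similarity \<mu> U F" and i: "i \<in> {1..chain_q}" "j \<in> {1..chain_q}" "i \<noteq> j"
  shows "linked_tori (F ` link_map (int i) ` core_torus) (F ` link_map (int j) ` core_torus) \<longleftrightarrow>
     [int i - int j = 1] (mod int chain_q) \<or> [int i - int j = - 1] (mod int chain_q)"
  unfolding linked_tori_def image_link_torus_facts(2)[OF F]
  using i
proof (cases rule: neighbours_cases)
  case (adj s)
  have "linked_circles (round_circle (F (radial (int i))) (U (link_normal (int i))) (\<mu> * chain_ratio))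
     (round_circle (F (radial (int j))) (U (link_normal (int j))) (\<mu> * chain_ratio))" (is "linked_circles ?C ?D")
  proof (cases "even (int i)")
    case True
    then show ?thesis using neighbours_linked[OF F True adj(1)] unfolding adj by blast
  next
    case False
    have "even (int i + s)" "- s = 1 \<or> - s = -1" using adj(1) False by auto
    from neighbours_linked[OF F this] have l: "linked_circles ?D ?C" unfolding adj by simp
    have "?C = F ` round_circle (radial (int i)) (link_normal (int i)) chain_ratio"
      "?D = F ` round_circle (radial (int j)) (link_normal (int j)) chain_ratio"
      by (simp_all add: similarity_round_circle[OF F])
    moreover have "round_circle (radial (int i)) (link_normal (int i)) chain_ratio \<inter> round_circle (radial (int j)) (link_normal (int j)) chain_ratio = {}"
      using link_circles_far[OF i] chain_ratio by fastforce
    ultimately have "?D \<inter> ?C = {}" using image_Int[OF similarity_inj[OF F]] by (metis Int_commute image_empty)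
    then show ?thesis by (rule linked_circles_commute[OF l])
  qed
  then show "linked_circles ?C ?D \<longleftrightarrow> [int i - int j = 1] (mod int chain_q) \<or> [int i - int j = - 1] (mod int chain_q)"
    using adj(5) by blast
next
  case far
  then show "linked_circles (round_circle (F (radial (int i))) (U (link_normal (int i))) (\<mu> * chain_ratio))
     (round_circle (F (radial (int j))) (U (link_normal (int j))) (\<mu> * chain_ratio)) \<longleftrightarrow>
     [int i - int j = 1] (mod int chain_q) \<or> [int i - int j = - 1] (mod int chain_q)"
    using far_links_unlinked[OF F far(1,2)] by blast
qed

text \<open>Stated for an arbitrary similarity F, so that it applies to every torus of every stage,
  these being the images of the core torus under words in the link maps.\<close>

lemma simple_chain_links:
  assumes F: "similarity \<mu> U F"
  shows "simple_chain (F ` core_torus) chain_q (\<lambda>i. F ` link_map (int i) ` core_torus)"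
proof -
  note \<mu> = similarity_pos[OF F]
  have in_ball: "F ` link_map k ` core_torus \<subseteq> ball (F (radial k)) (\<mu> * (1/100))" for k
    using image_mono[OF link_map_core_subset(1), of F k] unfolding similarity_ball[OF F] .
  have ball_in: "ball (F (radial k)) (\<mu> * (1/100)) \<subseteq> F ` core_torus" for k
    using image_mono[OF link_map_core_subset(2), of F k] unfolding similarity_ball[OF F] .
  show ?thesis unfolding simple_chain_def
  proof (intro conjI ballI impI)
    show "standard_solid_torus (F ` core_torus)" by (rule image_core_torus_facts(1)[OF F])
    show "3 \<le> chain_q" by (simp add: chain_q_def)
    show "standard_solid_torus (F ` link_map (int i) ` core_torus)" for i by (rule image_link_torus_facts(1)[OF F])
    show "F ` link_map (int i) ` core_torus \<inter> F ` link_map (int j) ` core_torus = {}"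
      if "i \<in> {1..chain_q}" "j \<in> {1..chain_q}" "i \<noteq> j" for i j
      using links_disjoint[OF that] image_Int[OF similarity_inj[OF F]] by (metis image_empty)
    show "congruent_sets (F ` link_map (int i) ` core_torus) (F ` link_map (int j) ` core_torus)" for i j
    proof -
      \<comment> \<open>Both maps have ratio \<mu> times \<open>chain_ratio\<close>, so going back
        along one and forward along the other is an isometry.\<close>
      let ?Gi = "F \<circ> link_map (int i)" and ?Gj = "F \<circ> link_map (int j)"
      note Gi = similarity_link_compose[OF F, of "int i"] and Gj = similarity_link_compose[OF F, of "int j"]
      have r: "?Gi (inv ?Gi x) = x" for x using similarity_surj[OF Gi, of x] by (metis f_inv_into_f rangeI)
      have "dist ((?Gj \<circ> inv ?Gi) x) ((?Gj \<circ> inv ?Gi) y) = dist x y" for x y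
        using similarity_dist[OF Gj, of "inv ?Gi x" "inv ?Gi y"] similarity_dist[OF Gi, of "inv ?Gi x" "inv ?Gi y"]
        unfolding r by simp
      moreover have "(?Gj \<circ> inv ?Gi) ` (F ` link_map (int i) ` core_torus) = F ` link_map (int j) ` core_torus"
      proof -
        have "inv ?Gi ` ?Gi ` core_torus = core_torus" by (rule image_inv_f_f[OF similarity_inj[OF Gi]])
        then show ?thesis by (metis image_comp)
      qed
      ultimately show ?thesis unfolding congruent_sets_def by blast
    qed
    show "(\<Union>i\<in>{1..chain_q}. F ` link_map (int i) ` core_torus) \<subseteq> interior (F ` core_torus)"
      using in_ball ball_in interior_maximal[OF ball_in open_ball] by blast
    show "regular_polygon_in (central_circle (F ` core_torus)) chain_q (\<lambda>i. torus_center (F ` link_map (int i) ` core_torus))"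
      unfolding regular_polygon_in_def image_core_torus_facts(2)[OF F] image_link_torus_facts(3)[OF F]
    proof (intro exI conjI ballI)
      show "circle_parametrization (round_circle (F 0) (U e3) \<mu>) (F 0) (circle_path (F 0) \<mu> (U e1) (U e2))"
        using similarity_norm[OF F] \<mu> by (intro circle_parametrization_round_circle) simp_all
      fix i
      have "radial (int i) = circle_path 0 1 e1 e2 (real i / real chain_q)"
        by (simp add: radial_def circle_path_def chain_angle_def)
      then show "F (radial (int i)) = circle_path (F 0) \<mu> (U e1) (U e2) (real i / real chain_q)"
        using similarity_circle_path[OF F, of 0 1 e1 e2] by simp
    qed
    show "linked_tori (F ` link_map (int i) ` core_torus) (F ` link_map (int j) ` core_torus) \<longleftrightarrow>
        [int i - int j = 1] (mod int chain_q) \<or> [int i - int j = - 1] (mod int chain_q)"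
      if "i \<in> {1..chain_q}" "j \<in> {1..chain_q}" "i \<noteq> j" for i j by (rule links_linked_iff[OF F that])
    show "\<exists>a. homotopic_with_canon (\<lambda>_. True) (central_circle (F ` link_map (int i) ` core_torus)) (F ` core_torus) (\<lambda>x. x) (\<lambda>_. a)" for i
    proof -
      let ?k = "int i"
      let ?B = "ball (F (radial ?k)) (\<mu> * (1/100))"
      have "central_circle (F ` link_map ?k ` core_torus) \<subseteq> F ` link_map ?k ` core_torus"
        unfolding image_link_torus_facts(2)[OF F] unfolding image_link_torus[OF F]
        using \<mu> chain_ratio by (intro round_circle_subset_solid_torus) simp
      then have sub: "central_circle (F ` link_map ?k ` core_torus) \<subseteq> ?B" using in_ball by blast
      have "homotopic_with_canon (\<lambda>_. True) (central_circle (F ` link_map ?k ` core_torus)) (F ` core_torus) (\<lambda>x. x) (\<lambda>_. F (radial ?k))"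
      proof (rule homotopic_with_linear)
        fix x assume "x \<in> central_circle (F ` link_map ?k ` core_torus)"
        then have "x \<in> ?B" using sub by blast
        moreover have "F (radial ?k) \<in> ?B" using \<mu> by simp
        ultimately have "closed_segment x (F (radial ?k)) \<subseteq> ?B" by (intro closed_segment_subset convex_ball)
        then show "closed_segment x (F (radial ?k)) \<subseteq> F ` core_torus" using ball_in by blast
      qed (auto intro: continuous_intros)
      then show ?thesis by blast
    qed
  qed
qed

section \<open>The necklace\<close>

definition link :: "nat \<Rightarrow> real^3 \<Rightarrow> real^3" where "link k = link_map (int k)"

definition necklace_stage :: "nat \<Rightarrow> (real^3) set" where
  "necklace_stage n = (chain_step ^^ n) core_torus"

definition necklace :: "(real^3) set" where "necklace = (\<Inter>n. necklace_stage n)"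

lemma similarity_word_map: "\<exists>U. similarity (chain_ratio ^ length w) U (word_map link w)"
proof (induction w)
  case Nil
  have e: "word_map link [] = id" by (auto simp: fun_eq_iff)
  show ?case unfolding e list.size(3) power_0 using similarity_id by blast
next
  case (Cons k w)
  then obtain U where U: "similarity (chain_ratio ^ length w) U (word_map link w)" by blast
  have e: "word_map link (k # w) = link_map (int k) \<circ> word_map link w" by (auto simp: fun_eq_iff link_def)
  have p: "chain_ratio ^ length (k # w) = chain_ratio * chain_ratio ^ length w" by simp
  show ?case unfolding e p using similarity_compose[OF similarity_link_map U] by blast
qed

lemma chain_step_link: "chain_step X = (\<Union>k<chain_q. link k ` X)"
  unfolding chain_step_finite link_def ..

lemma chain_step_funpow: "(chain_step ^^ n) X = (\<Union>w\<in>words chain_q n. word_map link w ` X)"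
proof (induction n)
  case 0
  have "word_map link [] ` X = X" by (simp add: image_def)
  then show ?case by (simp add: words_def)
next
  case (Suc n)
  have "(\<Union>w\<in>words chain_q (Suc n). word_map link w ` X) = (\<Union>k<chain_q. \<Union>w\<in>words chain_q n. word_map link (k # w) ` X)"
    unfolding words_Suc by blast
  also
  have e: "word_map link (k # w) ` X = link k ` word_map link w ` X" for k w by (simp add: image_image)
  have "(\<Union>k<chain_q. \<Union>w\<in>words chain_q n. word_map link (k # w) ` X) = (\<Union>k<chain_q. link k ` (\<Union>w\<in>words chain_q n. word_map link w ` X))"
    by (simp only: image_UN e)
  also have "\<dots> = chain_step ((chain_step ^^ n) X)" unfolding Suc chain_step_link ..
  finally show ?case by simp
qed

lemma chain_step_mono: "X \<subseteq> Y \<Longrightarrow> chain_step X \<subseteq> chain_step Y"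
  unfolding chain_step_def by blast

text \<open>Chains are numbered from 1 to q but the alphabet of the attractor from 0 to q - 1; by
  periodicity index q stands for index 0.\<close>

lemma chain_step_1_q: "chain_step X = (\<Union>k\<in>{1..chain_q}. link_map (int k) ` X)"
proof (intro equalityI subsetI)
  fix x assume "x \<in> chain_step X"
  then obtain k where k: "k < chain_q" "x \<in> link_map (int k) ` X" unfolding chain_step_finite by blast
  have "link_map (int chain_q) = link_map 0" using link_map_periodic[of 0] by simp
  then have "x \<in> link_map (int (if k = 0 then chain_q else k)) ` X" using k by (cases "k = 0") auto
  moreover have "(if k = 0 then chain_q else k) \<in> {1..chain_q}" using k by (auto simp: chain_q_def)
  ultimately show "x \<in> (\<Union>k\<in>{1..chain_q}. link_map (int k) ` X)" by blast
qed (auto simp: chain_step_def)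

lemma link_core_subset: "link k ` core_torus \<subseteq> core_torus"
  unfolding link_def using link_map_core_subset by blast

lemma link_core_disjoint:
  assumes "j < chain_q" "k < chain_q" "j \<noteq> k"
  shows "link j ` core_torus \<inter> link k ` core_torus = {}"
proof -
  define s where "s i = (if i = 0 then chain_q else i)" for i
  have q0: "link_map (int chain_q) = link_map 0" using link_map_periodic[of 0] by simp
  have e: "link_map (int (s i)) = link i" for i using q0 by (auto simp: s_def link_def)
  have "s j \<in> {1..chain_q}" "s k \<in> {1..chain_q}" "s j \<noteq> s k" using assms by (auto simp: s_def chain_q_def)
  from links_disjoint[OF this] show ?thesis unfolding e .
qed

lemma link_inj: "inj (link k)"
  unfolding link_def by (rule similarity_inj[OF similarity_link_map])

lemma necklace_stage_Suc: "necklace_stage (Suc n) = chain_step (necklace_stage n)"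
  by (simp add: necklace_stage_def)

lemma necklace_stage_antimono: "m \<le> n \<Longrightarrow> necklace_stage n \<subseteq> necklace_stage m"
proof -
  have "necklace_stage (Suc n) \<subseteq> necklace_stage n" for n
  proof (induction n)
    case 0
    show ?case using link_core_subset unfolding necklace_stage_Suc chain_step_link by (auto simp: necklace_stage_def)
  next
    case (Suc n)
    from chain_step_mono[OF this] show ?case unfolding necklace_stage_Suc[symmetric] .
  qed
  then show "m \<le> n \<Longrightarrow> necklace_stage n \<subseteq> necklace_stage m" by (rule lift_Suc_antimono_le)
qed

lemma necklace_stage_subset_core: "necklace_stage n \<subseteq> core_torus"
  using necklace_stage_antimono[of 0 n] by (simp add: necklace_stage_def)

lemma core_torus_compact: "compact core_torus"
  unfolding core_torus_def by (rule compact_solid_torus)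

lemma core_torus_nonempty: "core_torus \<noteq> {}"
  using link_map_core_subset(2)[of 0] by (metis centre_in_ball empty_iff subsetD zero_less_divide_1_iff zero_less_numeral)

lemma compact_necklace_stage: "compact (necklace_stage n)"
  unfolding necklace_stage_def chain_step_funpow
proof (intro compact_UN finite_words)
  fix w
  obtain U where "similarity (chain_ratio ^ length w) U (word_map link w)" using similarity_word_map by blast
  then show "compact (word_map link w ` core_torus)"
    by (intro compact_continuous_image core_torus_compact similarity_continuous)
qed

lemma necklace_subset_stage: "necklace \<subseteq> necklace_stage n"
  unfolding necklace_def by blast

text \<open>The delicate inclusion says that a point of the intersection comes from a single link:
  at each stage it lies in some link, and disjointness of the links forces the same letter and the
  same preimage every time.\<close>

lemma necklace_self_similar: "self_similar necklace chain_q link chain_ratio"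
proof -
  have comp: "compact necklace"
    unfolding necklace_def by (intro compact_Inter) (use compact_necklace_stage in auto)
  have ne: "necklace \<noteq> {}"
    unfolding necklace_def
  proof (rule compact_nest)
    show "necklace_stage n \<noteq> {}" for n
      by (induction n) (use core_torus_nonempty in \<open>auto simp: necklace_stage_def chain_step_def\<close>)
  qed (use compact_necklace_stage necklace_stage_antimono in auto)
  have "necklace = (\<Union>k<chain_q. link k ` necklace)"
  proof (intro equalityI subsetI)
    fix x assume "x \<in> (\<Union>k<chain_q. link k ` necklace)"
    then obtain k a where k: "k < chain_q" "a \<in> necklace" "x = link k a" by blast
    have "x \<in> necklace_stage (Suc n)" for n
      unfolding necklace_stage_Suc chain_step_link using k necklace_subset_stage by blast
    then have "x \<in> necklace_stage n" for n using necklace_stage_antimono[of n "Suc n"] by auto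
    then show "x \<in> necklace" by (simp add: necklace_def)
  next
    fix x assume "x \<in> necklace"
    then have x: "x \<in> (\<Union>k<chain_q. link k ` necklace_stage n)" for n
      using necklace_subset_stage[of "Suc n"] unfolding necklace_stage_Suc chain_step_link by blast
    then obtain k a where k: "k < chain_q" "x = link k a" "a \<in> necklace_stage 0" by blast
    have "a \<in> necklace_stage n" for n
    proof -
      obtain j b where j: "j < chain_q" "x = link j b" "b \<in> necklace_stage n" using x by blast
      have "x \<in> link j ` core_torus" "x \<in> link k ` core_torus"
        using j k necklace_stage_subset_core by blast+
      then have "j = k" using link_core_disjoint[OF j(1) k(1)] by blast
      then have "a = b" using j k link_inj by (metis injD)
      then show ?thesis using j by simp
    qed
    then have "a \<in> necklace" by (simp add: necklace_def)
    then show "x \<in> (\<Union>k<chain_q. link k ` necklace)" using k by blast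
  qed
  moreover have "link j ` necklace \<inter> link k ` necklace = {}" if "j < chain_q" "k < chain_q" "j \<noteq> k" for j k
    using link_core_disjoint[OF that] necklace_subset_stage[of 0] unfolding necklace_stage_def by auto
  moreover have "inj_on (link k) necklace" for k using link_inj subset_UNIV by (rule inj_on_subset)
  moreover have "dist (link k x) (link k y) \<le> chain_ratio * dist x y" for k x y
    unfolding link_def similarity_dist[OF similarity_link_map] ..
  ultimately show ?thesis unfolding self_similar_def using comp ne chain_ratio by auto
qed

lemma is_cantor_set_necklace: "is_cantor_set necklace"
  unfolding is_cantor_set_def
  by (rule self_similar_homeomorphic[OF necklace_self_similar self_similar_cantor_set]) (simp add: chain_q_def)

text \<open>The definition of a necklace speaks of components of a stage. A finite disjoint union of
  closed connected sets has no components besides these sets, so a component is one of the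
  tori.\<close>

lemma components_disjoint_closed_Union:
  assumes fin: "finite \<T>" and cl: "\<And>T. T \<in> \<T> \<Longrightarrow> closed T" and con: "\<And>T. T \<in> \<T> \<Longrightarrow> connected T" and dj: "disjoint \<T>"
    and C: "C \<in> components (\<Union>\<T>)"
  shows "C \<in> \<T>"
proof -
  have Cne: "C \<noteq> {}" "C \<subseteq> \<Union>\<T>" "connected C"
    using in_components_nonempty[OF C] in_components_subset[OF C] in_components_connected[OF C] by auto
  then obtain T x where T: "T \<in> \<T>" "x \<in> C" "x \<in> T" by blast
  define R where "R = \<Union>(\<T> - {T})"
  have "closed R" unfolding R_def using fin cl by (intro closed_Union) auto
  moreover have TR: "T \<inter> R = {}" using dj T(1) unfolding R_def disjoint_def by blast
  moreover have "C \<subseteq> T \<union> R" using Cne T by (auto simp: R_def)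
  ultimately have "C \<inter> R = {}"
    using Cne(3) cl[OF T(1)] T(2,3) unfolding connected_closed by blast
  then have "C \<subseteq> T" using \<open>C \<subseteq> T \<union> R\<close> by blast
  moreover have "T \<subseteq> C" using components_maximal[OF C con[OF T(1)]] T by blast
  ultimately show ?thesis using T(1) by auto
qed

definition stage_tori :: "nat \<Rightarrow> (real^3) set set" where
  "stage_tori n = (\<lambda>w. word_map link w ` core_torus) ` words chain_q n"

lemma stage_tori:
  shows "finite (stage_tori n)" "necklace_stage n = \<Union>(stage_tori n)" "disjoint (stage_tori n)"
    and "\<And>T. T \<in> stage_tori n \<Longrightarrow> standard_solid_torus T \<and> closed T \<and> connected T"
proof -
  show "finite (stage_tori n)" by (simp add: stage_tori_def finite_words)
  show "necklace_stage n = \<Union>(stage_tori n)" by (simp add: stage_tori_def necklace_stage_def chain_step_funpow)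
  show "disjoint (stage_tori n)"
    unfolding disjoint_def
  proof (intro ballI impI)
    fix a b assume "a \<in> stage_tori n" "b \<in> stage_tori n" "a \<noteq> b"
    then obtain v w where "v \<in> words chain_q n" "w \<in> words chain_q n" "v \<noteq> w" "a = word_map link v ` core_torus" "b = word_map link w ` core_torus"
      unfolding stage_tori_def by blast
    then show "a \<inter> b = {}"
      using word_map_images_disjoint[of chain_q core_torus link v n w] link_core_subset link_core_disjoint inj_on_subset[OF link_inj subset_UNIV] by blast
  qed
  fix T assume "T \<in> stage_tori n"
  then obtain w where T: "T = word_map link w ` core_torus" unfolding stage_tori_def by blast
  obtain U where U: "similarity (chain_ratio ^ length w) U (word_map link w)" using similarity_word_map by blast
  have "compact T" unfolding T by (intro compact_continuous_image core_torus_compact similarity_continuous[OF U])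
  moreover have "connected T" unfolding T core_torus_def
    by (intro connected_continuous_image connected_solid_torus similarity_continuous[OF U]) auto
  ultimately show "standard_solid_torus T \<and> closed T \<and> connected T"
    using image_core_torus_facts(1)[OF U] compact_imp_closed unfolding T by blast
qed

text \<open>Reads the iteration from the inside: each torus of stage n, given by a word, is replaced
  by the image of the first chain.\<close>

lemma necklace_stage_Suc_words: "necklace_stage (Suc n) = (\<Union>w\<in>words chain_q n. word_map link w ` chain_step core_torus)"
  unfolding necklace_stage_def funpow_Suc_right o_def chain_step_funpow ..

lemma chain_step_core_subset: "chain_step core_torus \<subseteq> core_torus"
  using link_core_subset unfolding chain_step_link by blast

lemma antoine_necklace_necklace: "antoine_necklace necklace"
  unfolding antoine_necklace_def
\<comment> \<open>Stages of a necklace are counted from 1, so M i is stage i - 1 and M 1 is the core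
  torus.\<close>
proof (rule conjI[OF is_cantor_set_necklace], rule exI[of _ "\<lambda>i. necklace_stage (i - 1)"], intro conjI allI impI ballI)
  show "necklace = (\<Inter>i\<in>{1..}. necklace_stage (i - 1))"
  proof (intro equalityI subsetI)
    fix x assume x: "x \<in> (\<Inter>i\<in>{1..}. necklace_stage (i - 1))"
    have "x \<in> necklace_stage n" for n
    proof -
      have "Suc n \<in> {1..}" by simp
      then have "x \<in> necklace_stage (Suc n - 1)" using x by blast
      then show ?thesis by simp
    qed
    then show "x \<in> necklace" by (simp add: necklace_def)
  qed (auto simp: necklace_def)
  show "\<exists>\<T>. finite \<T> \<and> (\<forall>T\<in>\<T>. standard_solid_torus T) \<and> disjoint \<T> \<and> necklace_stage (i - 1) = \<Union>\<T>" for i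
    using stage_tori(1-3)[of "i - 1"] stage_tori(4)[of _ "i - 1"] by blast
  show "standard_solid_torus (necklace_stage (1 - 1))"
    using image_core_torus_facts(1)[OF similarity_id] by (simp add: necklace_stage_def)
  show "necklace_stage (i + 1 - 1) \<subseteq> interior (necklace_stage (i - 1))" if i: "1 \<le> i" for i
  proof -
    obtain n where n: "i = Suc n" using i by (cases i) auto
    have "word_map link w ` chain_step core_torus \<subseteq> interior (necklace_stage n)" if w: "w \<in> words chain_q n" for w
    proof -
      obtain U where U: "similarity (chain_ratio ^ length w) U (word_map link w)" using similarity_word_map by blast
      have "word_map link w ` chain_step core_torus = (\<Union>k\<in>{1..chain_q}. word_map link w ` link_map (int k) ` core_torus)"
        unfolding chain_step_1_q by blast
      also have "\<dots> \<subseteq> interior (word_map link w ` core_torus)"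
        using simple_chain_links[OF U] unfolding simple_chain_def by blast
      also have "\<dots> \<subseteq> interior (necklace_stage n)"
        using w by (intro interior_mono) (auto simp: necklace_stage_def chain_step_funpow)
      finally show ?thesis .
    qed
    then show ?thesis using necklace_stage_Suc_words[of n] n by auto
  qed
  show "\<exists>q S. simple_chain T q S \<and> necklace_stage (i + 1 - 1) \<inter> T = (\<Union>k\<in>{1..q}. S k)"
    if i: "1 \<le> i" and T: "T \<in> components (necklace_stage (i - 1))" for i T
  proof -
    obtain n where n: "i = Suc n" using i by (cases i) auto
    have "T \<in> stage_tori n"
      using components_disjoint_closed_Union[OF stage_tori(1) _ _ stage_tori(3), of n T] stage_tori(4)[of _ n] T
      unfolding n stage_tori(2) by simp
    then obtain w where w: "w \<in> words chain_q n" "T = word_map link w ` core_torus" unfolding stage_tori_def by blast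
    obtain U where U: "similarity (chain_ratio ^ length w) U (word_map link w)" using similarity_word_map by blast
    have "necklace_stage (Suc n) \<inter> T = word_map link w ` chain_step core_torus"
    proof (intro equalityI subsetI)
      fix x assume x: "x \<in> necklace_stage (Suc n) \<inter> T"
      then obtain v where v: "v \<in> words chain_q n" "x \<in> word_map link v ` chain_step core_torus"
        unfolding necklace_stage_Suc_words by blast
      then have "x \<in> word_map link v ` core_torus" using chain_step_core_subset by blast
      then have "v = w" using x w v(1)
          word_map_images_disjoint[of chain_q core_torus link v n w x] link_core_subset link_core_disjoint inj_on_subset[OF link_inj subset_UNIV] by blast
      then show "x \<in> word_map link w ` chain_step core_torus" using v by simp
    next
      fix x assume "x \<in> word_map link w ` chain_step core_torus"
      then show "x \<in> necklace_stage (Suc n) \<inter> T"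
        using chain_step_core_subset w unfolding necklace_stage_Suc_words by blast
    qed
    also have "\<dots> = (\<Union>k\<in>{1..chain_q}. word_map link w ` link_map (int k) ` core_torus)"
      unfolding chain_step_1_q by blast
    finally have "simple_chain T chain_q (\<lambda>k. word_map link w ` link_map (int k) ` core_torus) \<and>
      necklace_stage (i + 1 - 1) \<inter> T = (\<Union>k\<in>{1..chain_q}. word_map link w ` link_map (int k) ` core_torus)"
      using simple_chain_links[OF U] w n by simp
    then show ?thesis by blast
  qed
qed

section \<open>Connectedness of the shadows\<close>

definition shadow_stage :: "nat \<Rightarrow> (real^3) set" where
  "shadow_stage n = (chain_step ^^ n) (cball 0 (101/100))"

lemma shadow_linked_stage: "shadow_linked (shadow_stage n)"
  by (induction n) (simp_all add: shadow_stage_def shadow_linked_cball shadow_linked_step)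

lemma necklace_words: "necklace = (\<Union>w\<in>words chain_q n. word_map link w ` necklace)"
  by (rule word_map_cover[OF necklace_self_similar])

lemma necklace_subset_cball: "necklace \<subseteq> cball 0 (101/100)"
  using necklace_subset_stage[of 0] core_torus_subset by (simp add: necklace_stage_def)

lemma necklace_subset_shadow_stage: "necklace \<subseteq> shadow_stage n"
proof -
  have "(\<Union>w\<in>words chain_q n. word_map link w ` necklace) \<subseteq> shadow_stage n"
    unfolding shadow_stage_def chain_step_funpow by (intro UN_mono image_mono necklace_subset_cball order_refl)
  then show ?thesis unfolding necklace_words[of n, symmetric] .
qed

text \<open>A point of the stage and some point of the necklace lie in the image of the starting
  ball under the same word of length n; 3 exceeds the diameter of that ball.\<close>

lemma shadow_stage_near:
  assumes p: "p \<in> shadow_stage n" shows "\<exists>a\<in>necklace. dist p a \<le> chain_ratio ^ n * 3"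
proof -
  obtain w b where w: "w \<in> words chain_q n" "b \<in> cball 0 (101/100)" "p = word_map link w b"
    using p unfolding shadow_stage_def chain_step_funpow by blast
  have len: "length w = n" "set w \<subseteq> {..<chain_q}" using w(1) by (auto simp: words_def)
  obtain U where "similarity (chain_ratio ^ length w) U (word_map link w)" using similarity_word_map by blast
  note U = this[unfolded len(1)]
  obtain a where a: "a \<in> necklace" using necklace_self_similar by (auto simp: self_similar_def)
  have "norm b \<le> 101/100" "norm a \<le> 101/100" using w(2) a necklace_subset_cball by (auto simp: dist_norm)
  then have "dist b a \<le> 3" using norm_triangle_ineq4[of b a] by (simp add: dist_norm)
  then have "dist p (word_map link w a) \<le> chain_ratio ^ n * 3"
    unfolding w(3) similarity_dist[OF U] using chain_ratio by (intro mult_left_mono) auto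
  moreover have "word_map link w a \<in> necklace" by (rule word_map_in[OF necklace_self_similar len(2) a])
  ultimately show ?thesis by blast
qed

text \<open>If X fell into two parts, these would be compact and at distance \<delta> from each
  other. The \<delta>/2-neighbourhoods of the parts would then disconnect any Y that contains X and
  stays within \<delta>/2 of it. Applied to shadows of stages.\<close>

lemma connected_approximable:
  fixes X :: "'a::euclidean_space set"
  assumes X: "compact X"
    and approx: "\<And>e. e > 0 \<Longrightarrow> \<exists>Y. connected Y \<and> X \<subseteq> Y \<and> (\<forall>y\<in>Y. \<exists>x\<in>X. dist y x < e)"
  shows "connected X"
  unfolding connected_def
proof
  assume "\<exists>A B. open A \<and> open B \<and> X \<subseteq> A \<union> B \<and> A \<inter> B \<inter> X = {} \<and> A \<inter> X \<noteq> {} \<and> B \<inter> X \<noteq> {}"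
  then obtain A B where AB: "open A" "open B" "X \<subseteq> A \<union> B" "A \<inter> B \<inter> X = {}" "A \<inter> X \<noteq> {}" "B \<inter> X \<noteq> {}" by blast
  have cA: "compact (X - B)" and cB: "compact (X - A)" using X AB by (simp_all add: compact_diff)
  have dj: "(X - B) \<inter> (X - A) = {}" and ne: "X - B \<noteq> {}" "X - A \<noteq> {}" using AB by blast+
  obtain \<delta> where \<delta>: "\<delta> > 0" "\<And>x y. x \<in> X - B \<Longrightarrow> y \<in> X - A \<Longrightarrow> \<delta> \<le> dist x y"
    using separate_compact_closed[OF cA compact_imp_closed[OF cB] dj] by blast
  obtain Y where Y: "connected Y" "X \<subseteq> Y" "\<And>y. y \<in> Y \<Longrightarrow> \<exists>x\<in>X. dist y x < \<delta> / 2"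
    using approx[of "\<delta> / 2"] \<delta> by auto
  define V W where "V = (\<Union>x\<in>X - B. ball x (\<delta> / 2))" and "W = (\<Union>x\<in>X - A. ball x (\<delta> / 2))"
  have "open V" "open W" by (auto simp: V_def W_def)
  moreover have "Y \<subseteq> V \<union> W"
  proof
    fix y assume "y \<in> Y"
    then obtain x where x: "x \<in> X" "dist y x < \<delta> / 2" using Y by blast
    then have "x \<in> X - B \<or> x \<in> X - A" using AB by blast
    then show "y \<in> V \<union> W" using x unfolding V_def W_def by (auto simp: dist_commute)
  qed
  moreover have "V \<inter> W \<inter> Y = {}"
  proof (rule ccontr)
    assume "V \<inter> W \<inter> Y \<noteq> {}"
    then obtain y where y: "y \<in> V" "y \<in> W" by blast
    obtain x where "x \<in> X - B" "dist x y < \<delta> / 2" using y(1) unfolding V_def by auto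
    moreover obtain x' where "x' \<in> X - A" "dist x' y < \<delta> / 2" using y(2) unfolding W_def by auto
    ultimately show False using \<delta>(2)[of x x'] dist_triangle2[of x x' y] by auto
  qed
  moreover have "X - B \<subseteq> V \<inter> Y" "X - A \<subseteq> W \<inter> Y"
    using Y(2) \<delta>(1) unfolding V_def W_def by (force intro: centre_in_ball[THEN iffD2])+
  then have "V \<inter> Y \<noteq> {}" "W \<inter> Y \<noteq> {}" using ne by blast+
  ultimately show False using connectedD[OF Y(1), of V W] by (simp add: Int_assoc)
qed

lemma flatten_dist:
  assumes "norm d = 1" shows "dist (flatten d x) (flatten d y) \<le> dist x y"
proof -
  have d: "d \<bullet> d = 1" using assms by (simp add: norm_eq_1)
  let ?z = "x - y"
  have e: "flatten d x - flatten d y = flatten d ?z" by (simp add: flatten_def inner_diff_left algebra_simps)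
  have "norm (flatten d ?z) ^ 2 = norm ?z ^ 2 - (?z \<bullet> d)\<^sup>2"
    unfolding power2_norm_eq_inner flatten_def using d
    by (simp add: inner_diff_left[of ?z] inner_diff_right[of _ ?z] inner_commute[of d ?z] power2_eq_square del: inner_diff_left inner_diff_right)
  then have "norm (flatten d ?z) ^ 2 \<le> norm ?z ^ 2" by simp
  then show ?thesis unfolding dist_norm e by (rule power2_le_imp_le) simp
qed

lemma compact_flatten: "compact X \<Longrightarrow> compact (flatten d ` X)"
  by (intro compact_continuous_image linear_continuous_on linear_conv_bounded_linear[THEN iffD1] linear_flatten)

lemma necklace_compact: "compact necklace"
  using necklace_self_similar by (simp add: self_similar_def)

lemma connected_flatten_necklace:
  assumes d: "norm d = 1" shows "connected (flatten d ` necklace)"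
proof (rule connected_approximable[OF compact_flatten[OF necklace_compact]])
  fix e :: real assume e: "e > 0"
  have "(\<lambda>n. chain_ratio ^ n * 3) \<longlonglongrightarrow> 0 * 3"
    by (intro tendsto_intros LIMSEQ_realpow_zero) (use chain_ratio in auto)
  then have "eventually (\<lambda>n. chain_ratio ^ n * 3 < e) sequentially" using e by (intro order_tendstoD) auto
  then obtain n where n: "chain_ratio ^ n * 3 < e" unfolding eventually_sequentially by blast
  have "connected (flatten d ` shadow_stage n)"
    using shadow_linked_stage[of n] d by (auto simp: shadow_linked_def intro: path_connected_imp_connected)
  moreover have "flatten d ` necklace \<subseteq> flatten d ` shadow_stage n" using necklace_subset_shadow_stage by blast
  moreover have "\<exists>x\<in>flatten d ` necklace. dist y x < e" if y: "y \<in> flatten d ` shadow_stage n" for y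
  proof -
    obtain p where p: "p \<in> shadow_stage n" "y = flatten d p" using y by blast
    obtain a where a: "a \<in> necklace" "dist p a \<le> chain_ratio ^ n * 3" using shadow_stage_near[OF p(1)] by blast
    then have "dist y (flatten d a) < e" using flatten_dist[OF d, of p a] n p(2) by simp
    then show ?thesis using a by blast
  qed
  ultimately show "\<exists>Y. connected Y \<and> flatten d ` necklace \<subseteq> Y \<and> (\<forall>y\<in>Y. \<exists>x\<in>flatten d ` necklace. dist y x < e)"
    by blast
qed

section \<open>Null shadows, and the passage to orthogonal projections\<close>

lemma necklace_cover:
  "\<exists>W. finite W \<and> card W \<le> chain_q ^ n \<and> necklace \<subseteq> (\<Union>c\<in>W. cball c (101/100 * chain_ratio ^ n))"
proof (intro exI conjI)
  let ?W = "(\<lambda>w. word_map link w 0) ` words chain_q n"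
  show "finite ?W" by (simp add: finite_words)
  have "card ?W \<le> card (words chain_q n)" by (rule card_image_le[OF finite_words])
  also have "\<dots> = chain_q ^ n" unfolding words_def by (simp add: card_lists_length_eq)
  finally show "card ?W \<le> chain_q ^ n" .
  have "word_map link w ` necklace \<subseteq> cball (word_map link w 0) (101/100 * chain_ratio ^ n)" if w: "w \<in> words chain_q n" for w
  proof -
    have len: "length w = n" using w by (simp add: words_def)
    obtain U where "similarity (chain_ratio ^ length w) U (word_map link w)" using similarity_word_map by blast
    from similarity_cball[OF this] show ?thesis using image_mono[OF necklace_subset_cball, of "word_map link w"]
      by (simp add: len mult.commute)
  qed
  then have "(\<Union>w\<in>words chain_q n. word_map link w ` necklace) \<subseteq> (\<Union>c\<in>?W. cball c (101/100 * chain_ratio ^ n))"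
    by (intro UN_least) blast
  then show "necklace \<subseteq> (\<Union>c\<in>?W. cball c (101/100 * chain_ratio ^ n))"
    unfolding necklace_words[of n, symmetric] .
qed

text \<open>Numerically, 16000 / 3000^2 is far below 1.\<close>

lemma necklace_projection_negligible:
  assumes "norm u = 1" "norm v = 1"
  shows "negligible ((\<lambda>x. (x \<bullet> u, x \<bullet> v)) ` necklace)"
proof (rule negligible_planar_projection[where \<rho> = "101/100" and s = chain_ratio and q = chain_q])
  have "chain_ratio * chain_ratio \<le> 1/3000 * (1/3000)" using chain_ratio by (intro mult_mono) auto
  then show "real chain_q * chain_ratio\<^sup>2 < 1" by (simp add: chain_q_def power2_eq_square)
qed (use assms chain_ratio necklace_cover in auto)

text \<open>Uniqueness holds because two candidates y and y', each tested against the other, give |y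
  - y'|^2 = 0. The projection is thus the shadow moved by b d, and the offset of the plane is
  immaterial.\<close>

lemma orthogonal_projection_hyperplane:
  assumes d: "norm d = 1" shows "orthogonal_projection {x. d \<bullet> x = b} x = flatten d x + b *\<^sub>R d"
  unfolding orthogonal_projection_def
proof (rule the_equality)
  have dd: "d \<bullet> d = 1" using d by (simp add: norm_eq_1)
  let ?y = "flatten d x + b *\<^sub>R d"
  have xy: "x - ?y = (x \<bullet> d - b) *\<^sub>R d" by (simp add: flatten_def algebra_simps)
  have y: "d \<bullet> ?y = b" using dd by (simp add: flatten_def inner_add_right inner_diff_right inner_commute[of d x])
  then show *: "?y \<in> {x. d \<bullet> x = b} \<and> (\<forall>z\<in>{x. d \<bullet> x = b}. orthogonal (x - ?y) (z - ?y))"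
    unfolding xy orthogonal_def by (simp add: inner_diff_right)
  fix y' assume y': "y' \<in> {x. d \<bullet> x = b} \<and> (\<forall>z\<in>{x. d \<bullet> x = b}. orthogonal (x - y') (z - y'))"
  have "orthogonal (x - y') (?y - y')" "orthogonal (x - ?y) (y' - ?y)" using y' * by blast+
  then have "(x - y') \<bullet> (?y - y') - (x - ?y) \<bullet> (?y - y') = 0"
    unfolding orthogonal_def by (simp add: inner_diff_right)
  then have "(?y - y') \<bullet> (?y - y') = 0" by (simp add: inner_diff_left algebra_simps)
  then show "y' = ?y" by simp
qed

text \<open>Two points might be aligned with d, so three are taken, near e1, e2 and - e1. If their
  shadows coincided, a - c and b - c would both be multiples of d, but the determinant of their
  first two coordinates is not zero.\<close>

lemma flatten_necklace_not_singleton: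
  assumes d: "norm d = 1"
  shows "\<exists>x\<in>necklace. \<exists>y\<in>necklace. flatten d x \<noteq> flatten d y"
proof (rule ccontr)
  assume "\<not> ?thesis"
  then have eq: "flatten d x = flatten d y" if "x \<in> necklace" "y \<in> necklace" for x y using that by blast
  have ex: "\<exists>a\<in>necklace. norm (a - radial (int k)) \<le> 1/100" if k: "k < chain_q" for k
  proof -
    obtain a where a: "a \<in> necklace" using necklace_self_similar by (auto simp: self_similar_def)
    have "link k a \<in> necklace" using word_map_in[OF necklace_self_similar, of "[k]" a] k a by simp
    moreover have "link k a \<in> ball (radial (int k)) (1/100)"
    proof -
      have "a \<in> core_torus" using a necklace_subset_stage[of 0] by (auto simp: necklace_stage_def)
      then show ?thesis using link_map_core_subset(1)[of "int k"] unfolding link_def by blast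
    qed
    ultimately show ?thesis by (intro bexI[of _ "link k a"]) (auto simp: dist_norm norm_minus_commute)
  qed
  \<comment> \<open>Indices of a start, a quarter turn and a half turn on 16000 vertices.\<close>
  have "0 < chain_q" "4000 < chain_q" "8000 < chain_q" by (simp_all add: chain_q_def)
  from ex[OF this(1)] ex[OF this(2)] ex[OF this(3)]
  obtain a b c where a: "a \<in> necklace" "norm (a - radial (int 0)) \<le> 1/100"
    and b: "b \<in> necklace" "norm (b - radial (int 4000)) \<le> 1/100"
    and c: "c \<in> necklace" "norm (c - radial (int 8000)) \<le> 1/100" by blast
  have r: "radial (int 0) = e1" "radial (int 4000) = e2" "radial (int 8000) = - e1"
    by (simp_all add: radial_def chain_angle_def chain_q_def)
  have near: "\<bar>x \<bullet> e - y \<bullet> e\<bar> \<le> 1/100" if "norm (x - y) \<le> 1/100" "norm e = 1" for x y e :: "real^3"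
  proof -
    have "\<bar>(x - y) \<bullet> e\<bar> \<le> norm (x - y) * norm e" by (rule Cauchy_Schwarz_ineq2)
    then show ?thesis using that by (simp add: inner_diff_left)
  qed
  note a = a(1) a(2)[unfolded r] and b = b(1) b(2)[unfolded r] and c = c(1) c(2)[unfolded r]
  have ac: "a - c = ((a - c) \<bullet> d) *\<^sub>R d" and bc: "b - c = ((b - c) \<bullet> d) *\<^sub>R d"
    using eq[OF a(1) c(1)] eq[OF b(1) c(1)] by (simp_all add: flatten_def inner_diff_left algebra_simps)
  have "((s *\<^sub>R d) \<bullet> e1) * ((t *\<^sub>R d) \<bullet> e2) = ((s *\<^sub>R d) \<bullet> e2) * ((t *\<^sub>R d) \<bullet> e1)" for s t
    by simp
  then have det: "((a - c) \<bullet> e1) * ((b - c) \<bullet> e2) = ((a - c) \<bullet> e2) * ((b - c) \<bullet> e1)"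
    using ac bc by metis
  have bounds: "\<bar>a \<bullet> e1 - 1\<bar> \<le> 1/100" "\<bar>b \<bullet> e1\<bar> \<le> 1/100" "\<bar>c \<bullet> e1 + 1\<bar> \<le> 1/100"
    "\<bar>a \<bullet> e2\<bar> \<le> 1/100" "\<bar>b \<bullet> e2 - 1\<bar> \<le> 1/100" "\<bar>c \<bullet> e2\<bar> \<le> 1/100"
    using near[OF a(2), of e1] near[OF b(2), of e1] near[OF c(2), of e1] near[OF a(2), of e2] near[OF b(2), of e2] near[OF c(2), of e2]
    by simp_all
  have "1 \<le> (a - c) \<bullet> e1" unfolding inner_diff_left using bounds(1,3) by linarith
  moreover have "1/2 \<le> (b - c) \<bullet> e2" unfolding inner_diff_left using bounds(5,6) by linarith
  ultimately have lower: "1 * (1/2) \<le> ((a - c) \<bullet> e1) * ((b - c) \<bullet> e2)" by (intro mult_mono) simp_all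
  have "\<bar>(a - c) \<bullet> e2\<bar> \<le> 1/50" unfolding inner_diff_left using bounds(4,6) by linarith
  moreover have "\<bar>(b - c) \<bullet> e1\<bar> \<le> 2" unfolding inner_diff_left using bounds(2,3) by linarith
  ultimately have "\<bar>(a - c) \<bullet> e2\<bar> * \<bar>(b - c) \<bullet> e1\<bar> \<le> 1/50 * 2"
    by (intro mult_mono) simp_all
  then have "((a - c) \<bullet> e2) * ((b - c) \<bullet> e1) \<le> 1/50 * 2"
    using abs_ge_self[of "((a - c) \<bullet> e2) * ((b - c) \<bullet> e1)"] unfolding abs_mult by (rule order_trans[rotated])
  then show False using lower det by linarith
qed

theorem theorem2p8:
  shows "\<exists>A :: (real^3) set. antoine_necklace A \<and>
    (\<forall>P. is_plane P \<longrightarrow>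
       connected (orthogonal_projection P ` A) \<and>
       has_covering_dim (top_of_set (orthogonal_projection P ` A)) 1)"
proof (intro exI[of _ necklace] conjI allI impI antoine_necklace_necklace)
  fix P :: "(real^3) set" assume "is_plane P"
  then obtain d b where d: "norm d = 1" and P: "P = {x. d \<bullet> x = b}" by (rule is_planeE)
  let ?X = "orthogonal_projection P ` necklace"
  have X: "?X = (\<lambda>y. b *\<^sub>R d + y) ` flatten d ` necklace"
    unfolding P orthogonal_projection_hyperplane[OF d] by (simp add: image_image add.commute)
  show con: "connected ?X"
    unfolding X by (intro connected_continuous_image connected_flatten_necklace d continuous_intros)
  have comp: "compact ?X" unfolding X by (intro compact_continuous_image compact_flatten necklace_compact continuous_intros)
  obtain u v where uv: "norm u = 1" "norm v = 1" "u \<bullet> v = 0" "d \<bullet> u = 0" "d \<bullet> v = 0" "v = cross3 d u"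
    using ex_orthonormal_pair[OF d] .
  have dd: "d \<bullet> d = 1" using d by (simp add: norm_eq_1)
  have "covering_dim_le (top_of_set ?X) 1"
  \<comment> \<open>The coordinates u and v span the directions of the plane, so the distance of two
    points in it is bounded by the sum of their coordinate differences.\<close>
  proof (rule covering_dim_le_1_planar[where f = "\<lambda>x. x \<bullet> u" and g = "\<lambda>x. x \<bullet> v"])
    show "compact ?X" by (rule comp)
    fix x y assume xy: "x \<in> ?X" "y \<in> ?X"
    have "(x - y) \<bullet> d = 0" using xy dd unfolding X by (auto simp: flatten_def inner_diff_left inner_add_left)
    then have "x - y = ((x - y) \<bullet> u) *\<^sub>R u + ((x - y) \<bullet> v) *\<^sub>R v"
      using orthonormal_expansion(1)[OF d uv(1,4), of "x - y"] uv(6) by simp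
    then have "norm (x - y) \<le> norm (((x - y) \<bullet> u) *\<^sub>R u) + norm (((x - y) \<bullet> v) *\<^sub>R v)"
      by (metis norm_triangle_ineq)
    then show "dist x y \<le> \<bar>x \<bullet> u - y \<bullet> u\<bar> + \<bar>x \<bullet> v - y \<bullet> v\<bar>"
      using uv by (simp add: dist_norm inner_diff_left)
  next
    have "(\<lambda>x. (x \<bullet> u, x \<bullet> v)) ` ?X = (\<lambda>x. (x \<bullet> u, x \<bullet> v)) ` necklace"
      unfolding X using uv by (simp add: image_image inner_add_left flatten_def inner_diff_left)
    then show "negligible ((\<lambda>x. (x \<bullet> u, x \<bullet> v)) ` ?X)" using necklace_projection_negligible uv by simp
  qed (auto intro!: continuous_intros)
  moreover obtain x y where "x \<in> ?X" "y \<in> ?X" "x \<noteq> y"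
  proof -
    obtain x y where "x \<in> necklace" "y \<in> necklace" "flatten d x \<noteq> flatten d y"
      using flatten_necklace_not_singleton[OF d] by blast
    then show thesis using that[of "b *\<^sub>R d + flatten d x" "b *\<^sub>R d + flatten d y"] unfolding X by auto
  qed
  moreover have "\<not> covering_dim_le (top_of_set ?X) 0" using not_covering_dim_le_0[OF con] calculation by blast
  ultimately show "has_covering_dim (top_of_set ?X) 1" unfolding has_covering_dim_def by auto
qed

end
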